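(* Let $J_n$ be the $n\times n$ ($n\ge2$) Jordan matrix with eigenvalue $1$. Then every conformal map $F:(\mathbb R^n,D_{J_n})\to(\mathbb R^n,D_{J_n})$ is the boundary map of an isometry $G_{J_n}\to G_{J_n}$.
   Context: $J_n=I_n+N$, where $N$ has $1$'s on the superdiagonal and $0$'s elsewhere. $G_{J_n}=\mathbb R^n\rtimes\mathbb R$ is the Lie group with group law $(x_1,t_1)\cdot(x_2,t_2)=(x_1+e^{t_1J_n}x_2,\,t_1+t_2)$, equipped with the left invariant Riemannian metric given by the standard inner product at the identity; it is Gromov hyperbolic. For each $x\in\mathbb R^n$ the vertical line $\gamma_x(t)=(x,t)$ is a geodesic; all $\gamma_x$ are asymptotic as $t\to+\infty$ to a common point $\xi_0\in\partial G_{J_n}$, and $x\mapsto\gamma_x(-\infty)$ identifies $\mathbb R^n$ with $\partial G_{J_n}\setminus\{\xi_0\}$. The boundary map of an isometry whose extension fixes $\xi_0$ is the induced map on $\mathbb R^n=\partial G_{J_n}\setminus\{\xi_0\}$. $D_{J_n}$ is the quasimetric on $\mathbb R^n$ with $D_{J_n}(x,x)=0$ and, for $x\neq y$, $D_{J_n}(x,y)=e^t$ where $t$ is the smallest real number with $|e^{-tJ_n}(x-y)|=1$ ($|\cdot|$ Euclidean). A bijection $F:X\to Y$ between quasimetric spaces is quasisymmetric if for some homeomorphism $\eta:[0,\infty)\to[0,\infty)$, $\frac{\rho(F(x),F(y))}{\rho(F(x),F(z))}\le\eta\left(\frac{\rho(x,y)}{\rho(x,z)}\right)$ for all distinct triples.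 For a bijection $g:(X_1,\rho_1)\to(X_2,\rho_2)$ such that, for each fixed $x\in X_1$, $\rho_1(y,x)\to0$ if and only if $\rho_2(g(y),g(x))\to0$, set for $x\in X_1$, $r>0$: $L_g(x,r)=\sup\{\rho_2(g(x),g(x')):\rho_1(x,x')\le r\}$, $l_g(x,r)=\inf\{\rho_2(g(x),g(x')):\rho_1(x,x')\ge r\}$, $L_g(x)=\limsup_{r\to0}L_g(x,r)/r$, $l_g(x)=\liminf_{r\to0}l_g(x,r)/r$. For quasimetric spaces $X,Y$ of finite Hausdorff dimension, let $\mathcal H_X,\mathcal H_Y$ be their Hausdorff measures (in the dimension equal to the Hausdorff dimension of $X$, resp. $Y$). A quasisymmetric map $f:X\to Y$ is conformal if $L_f(x)=l_f(x)\in(0,\infty)$ for $\mathcal H_X$-almost every $x\in X$ and $L_{f^{-1}}(y)=l_{f^{-1}}(y)\in(0,\infty)$ for $\mathcal H_Y$-almost every $y\in Y$. *)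

theory Defs
  imports "HOL-Analysis.Analysis"
begin

section \<open>Matrix exponential and the Jordan matrix\<close>

primrec matrix_power :: "real^'n^'n \<Rightarrow> nat \<Rightarrow> real^'n^'n" where
  "matrix_power A 0 = mat 1"
| "matrix_power A (Suc k) = A ** matrix_power A k"

definition matrix_exp :: "real^'n^'n \<Rightarrow> real^'n^'n" where
  "matrix_exp A = (\<Sum>k. (1 / fact k) *\<^sub>R matrix_power A k)"

text \<open>The index type is a finite linear order standing for 1 < ... < n with n = CARD('n);
  the superdiagonal consists of the entries (i,j) with j the immediate successor of i.\<close>

definition jordan_matrix :: "real^('n::{finite,linorder})^('n::{finite,linorder})" where
  "jordan_matrix = mat 1 + (\<chi> i j. if i < j \<and> {i<..<j} = {} then 1 else 0)"


section \<open>The group and its left invariant Riemannian metric\<close>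

definition G_mult ::
  "real^'n^'n \<Rightarrow> (real^'n) \<times> real \<Rightarrow> (real^'n) \<times> real \<Rightarrow> (real^'n) \<times> real" where
  "G_mult A p q = (fst p + matrix_exp (snd p *\<^sub>R A) *v fst q, snd p + snd q)"

definition G_inverse :: "real^'n^'n \<Rightarrow> (real^'n) \<times> real \<Rightarrow> (real^'n) \<times> real" where
  "G_inverse A p = (- (matrix_exp ((- snd p) *\<^sub>R A) *v fst p), - snd p)"

text \<open>Tangent vectors at p are carried to the identity by the differential of left translation
  by the inverse of p; the inner product on the product type is the standard one.\<close>

definition G_metric ::
  "real^'n^'n \<Rightarrow> (real^'n) \<times> real \<Rightarrow> (real^'n) \<times> real \<Rightarrow> (real^'n) \<times> real \<Rightarrow> real" where
  "G_metric A p u v =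
     (let D = frechet_derivative (G_mult A (G_inverse A p)) (at p) in D u \<bullet> D v)"

text \<open>The derivative of a \<^const>\<open>valid_path\<close> (piecewise C1) may be unbounded near its
  finitely many singular points, so finiteness of the length is part of the definition.\<close>

definition G_dist :: "real^'n^'n \<Rightarrow> (real^'n) \<times> real \<Rightarrow> (real^'n) \<times> real \<Rightarrow> real" where
  "G_dist A p q = Inf {l. \<exists>c. valid_path c \<and> pathstart c = p \<and> pathfinish c = q \<and>
     ((\<lambda>t. sqrt (G_metric A (c t) (vector_derivative c (at t)) (vector_derivative c (at t))))
        has_integral l) {0..1}}"

definition bij_isometry :: "('a \<Rightarrow> 'a \<Rightarrow> real) \<Rightarrow> ('a \<Rightarrow> 'a) \<Rightarrow> bool" where
  "bij_isometry d f \<longleftrightarrow> bij f \<and> (\<forall>p q. d (f p) (f q) = d p q)"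


section \<open>Gromov boundary and boundary maps\<close>

text \<open>Only the values of a ray on nonnegative reals matter: rays that agree there
  are asymptotic and hence represent the same boundary point.\<close>

definition geodesic_ray :: "('a \<Rightarrow> 'a \<Rightarrow> real) \<Rightarrow> (real \<Rightarrow> 'a) \<Rightarrow> bool" where
  "geodesic_ray d c \<longleftrightarrow> (\<forall>s\<ge>0. \<forall>t\<ge>0. d (c s) (c t) = \<bar>s - t\<bar>)"

definition asymptotic_rays :: "('a \<Rightarrow> 'a \<Rightarrow> real) \<Rightarrow> ((real \<Rightarrow> 'a) \<times> (real \<Rightarrow> 'a)) set" where
  "asymptotic_rays d = {(b, c). geodesic_ray d b \<and> geodesic_ray d c \<and>
     (\<exists>C. \<forall>t\<ge>0. d (b t) (c t) \<le> C)}"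

definition endpoint :: "('a \<Rightarrow> 'a \<Rightarrow> real) \<Rightarrow> (real \<Rightarrow> 'a) \<Rightarrow> (real \<Rightarrow> 'a) set" where
  "endpoint d c = asymptotic_rays d `` {c}"

definition boundary_extension ::
  "('a \<Rightarrow> 'a \<Rightarrow> real) \<Rightarrow> ('a \<Rightarrow> 'a) \<Rightarrow> (real \<Rightarrow> 'a) set \<Rightarrow> (real \<Rightarrow> 'a) set" where
  "boundary_extension d f \<xi> = asymptotic_rays d `` ((\<circ>) f ` \<xi>)"

definition vertical_line :: "real^'n \<Rightarrow> real \<Rightarrow> (real^'n) \<times> real" where
  "vertical_line x t = (x, t)"

text \<open>All vertical lines are asymptotic as t tends to infinity, so the one over 0
  serves as representative of the distinguished boundary point.\<close>

definition top_endpoint :: "real^'n^'n \<Rightarrow> (real \<Rightarrow> (real^'n) \<times> real) set" where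
  "top_endpoint A = endpoint (G_dist A) (vertical_line 0)"

definition lower_endpoint :: "real^'n^'n \<Rightarrow> real^'n \<Rightarrow> (real \<Rightarrow> (real^'n) \<times> real) set" where
  "lower_endpoint A x = endpoint (G_dist A) (\<lambda>t. vertical_line x (- t))"

definition is_boundary_map ::
  "real^'n^'n \<Rightarrow> ((real^'n) \<times> real \<Rightarrow> (real^'n) \<times> real) \<Rightarrow> (real^'n \<Rightarrow> real^'n) \<Rightarrow> bool" where
  "is_boundary_map A f F \<longleftrightarrow>
     boundary_extension (G_dist A) f (top_endpoint A) = top_endpoint A \<and>
     (\<forall>x. boundary_extension (G_dist A) f (lower_endpoint A x) = lower_endpoint A (F x))"


section \<open>The parabolic quasimetric\<close>

definition parabolic_quasimetric :: "real^'n^'n \<Rightarrow> real^'n \<Rightarrow> real^'n \<Rightarrow> real" where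
  "parabolic_quasimetric A x y =
     (if x = y then 0
      else exp (LEAST t. norm (matrix_exp ((- t) *\<^sub>R A) *v (x - y)) = 1))"


section \<open>Hausdorff measure and dimension of a quasimetric space\<close>

definition q_diameter :: "('a \<Rightarrow> 'a \<Rightarrow> real) \<Rightarrow> 'a set \<Rightarrow> ennreal" where
  "q_diameter \<rho> U = (SUP x\<in>U. SUP y\<in>U. ennreal (\<rho> x y))"

text \<open>The s-th power of the diameter of a bounded set. In exponent 0 every nonempty set
  counts 1, whereas \<^term>\<open>0 powr 0 = (0::real)\<close>.\<close>

definition hausdorff_gauge :: "('a \<Rightarrow> 'a \<Rightarrow> real) \<Rightarrow> real \<Rightarrow> 'a set \<Rightarrow> ennreal" where
  "hausdorff_gauge \<rho> s U =
     (if U = {} then 0 else if s = 0 then 1 else ennreal (enn2real (q_diameter \<rho> U) powr s))"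

definition hausdorff_content :: "('a \<Rightarrow> 'a \<Rightarrow> real) \<Rightarrow> real \<Rightarrow> real \<Rightarrow> 'a set \<Rightarrow> ennreal" where
  "hausdorff_content \<rho> s \<delta> E =
     (INF U\<in>{U :: nat \<Rightarrow> 'a set. E \<subseteq> (\<Union>i. U i) \<and> (\<forall>i. q_diameter \<rho> (U i) \<le> ennreal \<delta>)}.
        \<Sum>i. hausdorff_gauge \<rho> s (U i))"

definition hausdorff_outer_measure :: "('a \<Rightarrow> 'a \<Rightarrow> real) \<Rightarrow> real \<Rightarrow> 'a set \<Rightarrow> ennreal" where
  "hausdorff_outer_measure \<rho> s E = (SUP \<delta>\<in>{0<..}. hausdorff_content \<rho> s \<delta> E)"

definition hausdorff_dim :: "('a \<Rightarrow> 'a \<Rightarrow> real) \<Rightarrow> ereal" where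
  "hausdorff_dim \<rho> = (INF s\<in>{s. 0 \<le> s \<and> hausdorff_outer_measure \<rho> s UNIV = 0}. ereal s)"

text \<open>Meaningful for spaces of finite Hausdorff dimension only.\<close>

definition hausdorff_AE :: "('a \<Rightarrow> 'a \<Rightarrow> real) \<Rightarrow> ('a \<Rightarrow> bool) \<Rightarrow> bool" where
  "hausdorff_AE \<rho> P \<longleftrightarrow>
     hausdorff_outer_measure \<rho> (real_of_ereal (hausdorff_dim \<rho>)) {x. \<not> P x} = 0"


section \<open>Quasisymmetric and conformal maps\<close>

definition quasisymmetric ::
  "('a \<Rightarrow> 'a \<Rightarrow> real) \<Rightarrow> ('b \<Rightarrow> 'b \<Rightarrow> real) \<Rightarrow> ('a \<Rightarrow> 'b) \<Rightarrow> bool" where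
  "quasisymmetric \<rho>1 \<rho>2 F \<longleftrightarrow> bij F \<and>
     (\<exists>\<eta> \<eta>'. homeomorphism {0::real..} {0::real..} \<eta> \<eta>' \<and>
       (\<forall>x y z. x \<noteq> y \<and> y \<noteq> z \<and> x \<noteq> z \<longrightarrow>
          \<rho>2 (F x) (F y) / \<rho>2 (F x) (F z) \<le> \<eta> (\<rho>1 x y / \<rho>1 x z)))"

definition L_sup ::
  "('a \<Rightarrow> 'a \<Rightarrow> real) \<Rightarrow> ('b \<Rightarrow> 'b \<Rightarrow> real) \<Rightarrow> ('a \<Rightarrow> 'b) \<Rightarrow> 'a \<Rightarrow> real \<Rightarrow> ereal" where
  "L_sup \<rho>1 \<rho>2 g x r = (SUP x'\<in>{x'. \<rho>1 x x' \<le> r}. ereal (\<rho>2 (g x) (g x')))"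

definition l_inf ::
  "('a \<Rightarrow> 'a \<Rightarrow> real) \<Rightarrow> ('b \<Rightarrow> 'b \<Rightarrow> real) \<Rightarrow> ('a \<Rightarrow> 'b) \<Rightarrow> 'a \<Rightarrow> real \<Rightarrow> ereal" where
  "l_inf \<rho>1 \<rho>2 g x r = (INF x'\<in>{x'. \<rho>1 x x' \<ge> r}. ereal (\<rho>2 (g x) (g x')))"

definition L_upper ::
  "('a \<Rightarrow> 'a \<Rightarrow> real) \<Rightarrow> ('b \<Rightarrow> 'b \<Rightarrow> real) \<Rightarrow> ('a \<Rightarrow> 'b) \<Rightarrow> 'a \<Rightarrow> ereal" where
  "L_upper \<rho>1 \<rho>2 g x = Limsup (at_right 0) (\<lambda>r. L_sup \<rho>1 \<rho>2 g x r / ereal r)"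

definition l_lower ::
  "('a \<Rightarrow> 'a \<Rightarrow> real) \<Rightarrow> ('b \<Rightarrow> 'b \<Rightarrow> real) \<Rightarrow> ('a \<Rightarrow> 'b) \<Rightarrow> 'a \<Rightarrow> ereal" where
  "l_lower \<rho>1 \<rho>2 g x = Liminf (at_right 0) (\<lambda>r. l_inf \<rho>1 \<rho>2 g x r / ereal r)"

text \<open>The dilatations are usually considered for bijections g such that, for each x,
  \<open>\<rho>1 y x\<close> tends to 0 iff \<open>\<rho>2 (g y) (g x)\<close> does. Quasisymmetric bijections of quasimetric
  spaces have this property (since \<open>\<eta>\<close> is a homeomorphism with \<open>\<eta> 0 = 0\<close>), so it is not
  listed separately.\<close>

definition conformal ::
  "('a \<Rightarrow> 'a \<Rightarrow> real) \<Rightarrow> ('b \<Rightarrow> 'b \<Rightarrow> real) \<Rightarrow> ('a \<Rightarrow> 'b) \<Rightarrow> bool" where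
  "conformal \<rho>1 \<rho>2 f \<longleftrightarrow> quasisymmetric \<rho>1 \<rho>2 f \<and>
     hausdorff_AE \<rho>1 (\<lambda>x. L_upper \<rho>1 \<rho>2 f x = l_lower \<rho>1 \<rho>2 f x \<and>
       0 < L_upper \<rho>1 \<rho>2 f x \<and> L_upper \<rho>1 \<rho>2 f x < \<infinity>) \<and>
     hausdorff_AE \<rho>2 (\<lambda>y. L_upper \<rho>2 \<rho>1 (inv f) y = l_lower \<rho>2 \<rho>1 (inv f) y \<and>
       0 < L_upper \<rho>2 \<rho>1 (inv f) y \<and> L_upper \<rho>2 \<rho>1 (inv f) y < \<infinity>)"

end

theory Submission
  imports Defs "HOL-Computational_Algebra.Formal_Power_Series"
begin

text \<open>Number the coordinates of \<open>\<real>\<^sup>n\<close> from the last one (number 0) to the first one (number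
  \<open>n - 1\<close>). A power series in the nilpotent part \<open>N\<close> of \<open>J\<^sub>n\<close> then acts on vectors as multiplication
  by a truncated power series. Below, \<open>E t\<close> is \<open>exp (t J\<^sub>n)\<close>, \<open>U t\<close> is \<open>exp (t N)\<close> and \<open>D\<close> is the
  quasimetric, so that \<open>D x y \<le> exp t\<close> iff \<open>E (- t) (x - y)\<close> has norm at most 1.

  A D-ball of radius \<open>exp (- T)\<close> has extent of order \<open>T ^ (n - 1) exp (- T)\<close> in the direction of the
  first axis, but at most \<open>T ^ (n - 2) exp (- T)\<close> in the other coordinates. A quasisymmetric \<open>F\<close> maps
  D-balls to sets comparable to D-balls, of bounded total volume. Joining two points of a line in the
  direction of the first axis by chains of about \<open>exp T / T ^ (n - 1)\<close> balls and averaging over parallel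
  chains, one finds that \<open>F\<close> maps such lines to such lines. Comparing each line with a parallel one at
  distance \<open>h\<close>, its stretching at scale \<open>h\<close> is the same along the line up to a constant, whence \<open>F\<close> is
  Lipschitz for \<open>D\<close>. Hence \<open>F\<close> is Lipschitz for each of the norms of \<open>U \<tau> x\<close>, at scales above
  \<open>exp (- \<tau>)\<close>; as \<open>\<tau>\<close> tends to infinity this forces \<open>F x = F 0 + p(N) x + h(x\<^sub>n) e\<^sub>1\<close> with \<open>p\<close> a
  polynomial and \<open>h\<close> Lipschitz. At a point of conformality the blow-up of \<open>F\<close> is, up to the factor
  \<open>E l\<close>, a linear isometry commuting with \<open>N\<close>. This determines \<open>p\<close> and the derivative of \<open>h\<close> almost
  everywhere, so that \<open>F x = F 0 \<plusminus> E l x\<close>, which is induced by an isometry of the group.\<close>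

section \<open>Coordinates and the exponential of the Jordan matrix\<close>

text \<open>Averaging over chains is forced by the fact that the image of a single D-ball may be
  large: volume bounds the n-th powers of the image radii in the mean only. As n >= 2, this moment
  also absorbs the logarithms of the radii, and what remains of the displacement of the other
  coordinates along a chain is of order 1 / T. The polynomial p(N) can be split off because it
  commutes with every \<open>U \<tau>\<close>. What is left is not removed entirely, since a
  coordinate is controlled through the next one, where it reappears multiplied by \<tau>; the first
  coordinate has no next one, and so h survives until conformality is used. The null sets in the
  definition of conformality are Lebesgue negligible for every exponent between 0 and n, because a
  D-ball of radius r has volume of order r ^ n. Hence the Hausdorff dimension need only be located
  in that interval.\<close>

definition rk :: "'n::{finite,linorder} \<Rightarrow> nat" where
  "rk i = card {j. i < j}"

lemma rk_strict_antimono: "i < j \<Longrightarrow> rk j < rk i"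
  unfolding rk_def by (intro psubset_card_mono) auto

lemma rk_less_iff: "rk i < rk j \<longleftrightarrow> j < i"
  by (metis rk_strict_antimono linorder_less_linear order.asym)

lemma inj_rk: "inj rk"
  by (rule injI) (metis rk_strict_antimono linorder_less_linear order.irrefl)

lemma rk_less: "rk (i::'n::{finite,linorder}) < CARD('n)"
  unfolding rk_def by (intro psubset_card_mono) auto

lemma bij_rk: "bij_betw rk (UNIV::'n::{finite,linorder} set) {..<CARD('n)}"
proof -
  have "rk ` (UNIV::'n set) = {..<CARD('n)}"
    by (rule card_subset_eq) (auto simp: rk_less card_image inj_rk)
  then show ?thesis by (simp add: bij_betw_def inj_rk)
qed

definition ix :: "nat \<Rightarrow> 'n::{finite,linorder}" where
  "ix = inv rk"

lemma ix_rk [simp]: "ix (rk i) = i"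
  by (simp add: ix_def inj_rk)

lemma rk_ix: "k < CARD('n) \<Longrightarrow> rk (ix k :: 'n::{finite,linorder}) = k"
  unfolding ix_def using bij_rk[where 'n='n]
  by (metis bij_betw_imp_surj_on f_inv_into_f lessThan_iff)

lemma covers_iff_rk: "i < j \<and> {i<..<j} = {} \<longleftrightarrow> rk i = Suc (rk j)"
  for i j :: "'n::{finite,linorder}"
proof
  assume a: "i < j \<and> {i<..<j} = {}"
  then have "{k. i < k} = insert j {k. j < k}" by force
  then show "rk i = Suc (rk j)" by (simp add: rk_def)
next
  assume a: "rk i = Suc (rk j)"
  then have ij: "i < j" by (metis rk_less_iff lessI)
  then have "{k. i < k} = {i<..<j} \<union> insert j {k. j < k}" by auto
  moreover have "{i<..<j} \<inter> insert j {k. j < k} = {}" by auto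
  ultimately have "card {k. i < k} = card {i<..<j} + card (insert j {k. j < k})"
    by (simp only:) (rule card_Un_disjoint; simp)
  then have "card {i<..<j} = 0" using a by (simp add: rk_def)
  then show "i < j \<and> {i<..<j} = {}" using ij by simp
qed

section \<open>Truncated power series acting on vectors\<close>

definition fps_of_vec :: "real^'n::{finite,linorder} \<Rightarrow> real fps" where
  "fps_of_vec x = Abs_fps (\<lambda>k. if k < CARD('n) then x $ ix k else 0)"

text \<open>The operator a(N), an upper triangular Toeplitz matrix in the usual order of the
  coordinates. These operators form the commutant of N.\<close>

definition toep :: "real fps \<Rightarrow> real^'n::{finite,linorder} \<Rightarrow> (real,'n) vec" where
  "toep a x = (\<chi> i. fps_nth (a * fps_of_vec x) (rk i))"

lemma toep_nth: "toep a x $ i = (\<Sum>k\<le>rk i. fps_nth a k * x $ ix (rk i - k))"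
  unfolding toep_def fps_mult_nth
  by (auto simp: fps_of_vec_def atLeast0AtMost intro!: sum.cong dest: order.strict_trans1[OF _ rk_less])
     (metis diff_le_self order.strict_trans1 rk_less)+

text \<open>Truncation at \<open>CARD('n)\<close> does no harm, because a coefficient of a product
  of power series depends only on coefficients of the same or lower index.\<close>

lemma toep_mult: "toep (a * b) x = toep a (toep b x)" for x :: "real^'n::{finite,linorder}"
proof (rule vec_eq_iff[THEN iffD2], intro allI)
  fix i :: 'n
  have "fps_nth (fps_of_vec (toep b x)) k = fps_nth (b * fps_of_vec x) k" if "k < CARD('n)" for k
    using that by (simp add: fps_of_vec_def[of "toep b x"]) (simp add: toep_def rk_ix)
  then have "fps_nth (a * fps_of_vec (toep b x)) (rk i) = fps_nth (a * (b * fps_of_vec x)) (rk i)"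
    unfolding fps_mult_nth[of a] using rk_less[of i]
    by (intro sum.cong refl arg_cong2[where f="(*)"]) auto
  then show "toep (a * b) x $ i = toep a (toep b x) $ i"
    by (simp add: toep_def mult.assoc)
qed

lemma toep_commute: "toep a (toep b x) = toep b (toep a x)"
  by (metis toep_mult mult.commute)

lemma toep_1 [simp]: "toep 1 x = x"
  by (simp add: vec_eq_iff toep_def fps_of_vec_def rk_less)

lemma toep_add_left: "toep (a + b) x = toep a x + toep b x"
  by (simp add: vec_eq_iff toep_nth algebra_simps sum.distrib)

lemma toep_const_mult: "toep (fps_const c * a) x = c *\<^sub>R toep a x"
  by (simp add: vec_eq_iff toep_nth sum_distrib_left mult.assoc)

lemma linear_toep: "linear (toep a)"
  by (rule linearI) (simp_all add: vec_eq_iff toep_nth algebra_simps sum.distrib sum_distrib_left)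

lemmas toep_add = linear_add[OF linear_toep]
  and toep_scaleR = linear_scale[OF linear_toep]
  and toep_0 [simp] = linear_0[OF linear_toep]

lemma toep_axis: "toep a (axis j c) $ i = (if rk j \<le> rk i then fps_nth a (rk i - rk j) * c else 0)"
  for i j :: "'n::{finite,linorder}"
proof -
  have "ix (rk i - k) = j \<longleftrightarrow> rk i - k = rk j" for k
    by (metis ix_rk rk_ix diff_le_self order.strict_trans1 rk_less)
  then have "toep a (axis j c) $ i = (\<Sum>k\<le>rk i. if rk i - k = rk j then fps_nth a k * c else 0)"
    by (auto simp: toep_nth axis_def intro!: sum.cong)
  also have "\<dots> = (\<Sum>k\<in>{k. k \<le> rk i \<and> rk i - k = rk j}. fps_nth a k * c)"
    by (subst sum.inter_filter[symmetric]) (auto intro: sum.cong)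
  also have "{k. k \<le> rk i \<and> rk i - k = rk j} = (if rk j \<le> rk i then {rk i - rk j} else {})"
    by auto
  finally show ?thesis by simp
qed

text \<open>N ^ m shifts the coordinates and drops those that overflow, so it cannot increase the
  norm. With \<open>toep_eq_sum\<close> this bounds a(N) by the sum of the absolute values of its
  coefficients.\<close>

lemma norm_toep_X_power_le: "norm (toep (fps_X ^ m) x) \<le> norm x" for x :: "real^'n::{finite,linorder}"
proof -
  have *: "toep (fps_X ^ m) x $ i = (if m \<le> rk i then x $ ix (rk i - m) else 0)" for i
    by (auto simp: toep_nth fps_X_power_nth if_distrib[of "\<lambda>u. u * _"] cong: if_cong)
  have "(\<Sum>i\<in>UNIV. (toep (fps_X ^ m) x $ i)\<^sup>2) = (\<Sum>i | m \<le> rk (i::'n). (x $ ix (rk i - m))\<^sup>2)"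
    unfolding * by (rule sum.mono_neutral_cong_right) auto
  also have "\<dots> = (\<Sum>j\<in>(\<lambda>i::'n. ix (rk i - m)) ` {i. m \<le> rk i}. (x $ j)\<^sup>2)"
  proof (subst sum.reindex)
    show "inj_on (\<lambda>i::'n. ix (rk i - m) :: 'n) {i. m \<le> rk i}"
    proof (rule inj_onI)
      fix i j :: 'n
      assume a: "i \<in> {i. m \<le> rk i}" "j \<in> {i. m \<le> rk i}" "ix (rk i - m) = (ix (rk j - m) :: 'n)"
      have "rk i - m < CARD('n)" "rk j - m < CARD('n)" by (meson diff_le_self order.strict_trans1 rk_less)+
      then have "rk i - m = rk j - m" using a(3) by (metis rk_ix)
      then have "rk i = rk j" using a by auto
      then show "i = j" by (metis ix_rk)
    qed
  qed (auto simp: o_def)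
  also have "\<dots> \<le> (\<Sum>j\<in>UNIV. (x $ j)\<^sup>2)" by (rule sum_mono2) auto
  finally show ?thesis
    by (simp add: norm_vec_def L2_set_def)
qed

lemma toep_eq_sum: "toep a x = (\<Sum>k<CARD('n). fps_nth a k *\<^sub>R toep (fps_X ^ k) x)"
  for x :: "real^'n::{finite,linorder}"
proof -
  have *: "toep (fps_X ^ m) x $ i = (if m \<le> rk i then x $ ix (rk i - m) else 0)" for i m
    by (auto simp: toep_nth fps_X_power_nth if_distrib[of "\<lambda>u. u * _"] cong: if_cong)
  show ?thesis
  proof (rule vec_eq_iff[THEN iffD2], intro allI)
    fix i :: 'n
    have "(\<Sum>k<CARD('n). fps_nth a k * (if k \<le> rk i then x $ ix (rk i - k) else 0)) =
          (\<Sum>k\<le>rk i. fps_nth a k * x $ ix (rk i - k))"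
      using rk_less[of i] by (intro sum.mono_neutral_cong_right) auto
    then show "toep a x $ i = (\<Sum>k<CARD('n). fps_nth a k *\<^sub>R toep (fps_X ^ k) x) $ i"
      by (simp add: toep_nth[of a] *)
  qed
qed

lemma norm_toep_le: "norm (toep a x) \<le> (\<Sum>k<CARD('n). \<bar>fps_nth a k\<bar>) * norm x"
  for x :: "real^'n::{finite,linorder}"
proof -
  have "norm (toep a x) \<le> (\<Sum>k<CARD('n). norm (fps_nth a k *\<^sub>R toep (fps_X ^ k) x))"
    unfolding toep_eq_sum[of a] by (rule norm_sum)
  also have "\<dots> \<le> (\<Sum>k<CARD('n). \<bar>fps_nth a k\<bar> * norm x)"
    by (intro sum_mono) (simp add: mult_left_mono norm_toep_X_power_le)
  finally show ?thesis by (simp add: sum_distrib_right)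
qed

section \<open>The flows E and U and their norms\<close>

definition E :: "real \<Rightarrow> real^'n::{finite,linorder} \<Rightarrow> (real,'n) vec" where
  "E t = toep (fps_const (exp t) * fps_exp t)"

definition U :: "real \<Rightarrow> real^'n::{finite,linorder} \<Rightarrow> (real,'n) vec" where
  "U t = toep (fps_exp t)"

lemma E_eq_U: "E t x = exp t *\<^sub>R U t x"
  by (simp add: E_def U_def toep_const_mult)

lemma U_add: "U (s + t) x = U s (U t x)"
  by (simp add: U_def fps_exp_add_mult toep_mult)

lemma E_add: "E (s + t) x = E s (E t x)"
proof -
  have "fps_const (exp (s+t)) * fps_exp (s+t) = (fps_const (exp s) * fps_exp s) * (fps_const (exp t) * fps_exp t)"
    by (simp add: fps_exp_add_mult exp_add mult_ac flip: fps_const_mult)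
  then show ?thesis by (simp add: E_def toep_mult)
qed

lemma E_0 [simp]: "E 0 x = x" and U_0 [simp]: "U 0 x = x"
  by (simp_all add: E_def U_def)

lemma E_minus_cancel [simp]: "E (- t) (E t x) = x" "E t (E (- t) x) = x"
  by (simp_all flip: E_add)

lemma U_minus_cancel [simp]: "U (- t) (U t x) = x" "U t (U (- t) x) = x"
  by (simp_all flip: U_add)

lemma linear_E: "linear (E t)" and linear_U: "linear (U t)"
  by (simp_all add: E_def U_def linear_toep)

lemmas E_simps = linear_add[OF linear_E] linear_diff[OF linear_E] linear_neg[OF linear_E] linear_scale[OF linear_E]
lemmas U_simps = linear_add[OF linear_U] linear_diff[OF linear_U] linear_neg[OF linear_U] linear_scale[OF linear_U]

lemma E_zero [simp]: "E t 0 = 0"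
  by (simp add: linear_0 linear_E)

lemma U_nth: "U t x $ i = (\<Sum>k\<le>rk i. t ^ k / fact k * x $ ix (rk i - k))"
  by (simp add: U_def toep_nth)

lemma continuous_on_U [continuous_intros]:
  assumes "continuous_on S f" "continuous_on S g"
  shows "continuous_on S (\<lambda>z. U (f z) (g z))"
  by (rule continuous_on_vec_lambda[of S "\<lambda>i z. U (f z) (g z) $ i", simplified])
     (unfold U_nth, intro continuous_intros assms, simp)

lemma continuous_on_E [continuous_intros]:
  assumes "continuous_on S f" "continuous_on S g"
  shows "continuous_on S (\<lambda>z. E (f z) (g z))"
  unfolding E_eq_U by (intro continuous_intros assms)

definition Ubound :: "'n::{finite,linorder} itself \<Rightarrow> real \<Rightarrow> real" where
  "Ubound _ t = (\<Sum>k<CARD('n). \<bar>t\<bar> ^ k / fact k)"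

lemma Ubound_minus [simp]: "Ubound TYPE('n::{finite,linorder}) (- t) = Ubound TYPE('n) t"
  by (simp add: Ubound_def)

lemma Ubound_ge_1: "1 \<le> Ubound TYPE('n::{finite,linorder}) t"
proof -
  have "(\<Sum>k\<in>{0::nat}. \<bar>t\<bar> ^ k / fact k) \<le> (\<Sum>k<CARD('n). \<bar>t\<bar> ^ k / fact k)"
    by (rule sum_mono2) auto
  then show ?thesis by (simp add: Ubound_def)
qed

lemma norm_U_le: "norm (U t x) \<le> Ubound TYPE('n) t * norm x" for x :: "real^'n::{finite,linorder}"
  using norm_toep_le[of "fps_exp t" x] by (simp add: U_def Ubound_def power_abs abs_divide)

lemma norm_E_le: "norm (E t x) \<le> exp t * Ubound TYPE('n) t * norm x" for x :: "real^'n::{finite,linorder}"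
  using norm_U_le[of t x] by (simp add: E_eq_U mult.assoc)

text \<open>The exponential series of a positive number strictly exceeds its partial sums. So the
  factor exp t in \<open>E t\<close> dominates the polynomial growth of \<open>U t\<close> at every
  t > 0, not only asymptotically, which makes the norm of \<open>E t x\<close> strictly monotone in
  t.\<close>

lemma Ubound_less_exp: "t > 0 \<Longrightarrow> Ubound TYPE('n::{finite,linorder}) t < exp t"
proof -
  assume t: "t > 0"
  have s: "(\<lambda>k. t ^ k / fact k) sums exp t"
    using exp_converges[of t] by (simp add: divide_inverse mult.commute)
  have "(\<Sum>k<CARD('n). t ^ k / fact k) < (\<Sum>k. t ^ k / fact k)"
    by (rule sum_less_suminf) (use s t in \<open>auto simp: sums_iff\<close>)
  then show ?thesis using s t by (simp add: Ubound_def sums_iff)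
qed

lemma norm_E_strict_mono:
  fixes x :: "real^'n::{finite,linorder}"
  assumes "x \<noteq> 0" "s < t" shows "norm (E s x) < norm (E t x)"
proof -
  have nz: "E t x \<noteq> 0" using assms(1) by (metis E_minus_cancel(1) E_zero)
  have "E s x = E (- (t - s)) (E t x)" by (simp flip: E_add)
  then have "norm (E s x) \<le> exp (- (t-s)) * Ubound TYPE('n) (t - s) * norm (E t x)"
    by (metis norm_E_le Ubound_minus)
  also have "\<dots> < exp (- (t-s)) * exp (t - s) * norm (E t x)"
    using nz assms Ubound_less_exp[of "t-s", where 'n='n] by (intro mult_strict_right_mono mult_strict_left_mono) auto
  finally show ?thesis by (simp flip: exp_add)
qed

lemma norm_E_mono:
  fixes x :: "real^'n::{finite,linorder}"
  assumes "s \<le> t" shows "norm (E s x) \<le> norm (E t x)"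
  using norm_E_strict_mono[of x s t] assms by (cases "x = 0"; cases "s = t"; force)

section \<open>The exponential of the Jordan matrix\<close>

lemma jordan_mult: "jordan_matrix *v x = toep (1 + fps_X) x" for x :: "real^'n::{finite,linorder}"
proof -
  have "(\<Sum>j\<in>UNIV. (if i < j \<and> {i<..<j} = {} then 1 else 0) * x $ j) = toep fps_X x $ i" for i
  proof -
    have "(\<Sum>j\<in>UNIV. (if i < j \<and> {i<..<j} = {} then 1 else 0) * x $ j) =
       (\<Sum>j | rk i = Suc (rk j). x $ j)"
      unfolding covers_iff_rk by (rule sum.mono_neutral_cong_right) auto
    also have "{j::'n. rk i = Suc (rk j)} = (if rk i = 0 then {} else {ix (rk i - 1)})"
    proof -
      have "rk i - 1 < CARD('n)" using rk_less[of i] by simp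
      then have "rk (ix (rk i - 1)::'n) = rk i - 1" by (rule rk_ix)
      moreover have "j = ix (rk i - 1)" if "rk i = Suc (rk j)" for j :: 'n
        using that ix_rk[of j] by simp
      moreover have "rk i = Suc (rk i - 1)" if "rk i \<noteq> 0" using that by simp
      ultimately show ?thesis by auto
    qed
    finally show ?thesis
      by (auto simp: toep_nth fps_X_def if_distrib[of "\<lambda>u. u * _"] cong: if_cong)
  qed
  then have "((\<chi> i j. if i < j \<and> {i<..<j} = {} then 1 else 0) *v x) = toep fps_X x"
    by (simp add: vec_eq_iff matrix_vector_mult_def)
  then show ?thesis
    by (simp add: jordan_matrix_def matrix_vector_mult_add_rdistrib toep_add_left)
qed

lemma matrix_power_scaled_jordan:
  "matrix_power (t *\<^sub>R jordan_matrix) k *v x = t ^ k *\<^sub>R toep ((1 + fps_X) ^ k) x"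
  for x :: "real^'n::{finite,linorder}"
proof (induction k)
  case (Suc k)
  then show ?case
    by (simp flip: matrix_vector_mul_assoc scaleR_matrix_vector_assoc
        add: jordan_mult toep_mult matrix_vector_mult_scaleR)
qed simp

text \<open>\<open>k choose d\<close> is the coefficient of X ^ d in (1 + X) ^ k, so these are the
  entries of the exponential series of t J_n. Cancelling against the factorial leaves the series of
  exp t shifted by d.\<close>

lemma sums_choose: "(\<lambda>k. (1 / fact k) * (t ^ k * real (k choose d))) sums (exp t * t ^ d / fact d)"
proof -
  have "(\<lambda>k. t ^ k / fact k) sums exp t"
    using exp_converges[of t] by (simp add: divide_inverse mult.commute)
  then have "(\<lambda>k. t ^ d / fact d * (t ^ k / fact k)) sums (t ^ d / fact d * exp t)"
    by (rule sums_mult)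
  moreover have "t ^ d / fact d * (t ^ k / fact k) = (1 / fact (k+d)) * (t ^ (k+d) * real ((k+d) choose d))" for k
    by (simp add: binomial_fact power_add)
  ultimately have "(\<lambda>k. (1 / fact (k+d)) * (t ^ (k+d) * real ((k+d) choose d))) sums (t ^ d / fact d * exp t)"
    by simp
  \<comment> \<open>The first d terms, which the shift restores, vanish together with their binomial
    coefficients.\<close>
  then show ?thesis
    by (subst (asm) sums_iff_shift) (simp add: mult.commute binomial_eq_0)
qed

lemma one_plus_X_power_nth: "fps_nth ((1 + fps_X :: real fps) ^ k) d = real (k choose d)"
proof -
  have "(1 + fps_X :: real fps) ^ k = fps_binomial (of_nat k)"
    by (simp add: fps_binomial_of_nat)
  then show ?thesis by (simp add: fps_binomial_nth binomial_gbinomial)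
qed

text \<open>Convergence is checked entry by entry, with entry (i, j) read as coordinate i of the
  image of the j-th basis vector.\<close>

lemma matrix_exp_jordan: "matrix_exp (t *\<^sub>R jordan_matrix) *v x = E t x" for x :: "real^'n::{finite,linorder}"
proof -
  let ?M = "\<lambda>k. (1 / fact k) *\<^sub>R matrix_power (t *\<^sub>R jordan_matrix :: ((real,'n) vec,'n) vec) k"
  have entry: "A $ i $ j = (A *v axis j 1) $ i" for A :: "((real,'n) vec,'n) vec" and i j
    by (simp add: matrix_vector_mul_component inner_axis)
  have "(\<lambda>k. ?M k $ i $ j) sums (E t (axis j 1) $ i)" for i j
  proof -
    have "?M k $ i $ j = (if rk j \<le> rk i then (1 / fact k) * (t ^ k * real (k choose (rk i - rk j))) else 0)" for k
      by (simp add: entry[of "matrix_power _ _"] matrix_power_scaled_jordan toep_axis one_plus_X_power_nth)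
    moreover have "E t (axis j 1) $ i = (if rk j \<le> rk i then exp t * t ^ (rk i - rk j) / fact (rk i - rk j) else 0)"
      by (simp add: E_def toep_axis)
    ultimately show ?thesis using sums_choose[of t "rk i - rk j"] by (auto)
  qed
  then have "(\<lambda>m. (\<Sum>k<m. ?M k) $ i $ j) \<longlonglongrightarrow> matrix (E t) $ i $ j" for i j
    by (simp add: sums_def matrix_def)
  then have "?M sums matrix (E t)"
    unfolding sums_def by (intro vec_tendstoI)
  then have "matrix_exp (t *\<^sub>R jordan_matrix :: ((real,'n) vec,'n) vec) = matrix (E t)"
    by (simp add: matrix_exp_def sums_iff)
  then show ?thesis by (simp add: matrix_works linear_E)
qed

section \<open>The parabolic quasimetric\<close>

lemma exp_Ubound_tendsto_0: "((\<lambda>t. exp (- t) * Ubound TYPE('n::{finite,linorder}) t) \<longlongrightarrow> 0) at_top"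
proof -
  have "((\<lambda>t::real. \<Sum>k<CARD('n). (t ^ k / exp t) / fact k) \<longlongrightarrow> (\<Sum>k<CARD('n). 0 / fact k)) at_top"
    by (intro tendsto_intros tendsto_power_div_exp_0) auto
  then have "((\<lambda>t::real. \<Sum>k<CARD('n). (t ^ k / exp t) / fact k) \<longlongrightarrow> 0) at_top" by simp
  moreover have "\<forall>\<^sub>F t in at_top. (\<Sum>k<CARD('n). (t ^ k / exp t) / fact k) = exp (- t) * Ubound TYPE('n) t"
    by (rule eventually_mono[OF eventually_ge_at_top[of 0]])
       (simp add: Ubound_def sum_distrib_left exp_minus field_simps)
  ultimately show ?thesis by (rule Lim_transform_eventually)
qed

lemma ex_norm_E_eq_1:
  fixes v :: "real^'n::{finite,linorder}"
  assumes "v \<noteq> 0"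
  obtains t where "norm (E t v) = 1"
proof -
  define h where "h t = exp (- t) * Ubound TYPE('n) t" for t
  have ev: "\<forall>\<^sub>F t in at_top. h t < c" if "c > 0" for c
    using order_tendstoD(2)[OF exp_Ubound_tendsto_0 that] by (simp add: h_def)
  have c: "norm v > 0" "1 / norm v > 0" using assms by auto
  \<comment> \<open>One t so large that E (- t) shrinks v below norm 1, while E t, its inverse, must
    expand v beyond norm 1.\<close>
  obtain t where t: "t > 0" "h t < norm v" "h t < 1 / norm v"
    using eventually_happens'[OF _ eventually_conj[OF ev[OF c(1)] eventually_conj[OF ev[OF c(2)] eventually_gt_at_top[of 0]]]]
    by auto
  have "norm (E (- t) v) \<le> h t * norm v" using norm_E_le[of "-t" v] by (simp add: h_def)
  also have "\<dots> \<le> 1" using t c by (simp add: field_simps)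
  finally have lo: "norm (E (-t) v) \<le> 1" .
  have "norm v \<le> h t * norm (E t v)" using norm_E_le[of "-t" "E t v"] by (simp add: h_def)
  also have "\<dots> \<le> norm v * norm (E t v)" using t by (intro mult_right_mono) auto
  finally have hi: "1 \<le> norm (E t v)" using c by simp
  have "\<exists>s\<ge>-t. s \<le> t \<and> norm (E s v) = 1"
    by (rule IVT') (use lo hi t in \<open>auto intro!: continuous_intros\<close>)
  then show ?thesis using that by blast
qed

abbreviation D :: "real^'n::{finite,linorder} \<Rightarrow> (real,'n) vec \<Rightarrow> real" where
  "D \<equiv> parabolic_quasimetric jordan_matrix"

lemma D_refl [simp]: "D x x = 0"
  by (simp add: parabolic_quasimetric_def)

text \<open>The norm of E s (x - y) is strictly increasing in s, so the equation in the definition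
  of D has at most one solution and LEAST picks it.\<close>

lemma D_eqI:
  assumes "norm (E (- t) (x - y)) = 1" shows "D x y = exp t"
proof -
  have ne: "x - y \<noteq> 0" using assms by auto
  have "(LEAST t. norm (E (- t) (x - y)) = 1) = t"
  proof (rule Least_equality)
    fix s assume "norm (E (- s) (x - y)) = 1"
    then show "t \<le> s" using assms norm_E_strict_mono[OF ne, of "-t" "-s"] by force
  qed (rule assms)
  then show ?thesis using ne by (simp add: parabolic_quasimetric_def matrix_exp_jordan del: scaleR_minus_left)
qed

lemma D_eqE:
  assumes "x \<noteq> y"
  obtains t where "D x y = exp t" "norm (E (- t) (x - y)) = 1"
proof -
  obtain t where "norm (E t (x - y)) = 1" using ex_norm_E_eq_1[of "x - y"] assms by auto
  then have "norm (E (- (-t)) (x - y)) = 1" by simp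
  then show ?thesis using D_eqI that by blast
qed

lemma D_le_iff: "D x y \<le> exp t \<longleftrightarrow> norm (E (- t) (x - y)) \<le> 1"
proof (cases "x = y")
  case False
  then obtain s where s: "D x y = exp s" "norm (E (- s) (x - y)) = 1" by (rule D_eqE)
  show ?thesis
    using s norm_E_strict_mono[of "x - y" "-s" "-t"] norm_E_mono[of "-t" "-s" "x-y"] False
    by (cases "s \<le> t") auto
qed simp

lemma D_less_iff: "D x y < exp t \<longleftrightarrow> norm (E (- t) (x - y)) < 1"
proof (cases "x = y")
  case False
  then obtain s where s: "D x y = exp s" "norm (E (- s) (x - y)) = 1" by (rule D_eqE)
  show ?thesis
    using s norm_E_strict_mono[of "x - y" "-t" "-s"] norm_E_mono[of "-s" "-t" "x-y"] False
    by (cases "s < t") auto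
qed simp

lemma D_nonneg [simp]: "0 \<le> D x y"
  by (cases "x = y") (auto elim: D_eqE)

lemma D_pos: "x \<noteq> y \<Longrightarrow> 0 < D x y"
  by (auto elim: D_eqE)

lemma D_eq_0_iff [simp]: "D x y = 0 \<longleftrightarrow> x = y"
  using D_pos[of x y] by force

lemma D_sym: "D x y = D y x"
proof (cases "x = y")
  case False
  then obtain s where s: "D x y = exp s" "norm (E (- s) (x - y)) = 1" by (rule D_eqE)
  then have "norm (E (- s) (y - x)) = 1" by (simp add: E_simps norm_minus_commute)
  then show ?thesis using s D_eqI by metis
qed simp

lemma D_translate [simp]: "D (x + z) (y + z) = D x y"
proof (cases "x = y")
  case False
  then obtain s where s: "D x y = exp s" "norm (E (- s) (x - y)) = 1" by (rule D_eqE)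
  then have "norm (E (- s) ((x+z) - (y+z))) = 1" by simp
  then show ?thesis using s D_eqI by metis
qed simp

lemma D_diff_cong: "x - y = x' - y' \<Longrightarrow> D x y = D x' y'"
proof -
  assume "x - y = x' - y'"
  then have "x' = x + (x' - x)" "y' = y + (x' - x)" by (simp_all add: algebra_simps)
  then show ?thesis by (metis D_translate)
qed

text \<open>The first basis vector, of rank n - 1, is the eigenvector of J_n and is killed by N. The
  last one, of rank 0, generates the whole space under N.\<close>

abbreviation first_axis :: "real^'n::{finite,linorder}" where
  "first_axis \<equiv> axis (ix (CARD('n) - Suc 0)) 1"

abbreviation last_axis :: "real^'n::{finite,linorder}" where
  "last_axis \<equiv> axis (ix 0) 1"

lemma rk_ix_0 [simp]: "rk (ix 0 :: 'n::{finite,linorder}) = 0"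
  by (simp add: rk_ix)

lemma rk_ix_last [simp]: "rk (ix (CARD('n) - Suc 0) :: 'n::{finite,linorder}) = CARD('n) - 1"
  by (simp add: rk_ix)

lemma eq_ix_iff: "i = ix k \<longleftrightarrow> rk i = k" if "k < CARD('n)" for i :: "'n::{finite,linorder}"
  using that ix_rk[of i] by (auto simp: rk_ix simp del: ix_rk)

lemma toep_first_axis: "toep a first_axis = fps_nth a 0 *\<^sub>R (first_axis :: real^'n::{finite,linorder})"
proof (rule vec_eq_iff[THEN iffD2], intro allI)
  fix i :: 'n
  have "i = ix (CARD('n) - Suc 0) \<longleftrightarrow> CARD('n) - Suc 0 \<le> rk i"
    using rk_less[of i] by (subst eq_ix_iff) auto
  then show "toep a first_axis $ i = (fps_nth a 0 *\<^sub>R first_axis) $ i"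
    unfolding toep_axis by (cases "i = ix (CARD('n) - Suc 0)") (simp_all add: axis_def)
qed

text \<open>Since N kills this axis, E acts on it by the scalar exp t and no logarithm
  enters.\<close>

lemma D_first_axis: "D x (x + s *\<^sub>R first_axis) = \<bar>s\<bar>"
proof (cases "s = 0")
  case False
  have "norm (E (- ln \<bar>s\<bar>) (x - (x + s *\<^sub>R first_axis))) = 1"
    using False by (simp only: E_def toep_first_axis E_simps linear_scale[OF linear_toep] linear_diff[OF linear_toep] linear_add[OF linear_toep]) (simp add: exp_minus abs_mult)
  then show ?thesis using D_eqI False by fastforce
qed simp

lemma D_E_unit: "norm w = 1 \<Longrightarrow> D x (x + E t w) = exp t"
  by (rule D_eqI) (simp add: E_simps)

text \<open>Together with \<open>D_small_imp_close\<close>: D induces the Euclidean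
  topology.\<close>

lemma close_imp_D_small:
  "\<exists>\<delta>>0. \<forall>y. norm (x - y) < \<delta> \<longrightarrow> D x y < e" if "e > 0" for x :: "real^'n::{finite,linorder}"
proof -
  define B where "B = exp (- ln e) * Ubound TYPE('n) (- ln e)"
  have B: "B > 0" using Ubound_ge_1[of "-ln e", where 'n='n] by (simp add: B_def)
  have "D x y < e" if "norm (x - y) < 1 / B" for y
  proof -
    have "norm (E (- ln e) (x - y)) \<le> B * norm (x - y)" unfolding B_def by (rule norm_E_le)
    also have "\<dots> < 1" using that B by (simp add: field_simps)
    finally show ?thesis using D_less_iff[of x y "ln e"] \<open>e > 0\<close> by simp
  qed
  then show ?thesis using B by (intro exI[of _ "1/B"]) auto
qed

lemma D_small_imp_close:
  "\<exists>\<delta>>0. \<forall>y. D x y < \<delta> \<longrightarrow> norm (x - y) < e" if "e > 0" for x :: "real^'n::{finite,linorder}"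
proof -
  have "\<forall>\<^sub>F t in at_top. exp (- t) * Ubound TYPE('n) t < e"
    using order_tendstoD(2)[OF exp_Ubound_tendsto_0 that] .
  then obtain t where t: "exp (- t) * Ubound TYPE('n) t < e"
    by (meson eventually_happens' trivial_limit_at_top_linorder)
  have "norm (x - y) < e" if "D x y < exp (- t)" for y
  proof -
    have "norm (E t (x - y)) < 1" using that D_less_iff[of x y "-t"] by simp
    then have "exp (- t) * Ubound TYPE('n) t * norm (E t (x - y)) \<le> exp (- t) * Ubound TYPE('n) t * 1"
      using Ubound_ge_1[of t, where 'n='n] by (intro mult_left_mono) auto
    moreover have "norm (x - y) \<le> exp (- t) * Ubound TYPE('n) t * norm (E t (x - y))"
      using norm_E_le[of "-t" "E t (x - y)"] by simp
    ultimately show ?thesis using t by linarith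
  qed
  then show ?thesis by (intro exI[of _ "exp (- t)"]) auto
qed

section \<open>Volume of balls\<close>

text \<open>The library proves the change of variables formula and Sard's lemma for index types of
  class \<open>wellorder\<close> only; finite linear orders are not known to belong to this class, so the
  index type is replaced by an order-isomorphic copy.\<close>

typedef 'n wo = "UNIV :: 'n set" by auto

instantiation wo :: ("{finite,linorder}") "{finite,wellorder}"
begin

definition less_eq_wo :: "'a wo \<Rightarrow> 'a wo \<Rightarrow> bool" where
  "less_eq_wo i j \<longleftrightarrow> Rep_wo i \<le> Rep_wo j"

definition less_wo :: "'a wo \<Rightarrow> 'a wo \<Rightarrow> bool" where
  "less_wo i j \<longleftrightarrow> Rep_wo i < Rep_wo j"

instance
proof
  have "UNIV = Abs_wo ` (UNIV :: 'a set)" by (metis Abs_wo_cases UNIV_I surj_def)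
  then show "finite (UNIV :: 'a wo set)" by (metis finite finite_imageI)
  fix P :: "'a wo \<Rightarrow> bool" and a
  assume step: "\<And>x. (\<And>y. y < x \<Longrightarrow> P y) \<Longrightarrow> P x"
  have "P (Abs_wo i)" for i
  proof (induction "card {j. j < i}" arbitrary: i rule: less_induct)
    case less
    show ?case
    proof (rule step)
      fix y :: "'a wo" assume "y < Abs_wo i"
      then have lt: "Rep_wo y < i" by (simp add: less_wo_def Abs_wo_inverse)
      then have "card {j. j < Rep_wo y} < card {j. j < i}"
        by (intro psubset_card_mono) auto
      then have "P (Abs_wo (Rep_wo y))" by (rule less)
      then show "P y" by (simp add: Rep_wo_inverse)
    qed
  qed
  then show "P a" by (metis Rep_wo_inverse)
qed (auto simp: less_eq_wo_def less_wo_def simp flip: Rep_wo_inject)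

end

lemma bij_Rep_wo: "bij Rep_wo"
  by (metis Rep_wo_inverse Abs_wo_inverse UNIV_I bijI')

section \<open>Reindexing of coordinates and Lebesgue measure\<close>

definition of_wo :: "real^('n::{finite,linorder}) wo \<Rightarrow> (real,'n) vec" where
  "of_wo x = (\<chi> i. x $ Abs_wo i)"

definition to_wo :: "real^'n::{finite,linorder} \<Rightarrow> (real,'n wo) vec" where
  "to_wo x = (\<chi> j. x $ Rep_wo j)"

lemma to_wo_of_wo [simp]: "to_wo (of_wo x) = x" and of_wo_to_wo [simp]: "of_wo (to_wo y) = y"
  by (simp_all add: vec_eq_iff of_wo_def to_wo_def Rep_wo_inverse Abs_wo_inverse)

lemma linear_of_wo: "linear of_wo" and linear_to_wo: "linear to_wo"
  by (auto intro!: linearI simp: of_wo_def to_wo_def vec_eq_iff)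

lemma norm_to_wo [simp]: "norm (to_wo x) = norm x"
  using sum.reindex_bij_betw[OF bij_Rep_wo, of "\<lambda>i. (x $ i)\<^sup>2"]
  by (simp add: norm_vec_def L2_set_def to_wo_def)

lemma norm_of_wo [simp]: "norm (of_wo x) = norm x"
  by (metis norm_to_wo to_wo_of_wo)

lemma continuous_on_of_wo: "continuous_on S of_wo"
  by (auto intro: linear_continuous_on simp: linear_linear linear_of_wo)

lemma continuous_on_to_wo: "continuous_on S to_wo"
  by (auto intro: linear_continuous_on simp: linear_linear linear_to_wo)

lemma Basis_vec_real: "(Basis :: (real^'n) set) = range (\<lambda>i. axis i 1)"
  by (auto simp: Basis_vec_def)

text \<open>Lebesgue measure is determined by its values on boxes, and reindexing maps boxes to
  boxes with the same side lengths.\<close>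

lemma distr_to_wo: "distr lborel borel to_wo = (lborel :: (real^('n::{finite,linorder}) wo) measure)"
proof (rule lborel_eqI[symmetric])
  fix l u :: "real^'n wo"
  have prod_Basis: "(\<Prod>b\<in>Basis. f \<bullet> b) = (\<Prod>i\<in>UNIV. f $ i)" for f :: "real^'k::finite"
    unfolding Basis_vec_real by (subst prod.reindex) (auto simp: inj_on_def axis_eq_axis inner_axis)
  assume le: "\<And>b. b \<in> Basis \<Longrightarrow> l \<bullet> b \<le> u \<bullet> b"
  then have le': "l $ j \<le> u $ j" for j
    using le[of "axis j 1"] by (simp add: inner_axis)
  have "to_wo -` box l u = box (of_wo l) (of_wo u)"
    by (auto simp: mem_box_cart to_wo_def of_wo_def Abs_wo_inverse) (metis Rep_wo_inverse Abs_wo_inverse UNIV_I)+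
  moreover have "(of_wo l) $ i \<le> (of_wo u) $ i" for i by (simp add: of_wo_def le')
  then have "\<forall>b\<in>Basis. of_wo l \<bullet> b \<le> of_wo u \<bullet> b" by (auto simp: Basis_vec_real inner_axis)
  moreover have "(\<Prod>i\<in>UNIV. (of_wo u - of_wo l) $ i) = (\<Prod>j\<in>UNIV. (u - l) $ j)"
    using prod.reindex_bij_betw[OF bij_Rep_wo, of "\<lambda>i. (of_wo u - of_wo l) $ i"]
    by (simp add: of_wo_def Rep_wo_inverse)
  moreover have "to_wo \<in> borel_measurable borel"
    by (intro borel_measurable_continuous_onI continuous_on_to_wo)
  ultimately show "emeasure (distr lborel borel to_wo) (box l u) = ennreal (\<Prod>b\<in>Basis. (u - l) \<bullet> b)"
    by (subst emeasure_distr) (simp_all add: emeasure_lborel_box_eq prod_Basis[of "u - l"] prod_Basis[of "of_wo u - of_wo l"])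
qed simp

lemma emeasure_of_wo_vimage:
  assumes "A \<in> sets borel"
  shows "emeasure lborel (of_wo -` A) = emeasure lborel (A :: (real^'n::{finite,linorder}) set)"
proof -
  have "of_wo -` A \<in> sets borel"
    using measurable_sets_borel[OF borel_measurable_continuous_onI[OF continuous_on_of_wo] assms] by simp
  then have "emeasure lborel (of_wo -` A) = emeasure lborel (to_wo -` (of_wo -` A))"
    by (subst distr_to_wo[symmetric], subst emeasure_distr)
       (simp_all add: borel_measurable_continuous_onI continuous_on_to_wo)
  then show ?thesis by (simp add: vimage_def)
qed

lemma negligible_of_wo_vimage:
  assumes "negligible (A :: (real^'n::{finite,linorder}) set)"
  shows "negligible (of_wo -` A)"
proof -
  have "A \<in> null_sets lebesgue" using assms by (simp add: negligible_iff_null_sets)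
  then obtain B where B: "B \<in> null_sets lborel" "A \<subseteq> B"
    by (auto simp: null_sets_completion_iff2)
  then have "of_wo -` B \<in> null_sets lborel"
    using emeasure_of_wo_vimage[of B] measurable_sets_borel[OF borel_measurable_continuous_onI[OF continuous_on_of_wo], of B]
    by (auto simp: null_sets_def)
  then have "negligible (of_wo -` B)"
    by (simp add: negligible_iff_null_sets null_sets_completionI)
  then show ?thesis by (rule negligible_subset) (use B in auto)
qed

section \<open>Determinants of the flows and the volume of D-balls\<close>

definition conj_wo :: "(real^'n::{finite,linorder} \<Rightarrow> (real,'n) vec) \<Rightarrow> (real,'n wo) vec \<Rightarrow> (real,'n wo) vec" where
  "conj_wo f = to_wo \<circ> f \<circ> of_wo"

lemma linear_conj_wo: "linear f \<Longrightarrow> linear (conj_wo f)"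
  unfolding conj_wo_def by (intro linear_compose linear_of_wo linear_to_wo)

lemma conj_wo_o: "conj_wo (f \<circ> g) = conj_wo f \<circ> conj_wo g"
  by (auto simp: conj_wo_def)

lemma conj_wo_id: "conj_wo id = id"
  by (auto simp: conj_wo_def)

lemma det_conj_wo_o:
  "linear f \<Longrightarrow> linear g \<Longrightarrow>
     det (matrix (conj_wo (f \<circ> g))) = det (matrix (conj_wo f)) * det (matrix (conj_wo g))"
  by (simp add: conj_wo_o matrix_compose linear_conj_wo det_mul)

text \<open>The sign change \<open>x\<^sub>i \<mapsto> (-1)\<^sup>i x\<^sub>i\<close> conjugates \<^term>\<open>U t\<close> to its inverse, so both have the same determinant.\<close>

lemma det_U: "\<bar>det (matrix (conj_wo (U t :: real^'n::{finite,linorder} \<Rightarrow> (real,'n) vec)))\<bar> = 1"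
proof -
  define d where "d f = det (matrix (conj_wo f))" for f :: "(real,'n) vec \<Rightarrow> (real,'n) vec"
  have d_o: "d (f \<circ> g) = d f * d g" if "linear f" "linear g" for f g
    unfolding d_def using that by (rule det_conj_wo_o)
  have d_id: "d id = 1" by (simp add: d_def conj_wo_id matrix_id_mat_1)
  define S where "S x = (\<chi> i. (-1) ^ rk i * x $ i)" for x :: "(real,'n) vec"
  have linS: "linear S" by (rule linearI) (simp_all add: S_def vec_eq_iff algebra_simps)
  have SS: "S \<circ> S = id" by (auto simp: S_def vec_eq_iff fun_eq_iff simp flip: mult.assoc power_mult_distrib)
  have "U (- t) (S x) = S (U t x)" for x
  proof (rule vec_eq_iff[THEN iffD2], intro allI)
    fix i :: 'n
    have "(- t) ^ k / fact k * ((-1) ^ rk (ix (rk i - k) :: 'n) * x $ ix (rk i - k)) =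
          (-1) ^ rk i * (t ^ k / fact k * x $ ix (rk i - k))" if "k \<le> rk i" for k
    proof -
      have "rk (ix (rk i - k) :: 'n) = rk i - k"
        using rk_less[of i] by (intro rk_ix) simp
      moreover have "(-1::real) ^ rk i = (-1) ^ k * (-1) ^ (rk i - k)"
        using that by (simp flip: power_add)
      moreover have "(- t) ^ k = (-1) ^ k * t ^ k" by (rule power_minus)
      ultimately show ?thesis by simp
    qed
    then show "U (- t) (S x) $ i = S (U t x) $ i"
      unfolding U_nth S_def by (simp only: vec_lambda_beta sum_distrib_left) (intro sum.cong, simp_all)
  qed
  then have "U (- t) \<circ> S = S \<circ> U t" by (simp add: fun_eq_iff)
  then have "d (U (- t)) * d S = d S * d (U t)" by (metis d_o linS linear_U)
  moreover have "d S * d S = 1" by (metis d_o linS SS d_id)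
  ultimately have "d (U (- t)) = d (U t)"
    by (metis mult.commute mult_cancel_left zero_neq_one mult_zero_left)
  moreover have "U (- t) \<circ> U t = (id :: (real,'n) vec \<Rightarrow> _)" by (auto simp: fun_eq_iff)
  then have "d (U (- t)) * d (U t) = 1" by (metis d_o linear_U d_id)
  ultimately have "d (U t) * d (U t) = 1" by simp
  then show ?thesis unfolding d_def[symmetric] by (metis abs_1 abs_minus_cancel square_eq_1_iff)
qed

lemma CARD_wo [simp]: "CARD('n wo) = CARD('n)"
  using bij_betw_same_card[OF bij_Rep_wo] .

lemma det_E: "\<bar>det (matrix (conj_wo (E t :: real^'n::{finite,linorder} \<Rightarrow> (real,'n) vec)))\<bar> = exp t ^ CARD('n)"
proof -
  have "conj_wo (E t :: (real,'n) vec \<Rightarrow> _) = (*\<^sub>R) (exp t) \<circ> conj_wo (U t)"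
    by (auto simp: E_eq_U conj_wo_def linear_scale[OF linear_to_wo])
  then show ?thesis
    by (simp add: matrix_compose linear_conj_wo linear_U det_mul det_matrix_scaleR abs_mult det_U power_abs)
qed

text \<open>The ball is a translate of the image of the Euclidean unit ball under
  \<open>E t\<close>, whose determinant has absolute value exp (n t). So Lebesgue measure is regular
  of dimension n for D, without logarithmic factors.\<close>

lemma emeasure_D_ball:
  fixes z :: "real^'n::{finite,linorder}"
  shows "emeasure lborel {y. D z y < exp t} = ennreal (unit_ball_vol (real CARD('n)) * exp t ^ CARD('n))"
proof -
  let ?A = "{y. D z y < exp t}"
  have "of_wo -` ?A = (+) (to_wo z) ` conj_wo (E t) ` ball 0 1"
  proof -
    have "x \<in> (+) (to_wo z) ` conj_wo (E t) ` ball 0 1" if "D z (of_wo x) < exp t" for x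
    proof -
      have "norm (E (- t) (of_wo x - z)) < 1" using that by (subst (asm) D_sym) (simp add: D_less_iff)
      moreover have "x = to_wo z + conj_wo (E t) (to_wo (E (- t) (of_wo x - z)))"
        by (simp add: conj_wo_def linear_diff[OF linear_to_wo])
      ultimately show ?thesis by (intro image_eqI[OF _ imageI]) auto
    qed
    moreover have "D z (of_wo (to_wo z + conj_wo (E t) w)) < exp t" if "norm w < 1" for w
      using that by (subst D_sym) (simp add: D_less_iff linear_add[OF linear_of_wo] conj_wo_def)
    ultimately show ?thesis by auto
  qed
  moreover have "open ?A"
    unfolding D_less_iff by (intro open_Collect_less continuous_intros)
  then have "open (of_wo -` ?A)" "?A \<in> sets borel"
    by (auto simp del: vimage_Collect_eq intro: open_vimage[OF _ continuous_on_of_wo])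
  moreover have "(+) (to_wo z) ` conj_wo (E t) ` ball 0 1 \<in> lmeasurable"
    by (intro measurable_translation measurable_linear_image linear_conj_wo linear_E lmeasurable_ball)
  moreover have "measure lebesgue ((+) (to_wo z) ` conj_wo (E t) ` ball 0 1) = unit_ball_vol (real CARD('n)) * exp t ^ CARD('n)"
    by (simp add: measure_translation measure_linear_image linear_conj_wo linear_E det_E content_ball)
  moreover have "emeasure lborel S = emeasure lebesgue S" if "open S" for S :: "(real,'n wo) vec set"
    using that by simp
  ultimately show ?thesis
    by (metis emeasure_of_wo_vimage emeasure_eq_measure2)
qed

section \<open>Lines in the direction of the first axis\<close>

lemma one_plus_power_le_fact_exp:
  fixes x :: real assumes "x \<ge> 0" shows "(1 + x) ^ k \<le> fact k * exp 1 * exp x"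
proof -
  have "(1 + x) ^ k / fact k \<le> exp (1 + x)"
  proof -
    have s: "(\<lambda>k. (1+x) ^ k / fact k) sums exp (1+x)"
      using exp_converges[of "1+x"] by (simp add: divide_inverse mult.commute)
    have "(\<Sum>i\<in>{k}. (1 + x) ^ i / fact i) \<le> (\<Sum>i. (1 + x) ^ i / fact i)"
      by (rule sum_le_suminf) (use s assms in \<open>auto simp: sums_iff\<close>)
    then show ?thesis using s by (simp add: sums_iff)
  qed
  then show ?thesis by (simp add: field_simps exp_add)
qed

text \<open>A power of 1 + |ln y| is at most a constant times exp |ln y|, which is y or 1 / y. The
  product with y is thus at most quadratic, and n >= 2 turns this into the n-th power, the moment
  that volume controls.\<close>

lemma mult_log_power_le:
  fixes y :: real assumes "y > 0" "n \<ge> 2"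
  shows "y * (1 + \<bar>ln y\<bar>) ^ k \<le> 2 * fact k * exp 1 * (1 + y ^ n)"
proof -
  have "exp \<bar>ln y\<bar> \<le> y + 1 / y"
    using assms(1) by (cases "ln y \<ge> 0") (auto simp: exp_minus divide_inverse)
  then have "y * exp \<bar>ln y\<bar> \<le> y * (y + 1 / y)" using assms(1) by simp
  also have "\<dots> = y\<^sup>2 + 1" using assms(1) by (simp add: field_simps power2_eq_square)
  also have "y\<^sup>2 \<le> 1 + y ^ n"
  proof (cases "y \<le> 1")
    case True
    then have "y\<^sup>2 \<le> 1" using assms(1) by (simp add: power_le_one)
    then show ?thesis using assms(1) by (smt (verit) zero_le_power)
  next
    case False
    then show ?thesis using power_increasing[OF assms(2), of y] by linarith
  qed
  finally have "y * exp \<bar>ln y\<bar> \<le> 1 + y ^ n + 1" by simp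
  then have *: "y * exp \<bar>ln y\<bar> \<le> 2 * (1 + y ^ n)" by (rule order_trans) (use zero_less_power[OF assms(1), of n] in simp)
  have "y * (1 + \<bar>ln y\<bar>) ^ k \<le> y * (fact k * exp 1 * exp \<bar>ln y\<bar>)"
    using assms(1) by (intro mult_left_mono one_plus_power_le_fact_exp) auto
  also have "\<dots> = fact k * exp 1 * (y * exp \<bar>ln y\<bar>)" by simp
  also have "\<dots> \<le> fact k * exp 1 * (2 * (1 + y ^ n))"
    using * by (intro mult_left_mono) auto
  finally show ?thesis by (simp add: algebra_simps)
qed

text \<open>The difference is exp \<rho> times \<open>U \<rho> w\<close> with w in the unit ball,
  and coordinate j of \<open>U \<rho>\<close> is a polynomial in \<rho> of degree rk j. It is
  applied with m = n - 2, which covers all coordinates but the first.\<close>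

lemma abs_nth_le_of_D_le:
  fixes x y :: "real^'n::{finite,linorder}"
  assumes "D x y \<le> exp \<rho>" "rk j \<le> m"
  shows "\<bar>y $ j - x $ j\<bar> \<le> real CARD('n) * exp \<rho> * (1 + \<bar>\<rho>\<bar>) ^ m"
proof -
  define w where "w = E (- \<rho>) (x - y)"
  have w: "norm w \<le> 1" using assms by (simp add: w_def D_le_iff)
  have "x - y = exp \<rho> *\<^sub>R U \<rho> w" by (simp add: w_def flip: E_eq_U)
  then have "\<bar>(x - y) $ j\<bar> = exp \<rho> * \<bar>U \<rho> w $ j\<bar>" by (simp add: abs_mult)
  also have "\<bar>U \<rho> w $ j\<bar> \<le> (\<Sum>k\<le>rk j. \<bar>\<rho> ^ k / fact k * w $ ix (rk j - k)\<bar>)"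
    unfolding U_nth by (rule sum_abs)
  also have "\<dots> \<le> (\<Sum>k\<le>rk j. (1 + \<bar>\<rho>\<bar>) ^ m)"
  proof (rule sum_mono)
    fix k assume k: "k \<in> {..rk j}"
    have "\<bar>\<rho> ^ k\<bar> \<le> (1 + \<bar>\<rho>\<bar>) ^ k" by (auto simp: power_abs intro: power_mono)
    also have "\<dots> \<le> (1 + \<bar>\<rho>\<bar>) ^ m" using k assms(2) by (intro power_increasing) auto
    finally have "\<bar>\<rho> ^ k\<bar> / fact k \<le> (1 + \<bar>\<rho>\<bar>) ^ m / 1" by (intro frac_le) auto
    moreover have "\<bar>w $ ix (rk j - k)\<bar> \<le> 1" using w component_le_norm_cart order_trans by blast
    ultimately show "\<bar>\<rho> ^ k / fact k * w $ ix (rk j - k)\<bar> \<le> (1 + \<bar>\<rho>\<bar>) ^ m"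
      using mult_mono[of "\<bar>\<rho> ^ k\<bar> / fact k" "(1 + \<bar>\<rho>\<bar>) ^ m / 1" "\<bar>w $ ix (rk j - k)\<bar>" 1]
      by (simp add: abs_mult)
  qed
  also have "\<dots> \<le> real CARD('n) * (1 + \<bar>\<rho>\<bar>) ^ m"
    using rk_less[of j] by (auto intro!: mult_right_mono)
  finally show ?thesis by (simp add: abs_minus_commute mult_ac)
qed

lemma open_D_less:
  assumes "continuous_on UNIV f" "continuous_on UNIV g"
  shows "open {z. D (f z) (g z) < c}"
proof (cases "c > 0")
  case True
  have "{z. D (f z) (g z) < c} = {z. norm (E (- ln c) (f z - g z)) < 1}"
    using True D_less_iff[where t = "ln c"] by (metis exp_ln)
  then show ?thesis by (simp) (intro open_Collect_less continuous_intros assms)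
next
  case False
  then have "{z. D (f z) (g z) < c} = {}" using D_nonneg by (metis (no_types, lifting) Collect_empty_eq order.strict_trans1)
  then show ?thesis by simp
qed

lemma borel_measurable_D [measurable]:
  assumes "continuous_on UNIV f" "continuous_on UNIV g"
  shows "(\<lambda>z. D (f z) (g z)) \<in> borel_measurable borel"
  unfolding borel_measurable_iff_less using open_D_less[OF assms] by simp

section \<open>Averaged increments of weakly quasisymmetric maps\<close>

locale weak_quasisymmetry =
  fixes F :: "real^'n::{finite,linorder} \<Rightarrow> (real,'n) vec" and H :: real
  assumes bij_F: "bij F"
    and continuous_F: "continuous_on UNIV F"
    and H_ge_1: "1 \<le> H"
    and qs: "D x y \<le> D x z \<Longrightarrow> D (F x) (F y) \<le> H * D (F x) (F z)"
begin

lemma F_inj [simp]: "F x = F y \<longleftrightarrow> x = y"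
  using bij_F by (meson bij_is_inj injD)

lemma F_inv [simp]: "F (inv F y) = y" "inv F (F x) = x"
  using bij_F by (simp_all add: bij_is_surj surj_f_inv_f bij_is_inj)

text \<open>By \<open>qs\<close>, one reference point measures, up to the factor H, the size of the
  image of the whole D-ball of radius |r| about p.\<close>

definition R :: "real \<Rightarrow> (real,'n) vec \<Rightarrow> real" where
  "R r p = D (F p) (F (p + r *\<^sub>R first_axis))"

lemma R_pos: "r \<noteq> 0 \<Longrightarrow> R r p > 0"
  unfolding R_def by (rule D_pos) simp

lemma continuous_F_compose [continuous_intros]:
  "continuous_on S f \<Longrightarrow> continuous_on S (\<lambda>x. F (f x))"
  using continuous_on_compose2[OF continuous_F] by blast

lemma R_measurable [measurable]: "R r \<in> borel_measurable borel"
  unfolding R_def by (intro borel_measurable_D continuous_intros)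

lemma le_R: "D x y \<le> \<bar>r\<bar> \<Longrightarrow> D (F x) (F y) \<le> H * R r x"
  unfolding R_def by (rule qs) (simp add: D_first_axis)

lemma R_le: "\<bar>r\<bar> \<le> D x y \<Longrightarrow> R r x \<le> H * D (F x) (F y)"
  unfolding R_def by (rule qs) (simp add: D_first_axis)

text \<open>Tonelli on the set of pairs \<open>(p, y)\<close> with \<open>y\<close> in the D-ball of radius \<open>R r p / H\<close> about \<open>F p\<close>,
  which is contained in the image of the D-ball of radius \<open>r\<close> about \<open>p\<close>.\<close>

lemma nn_integral_R_power_le:
  assumes "T \<ge> 0"
  shows "(\<integral>\<^sup>+p. indicator (cball p0 \<rho>) p * ennreal (R (exp (- T)) p ^ CARD('n)) \<partial>lborel)
     \<le> ennreal (H ^ CARD('n) * exp (- T) ^ CARD('n) * measure lborel (F ` cball p0 (\<rho> + 1)))"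
proof -
  let ?r = "exp (- T)" and ?n = "CARD('n)"
  define W where "W = unit_ball_vol (real ?n)"
  have W: "W > 0" unfolding W_def by simp
  define S where "S = {z. fst z \<in> cball p0 \<rho> \<and> D (F (fst z)) (snd z) < R ?r (fst z) / H}"
  have S [measurable]: "S \<in> sets (lborel \<Otimes>\<^sub>M lborel)"
  proof -
    have [measurable]: "(\<lambda>z. D (F (fst z)) (snd z)) \<in> borel_measurable (borel :: ((real,'n) vec \<times> (real,'n) vec) measure)"
      by (intro borel_measurable_D continuous_intros)
    have [measurable]: "(\<lambda>z. R ?r (fst z)) \<in> borel_measurable (borel :: ((real,'n) vec \<times> (real,'n) vec) measure)"
      unfolding R_def by (intro borel_measurable_D continuous_intros)
    have [measurable]: "{z :: (real,'n) vec \<times> (real,'n) vec. fst z \<in> cball p0 \<rho>} \<in> sets borel"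
      unfolding mem_cball by (intro borel_closed closed_Collect_le continuous_intros)
    have "S = {z. fst z \<in> cball p0 \<rho>} \<inter> {z \<in> space borel. D (F (fst z)) (snd z) < R ?r (fst z) / H}"
      by (auto simp: S_def)
    also have "\<dots> \<in> sets borel" by measurable
    finally have "S \<in> sets borel" .
    moreover have "sets (lborel \<Otimes>\<^sub>M lborel :: ((real,'n) vec \<times> (real,'n) vec) measure) = sets borel"
      unfolding lborel_prod by (rule sets_lborel)
    ultimately show ?thesis by blast
  qed
  have sec1: "emeasure lborel (Pair p -` S) = indicator (cball p0 \<rho>) p * ennreal (W * (R ?r p / H) ^ ?n)" for p
  proof (cases "p \<in> cball p0 \<rho>")
    case True
    then have "Pair p -` S = {y. D (F p) y < exp (ln (R ?r p / H))}"
      using R_pos[of ?r p] H_ge_1 by (simp add: S_def)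
    then show ?thesis
      using True emeasure_D_ball[of "F p" "ln (R ?r p / H)"] R_pos[of ?r p] H_ge_1 by (simp add: W_def)
  qed (simp add: S_def)
  have comp: "compact (F ` cball p0 (\<rho> + 1))"
    by (intro compact_continuous_image continuous_on_subset[OF continuous_F]) auto
  have sec2: "emeasure lborel ((\<lambda>p. (p, y)) -` S) \<le> indicator (F ` cball p0 (\<rho> + 1)) y * ennreal (W * ?r ^ ?n)" for y
  proof -
    \<comment> \<open>By \<open>R_le\<close>, points at D-distance at least r from p have images at
      distance at least R / H from F p. So the section lies in the D-ball of radius r about the
      preimage of y.\<close>
    have sub: "D (inv F y) p < ?r" if "(p, y) \<in> S" for p
    proof (rule ccontr)
      assume "\<not> D (inv F y) p < ?r"
      then have "R ?r p \<le> H * D (F p) (F (inv F y))" by (intro R_le) (simp add: D_sym)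
      then show False using that H_ge_1 by (simp add: S_def field_simps)
    qed
    show ?thesis
    proof (cases "y \<in> F ` cball p0 (\<rho> + 1)")
      case True
      have "emeasure lborel ((\<lambda>p. (p, y)) -` S) \<le> emeasure lborel {p. D (inv F y) p < exp (- T)}"
        using sub open_D_less[of "\<lambda>_. inv F y" "\<lambda>p. p"] by (intro emeasure_mono) (auto intro: continuous_intros)
      then show ?thesis using True by (simp add: emeasure_D_ball W_def)
    next
      case False
      have "(p, y) \<notin> S" for p
      proof
        assume p: "(p, y) \<in> S"
        \<comment> \<open>As T >= 0, the radius is at most 1, and the D-ball of radius 1 is
          Euclidean. This is the origin of the margin in \<rho> + 1.\<close>
        have "D (inv F y) p \<le> exp 0" using sub[OF p] assms by (smt (verit) exp_le_cancel_iff)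
        then have "norm (inv F y - p) \<le> 1" by (subst (asm) D_le_iff) simp
        moreover have "dist p0 p \<le> \<rho>" using p by (simp add: S_def)
        ultimately have "inv F y \<in> cball p0 (\<rho> + 1)"
          using dist_triangle[of p0 "inv F y" p] by (simp add: dist_norm norm_minus_commute)
        then show False using False by (metis F_inv(1) imageI)
      qed
      then have "(\<lambda>p. (p, y)) -` S = {}" by auto
      then show ?thesis by simp
    qed
  qed
  have "(\<integral>\<^sup>+p. indicator (cball p0 \<rho>) p * ennreal (W * (R ?r p / H) ^ ?n) \<partial>lborel) = emeasure (lborel \<Otimes>\<^sub>M lborel) S"
    by (simp only: lborel.emeasure_pair_measure_alt[OF S] sec1)
  also have "\<dots> = (\<integral>\<^sup>+y. emeasure lborel ((\<lambda>p. (p, y)) -` S) \<partial>lborel)"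
    by (rule lborel_pair.emeasure_pair_measure_alt2) measurable
  also have "\<dots> \<le> (\<integral>\<^sup>+y. indicator (F ` cball p0 (\<rho> + 1)) y * ennreal (W * ?r ^ ?n) \<partial>lborel)"
    by (intro nn_integral_mono sec2)
  also have "\<dots> = emeasure lborel (F ` cball p0 (\<rho> + 1)) * ennreal (W * ?r ^ ?n)"
    using borel_compact[OF comp] by (simp add: nn_integral_multc nn_integral_indicator borel_measurable_indicator)
  also have "emeasure lborel (F ` cball p0 (\<rho> + 1)) = ennreal (measure lborel (F ` cball p0 (\<rho> + 1)))"
    using emeasure_compact_finite[OF comp] by (intro emeasure_eq_ennreal_measure) auto
  finally have le: "(\<integral>\<^sup>+p. indicator (cball p0 \<rho>) p * ennreal (W * (R ?r p / H) ^ ?n) \<partial>lborel)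
      \<le> ennreal (measure lborel (F ` cball p0 (\<rho> + 1)) * (W * ?r ^ ?n))"
    using W by (simp add: ennreal_mult)
  have "(\<integral>\<^sup>+p. indicator (cball p0 \<rho>) p * ennreal (R ?r p ^ ?n) \<partial>lborel)
     = (\<integral>\<^sup>+p. ennreal (H ^ ?n / W) * (indicator (cball p0 \<rho>) p * ennreal (W * (R ?r p / H) ^ ?n)) \<partial>lborel)"
  proof (intro nn_integral_cong)
    fix p
    have "R ?r p ^ ?n = H ^ ?n / W * (W * (R ?r p / H) ^ ?n)"
      using W H_ge_1 by (simp add: power_divide)
    then show "indicator (cball p0 \<rho>) p * ennreal (R ?r p ^ ?n) =
        ennreal (H ^ ?n / W) * (indicator (cball p0 \<rho>) p * ennreal (W * (R ?r p / H) ^ ?n))"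
      using W H_ge_1 by (auto simp: indicator_def simp flip: ennreal_mult')
  qed
  also have "\<dots> = ennreal (H ^ ?n / W) * (\<integral>\<^sup>+p. indicator (cball p0 \<rho>) p * ennreal (W * (R ?r p / H) ^ ?n) \<partial>lborel)"
  proof (rule nn_integral_cmult)
    have [measurable]: "R ?r \<in> borel_measurable lborel" "cball p0 \<rho> \<in> sets lborel"
      using R_measurable by simp_all
    show "(\<lambda>p. indicator (cball p0 \<rho>) p * ennreal (W * (R ?r p / H) ^ ?n)) \<in> borel_measurable lborel"
      by measurable
  qed
  also have "\<dots> \<le> ennreal (H ^ ?n / W) * ennreal (measure lborel (F ` cball p0 (\<rho> + 1)) * (W * ?r ^ ?n))"
    by (intro mult_left_mono le) simp
  also have "\<dots> = ennreal (H ^ ?n * ?r ^ ?n * measure lborel (F ` cball p0 (\<rho> + 1)))"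
    using W H_ge_1 by (simp add: field_simps flip: ennreal_mult')
  finally show ?thesis .
qed

text \<open>By \<open>le_R\<close> the image of the step has D-length at most exp \<rho> = H * R,
  where |\<rho>| is at most ln H + T + |ln y| for the normalised stretching y = exp T * R. The power
  of T is factored out and \<open>mult_log_power_le\<close> absorbs the logarithm of y. This leaves
  y ^ n, whose integral has a bound independent of T by
  \<open>nn_integral_R_power_le\<close>.\<close>

lemma increment_bound:
  assumes "CARD('n) \<ge> 2" "T \<ge> 0" "rk j \<le> CARD('n) - 2" "D p (p + v) \<le> exp (- T)"
  defines "K \<equiv> real CARD('n) * H * (1 + ln H) ^ (CARD('n) - 2) * (2 * fact (CARD('n) - 2) * exp 1)"
  shows "\<bar>F (p + v) $ j - F p $ j\<bar>
     \<le> K * exp (- T) * (1 + T) ^ (CARD('n) - 2) * (1 + (exp T * R (exp (- T)) p) ^ CARD('n))"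
proof -
  define y where "y = exp T * R (exp (- T)) p"
  let ?m = "CARD('n) - 2"
  have y: "y > 0" using R_pos by (simp add: y_def)
  have R: "R (exp (- T)) p = exp (- T) * y" by (simp add: y_def flip: exp_add)
  have lnH: "ln H \<ge> 0" using H_ge_1 by simp
  define \<rho> where "\<rho> = ln H + ln y - T"
  have \<rho>: "exp \<rho> = H * R (exp (- T)) p"
  proof -
    have "exp \<rho> = H * (exp (- T) * y)" using H_ge_1 y by (simp add: \<rho>_def exp_add exp_diff exp_minus divide_inverse)
    then show ?thesis by (simp only: R)
  qed
  have "1 + \<bar>\<rho>\<bar> \<le> 1 + (ln H + T + \<bar>ln y\<bar>)" using lnH assms(2) by (auto simp: \<rho>_def)
  also have "\<dots> \<le> (1 + ln H) * (1 + T) * (1 + \<bar>ln y\<bar>)"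
    using lnH assms(2) by (simp add: algebra_simps)
  finally have "(1 + \<bar>\<rho>\<bar>) ^ ?m \<le> ((1 + ln H) * (1 + T) * (1 + \<bar>ln y\<bar>)) ^ ?m"
    by (intro power_mono) auto
  also have "\<dots> = (1 + ln H) ^ ?m * (1 + T) ^ ?m * (1 + \<bar>ln y\<bar>) ^ ?m" by (simp add: power_mult_distrib)
  finally have 1: "(1 + \<bar>\<rho>\<bar>) ^ ?m \<le> (1 + ln H) ^ ?m * (1 + T) ^ ?m * (1 + \<bar>ln y\<bar>) ^ ?m" .
  have "D (F p) (F (p + v)) \<le> exp \<rho>" unfolding \<rho> using assms(4) by (intro le_R) auto
  then have "\<bar>F (p + v) $ j - F p $ j\<bar> \<le> real CARD('n) * exp \<rho> * (1 + \<bar>\<rho>\<bar>) ^ ?m"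
    by (rule abs_nth_le_of_D_le) (rule assms)
  also have "\<dots> \<le> real CARD('n) * exp \<rho> * ((1 + ln H) ^ ?m * (1 + T) ^ ?m * (1 + \<bar>ln y\<bar>) ^ ?m)"
    by (intro mult_left_mono 1) auto
  also have "\<dots> = real CARD('n) * H * (1 + ln H) ^ ?m * exp (- T) * (1 + T) ^ ?m * (y * (1 + \<bar>ln y\<bar>) ^ ?m)"
    by (simp add: \<rho> R mult_ac)
  also have "\<dots> \<le> real CARD('n) * H * (1 + ln H) ^ ?m * exp (- T) * (1 + T) ^ ?m * (2 * fact ?m * exp 1 * (1 + y ^ CARD('n)))"
    using lnH H_ge_1 assms(2) by (intro mult_left_mono mult_log_power_le y assms mult_nonneg_nonneg) auto
  finally show ?thesis by (simp add: K_def y_def mult_ac)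
qed

text \<open>The increment over m steps telescopes. After a translation, each step is integrated over
  part of the ball of radius \<rho> + s, so all m steps share one bound. The point is that M depends
  neither on T nor on v and m.\<close>

lemma chain_bound:
  assumes "CARD('n) \<ge> 2" "rk (j::'n) \<le> CARD('n) - 2"
  obtains M where "M \<ge> 0"
    "\<And>T v m. T \<ge> 0 \<Longrightarrow> D 0 v \<le> exp (- T) \<Longrightarrow> norm (real m *\<^sub>R v) \<le> s \<Longrightarrow>
      (\<integral>\<^sup>+p. indicator (cball p0 \<rho>) p * ennreal \<bar>F (p + real m *\<^sub>R v) $ j - F p $ j\<bar> \<partial>lborel)
       \<le> ennreal (real m * exp (- T) * (1 + T) ^ (CARD('n) - 2) * M)"
proof -
  let ?n = "CARD('n)"
  define K where "K = real ?n * H * (1 + ln H) ^ (?n - 2) * (2 * fact (?n - 2) * exp 1)"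
  have K: "K \<ge> 0" using H_ge_1 by (simp add: K_def)
  define B where "B = cball p0 (\<rho> + s)"
  define M where "M = measure lborel B + H ^ ?n * measure lborel (F ` cball p0 (\<rho> + s + 1))"
  have M: "M \<ge> 0" using H_ge_1 by (simp add: M_def)
  have "(\<integral>\<^sup>+p. indicator (cball p0 \<rho>) p * ennreal \<bar>F (p + real m *\<^sub>R v) $ j - F p $ j\<bar> \<partial>lborel)
       \<le> ennreal (real m * exp (- T) * (1 + T) ^ (?n - 2) * (K * M))"
    if T: "T \<ge> 0" and v: "D 0 v \<le> exp (- T)" and s: "norm (real m *\<^sub>R v) \<le> s" for T v m
  proof -
    define c where "c = K * exp (- T) * (1 + T) ^ (?n - 2)"
    have c: "c \<ge> 0" using K T by (simp add: c_def)
    define b where "b p = indicator B p * ennreal \<bar>F (p + v) $ j - F p $ j\<bar>" for p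
    have B [measurable]: "B \<in> sets borel" by (simp add: B_def)
    have [measurable]: "(\<lambda>p. F (p + v) $ j) \<in> borel_measurable borel" "(\<lambda>p. F p $ j) \<in> borel_measurable borel" for v
      by (intro borel_measurable_continuous_onI continuous_intros)+
    have b [measurable]: "b \<in> borel_measurable borel" unfolding b_def by measurable
    have "(\<integral>\<^sup>+p. b p \<partial>lborel) \<le> (\<integral>\<^sup>+p. ennreal c * (indicator B p + ennreal (exp T ^ ?n) * (indicator B p * ennreal (R (exp (- T)) p ^ ?n))) \<partial>lborel)"
    proof (intro nn_integral_mono)
      fix p
      have "D p (p + v) = D 0 v" by (rule D_diff_cong) simp
      then have "\<bar>F (p + v) $ j - F p $ j\<bar> \<le> c * (1 + (exp T * R (exp (- T)) p) ^ ?n)"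
        using increment_bound[OF assms(1) T assms(2), of p v] v by (simp add: c_def K_def)
      moreover have "ennreal (c * (1 + (exp T * R (exp (- T)) p) ^ ?n)) =
          ennreal c * (1 + ennreal (exp T ^ ?n) * ennreal (R (exp (- T)) p ^ ?n))"
        using c R_pos[of "exp (-T)" p] by (simp add: power_mult_distrib ennreal_plus ennreal_mult flip: ennreal_1)
      ultimately show "b p \<le> ennreal c * (indicator B p + ennreal (exp T ^ ?n) * (indicator B p * ennreal (R (exp (- T)) p ^ ?n)))"
        unfolding b_def indicator_def using ennreal_leI by fastforce
    qed
    also have "\<dots> = ennreal c * (emeasure lborel B + ennreal (exp T ^ ?n) * (\<integral>\<^sup>+p. indicator B p * ennreal (R (exp (- T)) p ^ ?n) \<partial>lborel))"
    proof -
      define g where "g p = indicator B p * ennreal (R (exp (- T)) p ^ ?n)" for p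
      have [measurable]: "g \<in> borel_measurable borel" unfolding g_def by measurable
      have "(\<integral>\<^sup>+p. ennreal c * (indicator B p + ennreal (exp T ^ ?n) * g p) \<partial>lborel)
          = ennreal c * (\<integral>\<^sup>+p. indicator B p + ennreal (exp T ^ ?n) * g p \<partial>lborel)"
        by (rule nn_integral_cmult) measurable
      also have "(\<integral>\<^sup>+p. indicator B p + ennreal (exp T ^ ?n) * g p \<partial>lborel)
          = (\<integral>\<^sup>+p. indicator B p \<partial>lborel) + (\<integral>\<^sup>+p. ennreal (exp T ^ ?n) * g p \<partial>lborel)"
        by (rule nn_integral_add) measurable
      also have "(\<integral>\<^sup>+p. ennreal (exp T ^ ?n) * g p \<partial>lborel) = ennreal (exp T ^ ?n) * (\<integral>\<^sup>+p. g p \<partial>lborel)"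
        by (rule nn_integral_cmult) measurable
      finally show ?thesis by (simp add: g_def)
    qed
    also have "\<dots> \<le> ennreal c * (emeasure lborel B + ennreal (exp T ^ ?n) * ennreal (H ^ ?n * exp (- T) ^ ?n * measure lborel (F ` cball p0 (\<rho> + s + 1))))"
      unfolding B_def by (intro mult_left_mono add_left_mono nn_integral_R_power_le T) auto
    also have "emeasure lborel B = ennreal (measure lborel B)"
      using emeasure_compact_finite[of B] by (intro emeasure_eq_ennreal_measure) (auto simp: B_def)
    also have "ennreal c * (ennreal (measure lborel B) + ennreal (exp T ^ ?n) * ennreal (H ^ ?n * exp (- T) ^ ?n * measure lborel (F ` cball p0 (\<rho> + s + 1)))) = ennreal (c * M)"
    proof -
      have "exp T ^ ?n * (H ^ ?n * exp (- T) ^ ?n * X) = H ^ ?n * X" for X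
        by (simp add: mult.commute mult.left_commute flip: power_mult_distrib exp_add)
      then show ?thesis using c H_ge_1
        by (simp add: M_def flip: ennreal_mult ennreal_mult' ennreal_plus)
    qed
    finally have step: "(\<integral>\<^sup>+p. b p \<partial>lborel) \<le> ennreal (c * M)" .
    have "(\<integral>\<^sup>+p. indicator (cball p0 \<rho>) p * ennreal \<bar>F (p + real m *\<^sub>R v) $ j - F p $ j\<bar> \<partial>lborel)
       \<le> (\<integral>\<^sup>+p. (\<Sum>i<m. b (real i *\<^sub>R v + p)) \<partial>lborel)"
    proof (intro nn_integral_mono)
      fix p
      show "indicator (cball p0 \<rho>) p * ennreal \<bar>F (p + real m *\<^sub>R v) $ j - F p $ j\<bar> \<le> (\<Sum>i<m. b (real i *\<^sub>R v + p))"
      proof (cases "p \<in> cball p0 \<rho>")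
        case True
        have inB: "real i *\<^sub>R v + p \<in> B" if "i < m" for i
        proof -
          have "norm (real i *\<^sub>R v) \<le> norm (real m *\<^sub>R v)"
            using that by (auto intro!: mult_right_mono)
          then show ?thesis using True s norm_triangle_ineq[of "p0 - p" "- (real i *\<^sub>R v)"]
            by (simp add: B_def dist_norm algebra_simps)
        qed
        have "\<bar>F (p + real m *\<^sub>R v) $ j - F p $ j\<bar> =
            \<bar>\<Sum>i<m. F (p + real (Suc i) *\<^sub>R v) $ j - F (p + real i *\<^sub>R v) $ j\<bar>"
          by (subst sum_lessThan_telescope[of "\<lambda>i. F (p + real i *\<^sub>R v) $ j"]) simp
        also have "\<dots> \<le> (\<Sum>i<m. \<bar>F (p + real (Suc i) *\<^sub>R v) $ j - F (p + real i *\<^sub>R v) $ j\<bar>)"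
          by (rule sum_abs)
        finally have "ennreal \<bar>F (p + real m *\<^sub>R v) $ j - F p $ j\<bar> \<le>
           ennreal (\<Sum>i<m. \<bar>F (p + real (Suc i) *\<^sub>R v) $ j - F (p + real i *\<^sub>R v) $ j\<bar>)"
          by (rule ennreal_leI)
        also have "\<dots> = (\<Sum>i<m. b (real i *\<^sub>R v + p))"
          using inB by (subst sum_ennreal[symmetric])
            (auto simp: b_def algebra_simps intro!: sum.cong)
        finally show ?thesis using True by simp
      qed simp
    qed
    also have "\<dots> = (\<Sum>i<m. \<integral>\<^sup>+p. b (real i *\<^sub>R v + p) \<partial>lborel)"
      by (rule nn_integral_sum) measurable
    also have "\<dots> = (\<Sum>i<m. \<integral>\<^sup>+p. b p \<partial>lborel)"
    \<comment> \<open>Translation invariance of Lebesgue measure.\<close>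
    proof (intro sum.cong refl)
      fix i
      have "(\<integral>\<^sup>+p. b p \<partial>distr lborel borel ((+) (real i *\<^sub>R v))) = (\<integral>\<^sup>+p. b (real i *\<^sub>R v + p) \<partial>lborel)"
        by (rule nn_integral_distr) auto
      then show "(\<integral>\<^sup>+p. b (real i *\<^sub>R v + p) \<partial>lborel) = (\<integral>\<^sup>+p. b p \<partial>lborel)"
        by (simp add: lborel_distr_plus)
    qed
    also have "\<dots> \<le> (\<Sum>i<m. ennreal (c * M))" by (intro sum_mono step)
    also have "\<dots> = ennreal (real m * (c * M))"
      by (simp add: ennreal_mult' ennreal_of_nat_eq_real_of_nat)
    finally show ?thesis by (simp add: c_def mult_ac)
  qed
  then show ?thesis using that[of "K * M"] K M by simp
qed

end

text \<open>In \<open>m\<close> steps \<open>E (- T) last_axis\<close> of D-length \<open>exp (- T)\<close>, with \<open>m\<close> of order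
  \<open>exp T / T ^ (n - 1)\<close>, one travels a fixed distance in the direction of the first axis.\<close>

lemma steps_tendsto_first_axis:
  fixes s :: real
  assumes "s > 0"
  defines "k \<equiv> CARD('n::{finite,linorder}) - 1"
  defines "m \<equiv> \<lambda>T. nat \<lfloor>s * fact k * exp (real T) / real T ^ k\<rfloor>"
  shows "(\<lambda>T. real (m T) *\<^sub>R ((-1) ^ k *\<^sub>R E (- real T) (last_axis :: (real,'n) vec))) \<longlonglongrightarrow> s *\<^sub>R first_axis"
proof (rule vec_tendstoI)
  fix i :: 'n
  \<comment> \<open>The number m T is chosen so that this tends to s * fact k: rounding down costs
    at most exp (- T) * T ^ k. The factor fact k cancels the denominator of the first coordinate of
    \<open>U\<close>.\<close>
  define c where "c T = real (m T) * exp (- real T) * real T ^ k" for T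
  have c: "c \<longlonglongrightarrow> s * fact k"
  proof (rule tendsto_sandwich)
    have "\<forall>\<^sub>F T in sequentially. s * fact k - exp (- real T) * real T ^ k \<le> c T \<and> c T \<le> s * fact k"
    proof (rule eventually_mono[OF eventually_gt_at_top[of 0]])
      fix T :: nat assume T: "T > 0"
      define x where "x = s * fact k * exp (real T) / real T ^ k"
      have x: "x \<ge> 0" using assms by (simp add: x_def)
      have e: "x * (exp (- real T) * real T ^ k) = s * fact k"
        using T by (simp add: x_def exp_minus field_simps)
      have "x - 1 \<le> real (m T)" "real (m T) \<le> x"
        using x unfolding m_def x_def[symmetric] by linarith+
      then have "(x - 1) * (exp (- real T) * real T ^ k) \<le> c T" "c T \<le> x * (exp (- real T) * real T ^ k)"
        unfolding c_def mult.assoc by (intro mult_right_mono; simp)+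
      then show "s * fact k - exp (- real T) * real T ^ k \<le> c T \<and> c T \<le> s * fact k"
        by (simp add: e left_diff_distrib)
    qed
    then show "\<forall>\<^sub>F T in sequentially. s * fact k - exp (- real T) * real T ^ k \<le> c T"
      "\<forall>\<^sub>F T in sequentially. c T \<le> s * fact k"
      by (auto elim: eventually_mono)
    have "(\<lambda>T. real T ^ k / exp (real T)) \<longlonglongrightarrow> 0"
      by (rule filterlim_compose[OF tendsto_power_div_exp_0 filterlim_real_sequentially])
    then have "(\<lambda>T. s * fact k - real T ^ k / exp (real T)) \<longlonglongrightarrow> s * fact k - 0"
      by (intro tendsto_intros)
    then show "(\<lambda>T. s * fact k - exp (- real T) * real T ^ k) \<longlonglongrightarrow> s * fact k"
      by (simp add: exp_minus field_simps)
  qed simp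
  have rk: "rk i \<le> k" using rk_less[of i] by (simp add: k_def)
  \<comment> \<open>Coordinate i of \<open>U\<close> carries only the power rk i of T, so it loses a
    factor T ^ (k - rk i) against the first coordinate. The sign (-1) ^ k undoes that of (- T) ^
    k.\<close>
  have L1: "(\<lambda>T. c T * ((-1) ^ k * (-1) ^ rk i / fact (rk i)) * (1 / real T) ^ (k - rk i))
      \<longlonglongrightarrow> s * fact k * ((-1) ^ k * (-1) ^ rk i / fact (rk i)) * 0 ^ (k - rk i)"
    by (intro tendsto_intros c lim_const_over_n)
  have L2: "s * fact k * ((-1) ^ k * (-1) ^ rk i / fact (rk i)) * 0 ^ (k - rk i) = (s *\<^sub>R (first_axis :: (real,'n) vec)) $ i"
  proof (cases "rk i = k")
    case True
    then have "i = ix (CARD('n) - Suc 0)" by (simp add: eq_ix_iff k_def)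
    then have "(first_axis :: (real,'n) vec) $ i = 1" by (simp only: axis_def) simp
    moreover have "(-1 :: real) ^ k * (-1) ^ k = 1" by (simp flip: power_mult_distrib)
    ultimately show ?thesis by (simp add: True)
  next
    case False
    then have "i \<noteq> ix (CARD('n) - Suc 0)" by (auto simp: k_def)
    then show ?thesis using False rk by (simp add: axis_def)
  qed
  have L3: "\<forall>\<^sub>F T in sequentially. c T * ((-1) ^ k * (-1) ^ rk i / fact (rk i)) * (1 / real T) ^ (k - rk i)
      = (real (m T) *\<^sub>R ((-1) ^ k *\<^sub>R E (- real T) (last_axis :: (real,'n) vec))) $ i"
  proof (rule eventually_mono[OF eventually_gt_at_top[of 0]])
    fix T :: nat assume T: "T > 0"
    have "real T ^ k = real T ^ rk i * real T ^ (k - rk i)" using rk by (simp flip: power_add)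
    then have "real T ^ k * (1 / real T) ^ (k - rk i) = real T ^ rk i"
      using T by (simp add: power_divide)
    moreover have "E (- real T) (last_axis :: (real,'n) vec) $ i = exp (- real T) * ((-1) ^ rk i * real T ^ rk i) / fact (rk i)"
      by (simp add: E_def toep_axis power_minus[of "real T"])
    ultimately show "c T * ((-1) ^ k * (-1) ^ rk i / fact (rk i)) * (1 / real T) ^ (k - rk i)
      = (real (m T) *\<^sub>R ((-1) ^ k *\<^sub>R E (- real T) (last_axis :: (real,'n) vec))) $ i"
      by (simp add: c_def)
  qed
  show "(\<lambda>T. (real (m T) *\<^sub>R ((-1) ^ k *\<^sub>R E (- real T) (last_axis :: (real,'n) vec))) $ i) \<longlonglongrightarrow> (s *\<^sub>R first_axis) $ i"
    unfolding L2[symmetric] by (rule Lim_transform_eventually[OF L1 L3])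
qed

section \<open>Constancy of the other coordinates along the first axis\<close>

context weak_quasisymmetry
begin

text \<open>If the coordinate changed, continuity would keep its increment above \<delta> / 2 for
  all base points near p0 and all displacements near that along the axis. So it is enough that the
  chains end near the target and that the increment is small in the mean: m T steps of mean order
  exp (- T) * T ^ (n - 2) give at most C / T.\<close>

lemma component_const_along_first_axis_pos:
  assumes "CARD('n) \<ge> 2" "rk j \<le> CARD('n) - 2" "s > 0"
  shows "F (p0 + s *\<^sub>R first_axis) $ j = F p0 $ j"
proof (rule ccontr)
  assume neq: "F (p0 + s *\<^sub>R first_axis) $ j \<noteq> F p0 $ j"
  define \<delta> where "\<delta> = \<bar>F (p0 + s *\<^sub>R first_axis) $ j - F p0 $ j\<bar>"
  have \<delta>: "\<delta> > 0" using neq by (simp add: \<delta>_def)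
  have "continuous_on UNIV (\<lambda>z. \<bar>F (fst z + snd z) $ j - F (fst z) $ j\<bar>)"
    by (intro continuous_intros)
  then have "open {z. \<delta> / 2 < \<bar>F (fst z + snd z) $ j - F (fst z) $ j\<bar>}"
    by (intro open_Collect_less continuous_intros)
  moreover have "(p0, s *\<^sub>R first_axis) \<in> {z. \<delta> / 2 < \<bar>F (fst z + snd z) $ j - F (fst z) $ j\<bar>}"
    using \<delta> by (simp add: \<delta>_def)
  ultimately obtain A B where AB: "open A" "open B" "p0 \<in> A" "s *\<^sub>R first_axis \<in> B"
      "A \<times> B \<subseteq> {z. \<delta> / 2 < \<bar>F (fst z + snd z) $ j - F (fst z) $ j\<bar>}"
    by (rule open_prod_elim) auto
  obtain \<rho> where \<rho>: "\<rho> > 0" "cball p0 \<rho> \<subseteq> A" using AB open_contains_cball by blast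
  have big: "\<delta> / 2 < \<bar>F (p + w) $ j - F p $ j\<bar>" if "p \<in> cball p0 \<rho>" "w \<in> B" for p w
    using that \<rho> AB(5) by force
  define k where "k = CARD('n) - 1"
  define m where "m T = nat \<lfloor>s * fact k * exp (real T) / real T ^ k\<rfloor>" for T
  define v where "v T = (-1) ^ k *\<^sub>R E (- real T) (last_axis :: (real,'n) vec)" for T
  have lim: "(\<lambda>T. real (m T) *\<^sub>R v T) \<longlonglongrightarrow> s *\<^sub>R first_axis"
    using steps_tendsto_first_axis[OF assms(3), where 'n='n] by (simp add: m_def v_def k_def)
  obtain M where M: "M \<ge> 0"
    "\<And>T v m. T \<ge> 0 \<Longrightarrow> D 0 v \<le> exp (- T) \<Longrightarrow> norm (real m *\<^sub>R v) \<le> s + 1 \<Longrightarrow>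
      (\<integral>\<^sup>+p. indicator (cball p0 \<rho>) p * ennreal \<bar>F (p + real m *\<^sub>R v) $ j - F p $ j\<bar> \<partial>lborel)
       \<le> ennreal (real m * exp (- T) * (1 + T) ^ (CARD('n) - 2) * M)"
    using chain_bound[OF assms(1,2), of "s + 1" p0 \<rho>] by blast
  define V where "V = measure lborel (cball p0 \<rho>)"
  have V: "V > 0" using content_cball_pos[OF \<rho>(1)] by (simp add: V_def)
  define C where "C = s * fact k * 2 ^ (CARD('n) - 2) * M"
  have "\<forall>\<^sub>F T in sequentially. real (m T) *\<^sub>R v T \<in> B"
    using lim AB(2,4) by (rule topological_tendstoD)
  moreover have "\<forall>\<^sub>F T in sequentially. norm (real (m T) *\<^sub>R v T) < s + 1"
    by (rule order_tendstoD(2)[OF tendsto_norm[OF lim]]) (use assms(3) in \<open>simp, linarith?\<close>)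
  moreover have "\<forall>\<^sub>F T in sequentially. C / real T < \<delta> / 2 * V"
    using \<delta> V by (intro order_tendstoD(2)[OF lim_const_over_n]) auto
  ultimately have "\<forall>\<^sub>F T in sequentially. real (m T) *\<^sub>R v T \<in> B \<and> norm (real (m T) *\<^sub>R v T) < s + 1 \<and> C / real T < \<delta> / 2 * V \<and> T > 0"
    using eventually_gt_at_top[of 0] by eventually_elim auto
  then obtain T where T: "real (m T) *\<^sub>R v T \<in> B" "norm (real (m T) *\<^sub>R v T) < s + 1" "C / real T < \<delta> / 2 * V" "T > 0"
    by (metis (no_types, lifting) eventually_happens' sequentially_bot)
  have "D 0 (0 + E (- real T) ((-1) ^ k *\<^sub>R (last_axis :: (real,'n) vec))) = exp (- real T)"
    by (rule D_E_unit) (simp add: power_abs)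
  then have "D 0 (v T) \<le> exp (- real T)" by (simp add: v_def E_simps)
  then have "(\<integral>\<^sup>+p. indicator (cball p0 \<rho>) p * ennreal \<bar>F (p + real (m T) *\<^sub>R v T) $ j - F p $ j\<bar> \<partial>lborel)
       \<le> ennreal (real (m T) * exp (- real T) * (1 + real T) ^ (CARD('n) - 2) * M)"
    using T by (intro M(2)) auto
  moreover have "(\<integral>\<^sup>+p. indicator (cball p0 \<rho>) p * ennreal \<bar>F (p + real (m T) *\<^sub>R v T) $ j - F p $ j\<bar> \<partial>lborel)
     \<ge> (\<integral>\<^sup>+p. ennreal (\<delta> / 2) * indicator (cball p0 \<rho>) p \<partial>lborel)"
  proof (rule nn_integral_mono)
    fix p
    show "ennreal (\<delta> / 2) * indicator (cball p0 \<rho>) p \<le> indicator (cball p0 \<rho>) p * ennreal \<bar>F (p + real (m T) *\<^sub>R v T) $ j - F p $ j\<bar>"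
      using big[OF _ T(1), of p] by (cases "p \<in> cball p0 \<rho>") (auto intro!: ennreal_leI)
  qed
  moreover have "(\<integral>\<^sup>+p. ennreal (\<delta> / 2) * indicator (cball p0 \<rho>) p \<partial>lborel) = ennreal (\<delta> / 2 * V)"
    using \<delta> emeasure_compact_finite[of "cball p0 \<rho>"]
    by (simp add: nn_integral_cmult_indicator V_def emeasure_eq_ennreal_measure flip: ennreal_mult')
  ultimately have "ennreal (\<delta> / 2 * V) \<le> ennreal (real (m T) * exp (- real T) * (1 + real T) ^ (CARD('n) - 2) * M)"
    by simp
  then have "\<delta> / 2 * V \<le> real (m T) * exp (- real T) * (1 + real T) ^ (CARD('n) - 2) * M"
    using M(1) by (subst (asm) ennreal_le_iff) auto
  also have "\<dots> \<le> (s * fact k / real T ^ k) * (2 * real T) ^ (CARD('n) - 2) * M"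
  proof -
    have "real (m T) \<le> s * fact k * exp (real T) / real T ^ k"
      using assms(3) by (simp add: m_def)
    then have "real (m T) * exp (- real T) \<le> s * fact k * exp (real T) / real T ^ k * exp (- real T)"
      by (intro mult_right_mono) auto
    also have "\<dots> = s * fact k / real T ^ k" by (simp add: exp_minus field_simps)
    finally show ?thesis using T(4) M(1) assms(3)
      by (intro mult_right_mono mult_mono power_mono) auto
  qed
  also have "\<dots> = C / real T"
  proof -
    have "k = Suc (CARD('n) - 2)" using assms(1) by (simp add: k_def)
    then show ?thesis using T(4) by (simp add: C_def power_mult_distrib field_simps)
  qed
  finally show False using T(3) by simp
qed

lemma component_const_along_first_axis:
  assumes "CARD('n) \<ge> 2" "rk j \<le> CARD('n) - 2"
  shows "F (p + s *\<^sub>R first_axis) $ j = F p $ j"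
proof (cases s "0::real" rule: linorder_cases)
  case less
  then show ?thesis
    using component_const_along_first_axis_pos[OF assms, of "- s" "p + s *\<^sub>R first_axis"] by simp
next
  case greater
  then show ?thesis using component_const_along_first_axis_pos[OF assms, of s] by simp
qed simp

end

section \<open>Lipschitz continuity\<close>

lemma quasisymmetric_imp_weak:
  fixes F :: "real^'n::{finite,linorder} \<Rightarrow> (real,'n) vec"
  assumes "quasisymmetric D D F"
  obtains H where "weak_quasisymmetry F H"
proof -
  from assms obtain \<eta> \<eta>' where bij: "bij F" and hom: "homeomorphism {0::real..} {0::real..} \<eta> \<eta>'"
    and qs: "\<And>x y z. x \<noteq> y \<Longrightarrow> y \<noteq> z \<Longrightarrow> x \<noteq> z \<Longrightarrow> D (F x) (F y) / D (F x) (F z) \<le> \<eta> (D x y / D x z)"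
    unfolding quasisymmetric_def by metis
  have F_inj: "F x = F y \<longleftrightarrow> x = y" for x y using bij by (meson bij_is_inj injD)
  have cont: "continuous_on {0..} \<eta>" and im: "\<eta> ` {0..} = {0..}" and inv: "\<And>t. t \<ge> 0 \<Longrightarrow> \<eta>' (\<eta> t) = t"
    using hom by (auto simp: homeomorphism_def)
  \<comment> \<open>The weak condition concerns ratios up to 1, where continuity provides a maximum
    of \<eta>.\<close>
  obtain t1 where "t1 \<in> {0..1}" "\<And>t. t \<in> {0..1} \<Longrightarrow> \<eta> t \<le> \<eta> t1"
    using continuous_attains_sup[of "{0..1::real}" \<eta>] continuous_on_subset[OF cont] by auto
  define H where "H = max 1 (\<eta> t1)"
  have weak: "D (F x) (F y) \<le> H * D (F x) (F z)" if le: "D x y \<le> D x z" for x y z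
  proof -
    consider "x = y" | "x \<noteq> y" "y = z" | "x \<noteq> y" "y \<noteq> z" "x \<noteq> z"
      using le D_pos[of x y] by force
    then show ?thesis
    proof cases
      case 3
      then have "D (F x) (F y) / D (F x) (F z) \<le> \<eta> (D x y / D x z)" by (rule qs)
      also have "\<dots> \<le> H" unfolding H_def
        using \<open>\<And>t. t \<in> {0..1} \<Longrightarrow> \<eta> t \<le> \<eta> t1\<close>[of "D x y / D x z"] le D_pos[OF 3(3)] by (auto simp: field_simps)
      finally show ?thesis using D_pos[of "F x" "F z"] 3 by (simp add: F_inj field_simps)
    next
      case 2
      then show ?thesis using mult_right_mono[of 1 H "D (F x) (F z)"] by (simp add: H_def)
    qed (simp add: H_def)
  qed
  \<comment> \<open>Otherwise \<eta> would attain its minimum 0 at an interior point, which is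
    impossible for an injective continuous function.\<close>
  have \<eta>0: "\<eta> 0 = 0"
  proof (rule ccontr)
    assume ne: "\<eta> 0 \<noteq> 0"
    obtain a where a: "a \<ge> 0" "\<eta> a = 0" using im by (metis atLeast_iff image_iff order_refl)
    then have a0: "a > 0" using ne by (cases "a = 0") auto
    have "inj_on \<eta> {0..a+1}" using inv by (metis atLeastAtMost_iff inj_onI)
    then have "(\<eta> 0 < \<eta> a \<and> \<eta> a < \<eta> (a+1)) \<or> (\<eta> (a+1) < \<eta> a \<and> \<eta> a < \<eta> 0)"
      using a0 by (intro continuous_inj_imp_mono continuous_on_subset[OF cont]) auto
    moreover have "\<eta> 0 \<ge> 0" "\<eta> (a+1) \<ge> 0" using im a0 by auto
    ultimately show False using a by simp
  qed
  have contF: "continuous_on UNIV F"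
    unfolding continuous_on_iff
  proof (intro ballI allI impI)
    fix x :: "(real,'n) vec" and e :: real assume e: "e > 0"
    define z where "z = x + first_axis"
    have xz: "x \<noteq> z" by (simp add: z_def axis_eq_0_iff)
    define c where "c = D (F x) (F z)"
    have c: "c > 0" using xz by (auto simp: c_def F_inj intro: D_pos)
    obtain d1 where d1: "d1 > 0" "\<And>w. D (F x) w < d1 \<Longrightarrow> norm (F x - w) < e"
      using D_small_imp_close[OF e] by blast
    obtain d2 where d2: "d2 > 0" "\<And>t. t \<ge> 0 \<Longrightarrow> t < d2 \<Longrightarrow> \<eta> t < d1 / c"
    proof -
      have "d1 / c > 0" using d1 c by simp
      then obtain d2 where "d2 > 0" "\<forall>t\<in>{0..}. dist t 0 < d2 \<longrightarrow> dist (\<eta> t) (\<eta> 0) < d1 / c"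
        using cont unfolding continuous_on_iff by (metis atLeast_iff order_refl)
      then show ?thesis using that[of d2] by (force simp: \<eta>0 dist_norm)
    qed
    \<comment> \<open>The entry 1 keeps y apart from the reference point z, so that x, y, z are
      distinct; d2 makes the value of \<eta> small.\<close>
    have "min 1 d2 * D x z > 0" using d2 D_pos[OF xz] by simp
    then obtain d where d: "d > 0" "\<And>y. norm (x - y) < d \<Longrightarrow> D x y < min 1 d2 * D x z"
      using close_imp_D_small by blast
    show "\<exists>d>0. \<forall>y\<in>UNIV. dist y x < d \<longrightarrow> dist (F y) (F x) < e"
    proof (intro exI[of _ d] conjI ballI impI d(1))
      fix y assume "dist y x < d"
      then have y: "D x y < min 1 d2 * D x z" using d(2) by (simp add: dist_norm norm_minus_commute)
      show "dist (F y) (F x) < e"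
      proof (cases "x = y")
        case False
        have y': "D x y < D x z" "D x y < d2 * D x z"
          using y mult_right_mono[of "min 1 d2" 1 "D x z"] mult_right_mono[of "min 1 d2" d2 "D x z"] by auto
        then have "y \<noteq> z" by auto
        then have "D (F x) (F y) / c \<le> \<eta> (D x y / D x z)" unfolding c_def using False xz by (intro qs) auto
        also have "\<dots> < d1 / c"
          using y' D_pos[OF xz] by (intro d2) (auto simp: field_simps)
        finally have "D (F x) (F y) < d1" using c by (simp add: divide_less_cancel)
        then show ?thesis using d1(2) by (metis dist_norm dist_commute)
      qed (simp add: e)
    qed
  qed
  have "weak_quasisymmetry F H"
    using bij contF weak by unfold_locales (auto simp: H_def)
  then show ?thesis by (rule that)
qed

section \<open>Stretching of lines in the direction of the first axis\<close>

locale weak_quasisymmetry_ge2 = weak_quasisymmetry F H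
  for F :: "real^'n::{finite,linorder} \<Rightarrow> (real,'n) vec" and H +
  assumes card_ge_2: "CARD('n) \<ge> 2"
begin

definition g :: "(real,'n) vec \<Rightarrow> real \<Rightarrow> real" where
  "g p s = (F (p + s *\<^sub>R first_axis) - F p) $ ix (CARD('n) - Suc 0)"

lemma F_line: "F (p + s *\<^sub>R first_axis) = F p + g p s *\<^sub>R first_axis"
proof (rule vec_eq_iff[THEN iffD2], intro allI)
  fix i :: 'n
  show "F (p + s *\<^sub>R first_axis) $ i = (F p + g p s *\<^sub>R first_axis) $ i"
  proof (cases "i = ix (CARD('n) - Suc 0)")
    case True
    then show ?thesis by (simp add: g_def axis_def)
  next
    case False
    then have "rk i \<noteq> CARD('n) - Suc 0" by (simp add: eq_ix_iff)
    then have "rk i \<le> CARD('n) - 2" using rk_less[of i] by simp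
    then show ?thesis using component_const_along_first_axis[OF card_ge_2] False by (simp add: axis_def)
  qed
qed

lemma R_eq_abs_g: "R s p = \<bar>g p s\<bar>"
  by (simp add: R_def F_line D_first_axis)

lemma g_add: "g p (a + b) = g p a + g (p + a *\<^sub>R first_axis) b"
  by (simp add: g_def scaleR_add_left add.assoc)

lemma g_0 [simp]: "g p 0 = 0"
  by (simp add: g_def)

lemma g_eq_0_iff [simp]: "g p s = 0 \<longleftrightarrow> s = 0"
  using R_pos[of s p] R_eq_abs_g[of s p] by (cases "s = 0") auto

lemma continuous_g: "continuous_on UNIV (\<lambda>z. g (fst z) (snd z))"
  unfolding g_def by (intro continuous_intros)

text \<open>The function g is continuous and has no zero on the connected set of pairs with h > 0.
  The common sign makes R additive along a line.\<close>

lemma g_sign: "(\<forall>p. \<forall>h>0. g p h > 0) \<or> (\<forall>p. \<forall>h>0. g p h < 0)"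
proof -
  let ?A = "(UNIV :: (real,'n) vec set) \<times> {0<..}"
  have "connected ((\<lambda>z. g (fst z) (snd z)) ` ?A)"
    by (intro connected_continuous_image continuous_on_subset[OF continuous_g] convex_connected convex_Times) auto
  then have "\<not> (a < 0 \<and> b > 0)" if "a \<in> (\<lambda>z. g (fst z) (snd z)) ` ?A" "b \<in> (\<lambda>z. g (fst z) (snd z)) ` ?A" for a b
    using that connectedD_interval[of _ a b 0] by fastforce
  then have *: "\<not> (g p h < 0 \<and> g q k > 0)" if "h > 0" "k > 0" for p q h k
    using that by force
  show ?thesis
  proof (rule ccontr)
    assume "\<not> ?thesis"
    then obtain p h q k where "h > 0" "k > 0" "\<not> g p h > 0" "\<not> g q k < 0" by auto
    moreover then have "g p h \<noteq> 0" "g q k \<noteq> 0" by auto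
    ultimately show False using *[of h k p q] by simp
  qed
qed

lemma R_add:
  assumes "a \<ge> 0" "b \<ge> 0"
  shows "R (a + b) p = R a p + R b (p + a *\<^sub>R first_axis)"
proof (cases "a = 0 \<or> b = 0")
  case False
  then show ?thesis using g_sign assms unfolding R_eq_abs_g g_add
    by (smt (verit))
qed (auto simp: R_eq_abs_g)

text \<open>By \<open>le_R\<close> the values of R along one half-line bound the distance of every
  image point from F p. A bound for them would contradict surjectivity of F.\<close>

lemma R_unbounded:
  assumes "\<sigma> \<noteq> 0"
  shows "\<exists>s>0. M < R (\<sigma> * s) p"
proof (rule ccontr)
  assume "\<not> ?thesis"
  then have le: "R (\<sigma> * s) p \<le> M" if "s > 0" for s using that by force
  have "D (F p) w \<le> H * M" for w
  proof (cases "inv F w = p")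
    case False
    define s where "s = D p (inv F w) / \<bar>\<sigma>\<bar>"
    have s: "s > 0" using False assms by (auto simp: s_def intro!: divide_pos_pos D_pos)
    then have "D (F p) (F (inv F w)) \<le> H * R (\<sigma> * s) p"
      using assms by (intro le_R) (simp add: abs_mult, simp add: s_def)
    then show ?thesis using le[OF s] H_ge_1 by (smt (verit) F_inv(1) mult_left_mono)
  next
    case True
    then have "F p = w" by auto
    moreover have "M \<ge> 0" using le[of 1] by (simp add: R_eq_abs_g)
    ultimately show ?thesis using H_ge_1 by simp
  qed
  then have "D (F p) (F p + (\<bar>H * M\<bar> + 1) *\<^sub>R first_axis) \<le> H * M" .
  then show False by (simp add: D_first_axis)
qed

lemma g_surj: "\<exists>s. g p s = t"
proof -
  obtain a where a: "a > 0" "\<bar>t\<bar> < R (1 * a) p" using R_unbounded[of 1] by auto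
  obtain b where b: "b > 0" "\<bar>t\<bar> < R (- 1 * b) p" using R_unbounded[of "-1"] by auto
  have "g p (- b) = - g (p + (- b) *\<^sub>R first_axis) b" using g_add[of p "-b" b] by simp
  then have "(g p (- b) \<le> t \<and> t \<le> g p a) \<or> (g p a \<le> t \<and> t \<le> g p (- b))"
    using a b g_sign by (simp add: R_eq_abs_g) (smt (verit))
  moreover have c: "continuous_on {-b..a} (g p)" unfolding g_def by (intro continuous_intros)
  ultimately show ?thesis
    using IVT'[OF _ _ _ c, of t] IVT2'[OF _ _ _ c, of t] a(1) b(1) by fastforce
qed

text \<open>The line through \<open>p\<close> is at constant distance \<open>h\<close> from a parallel line, which makes its
  stretching at scale \<open>h\<close> comparable at all of its points.\<close>

lemma R_line_le:
  assumes "h > 0"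
  shows "R h (p + a *\<^sub>R first_axis) \<le> H\<^sup>2 * R h p"
proof -
  define w where "w = E (ln h) (last_axis :: (real,'n) vec)"
  define q where "q = p + w"
  have "D p q = exp (ln h)" unfolding q_def w_def by (rule D_E_unit) simp
  then have pq: "D p q = h" using assms by simp
  \<comment> \<open>The point on the parallel line whose image has advanced as far as that of p + a
    e_1. The two images then differ by F p - F q, whose size is controlled at p.\<close>
  obtain s where s: "g q s = g p a" using g_surj by blast
  \<comment> \<open>The last coordinate of the rescaled difference is -1 wherever the points lie on
    their lines, so the lines are nowhere closer than h.\<close>
  have "\<not> D (p + a *\<^sub>R first_axis) (q + s *\<^sub>R first_axis) < exp (ln h)"
  proof -
    have "E (- ln h) (p + a *\<^sub>R first_axis - (q + s *\<^sub>R first_axis)) = E (- ln h) ((a - s) *\<^sub>R first_axis) - last_axis"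
      by (simp add: q_def w_def E_simps algebra_simps)
    also have "\<dots> = ((a - s) * exp (- ln h)) *\<^sub>R first_axis - last_axis"
      unfolding E_simps by (simp add: E_def toep_first_axis)
    finally have "\<bar>E (- ln h) (p + a *\<^sub>R first_axis - (q + s *\<^sub>R first_axis)) $ ix 0\<bar> = 1"
    proof -
      assume e: "E (- ln h) (p + a *\<^sub>R first_axis - (q + s *\<^sub>R first_axis)) = ((a - s) * exp (- ln h)) *\<^sub>R first_axis - last_axis"
      have "rk (ix 0 :: 'n) \<noteq> CARD('n) - Suc 0" using card_ge_2 by simp
      then have "(ix 0 :: 'n) \<noteq> ix (CARD('n) - Suc 0)" using eq_ix_iff[of "CARD('n) - Suc 0" "ix 0 :: 'n"] by auto
      then show ?thesis unfolding e by (simp add: axis_def)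
    qed
    then show ?thesis unfolding D_less_iff
      by (metis component_le_norm_cart not_less)
  qed
  then have far: "h \<le> D (p + a *\<^sub>R first_axis) (q + s *\<^sub>R first_axis)" using assms by simp
  have "R h (p + a *\<^sub>R first_axis) \<le> H * D (F (p + a *\<^sub>R first_axis)) (F (q + s *\<^sub>R first_axis))"
    using far assms by (intro R_le) simp
  also have "D (F (p + a *\<^sub>R first_axis)) (F (q + s *\<^sub>R first_axis)) = D (F p) (F q)"
    unfolding F_line s by simp
  also have "H * D (F p) (F q) \<le> H * (H * R h p)"
    using H_ge_1 pq assms by (intro mult_left_mono le_R) auto
  finally show ?thesis by (simp add: power2_eq_square)
qed

lemma R_0 [simp]: "R 0 p = 0"
  by (simp add: R_eq_abs_g)

lemma R_nonneg [simp]: "0 \<le> R h p"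
  by (simp add: R_eq_abs_g)

text \<open>R splits into m summands along the line, and \<open>R_line_le\<close> compares each with
  the first. So R is linear in the scale up to constants; \<open>R_le_scale_1\<close> and
  \<open>scale_1_le_R\<close> pay a further factor 2 for rounding h or 1 / h.\<close>

lemma R_mult_le:
  assumes "h > 0"
  shows "R (real m * h) p \<le> real m * (H\<^sup>2 * R h p)" "real m * R h p \<le> H\<^sup>2 * R (real m * h) p"
proof (induction m)
  case (Suc m)
  have *: "R (real (Suc m) * h) p = R (real m * h) p + R h (p + (real m * h) *\<^sub>R first_axis)"
    using R_add[of "real m * h" h p] assms by (simp add: algebra_simps)
  case 1
  show ?case using Suc(1) R_line_le[OF assms, of p "real m * h"] unfolding * by (simp add: algebra_simps)
  case 2
  show ?case using Suc(2) R_line_le[OF assms, of "p + (real m * h) *\<^sub>R first_axis" "- (real m * h)"]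
    unfolding * by (simp add: algebra_simps)
qed simp_all

lemma R_mono: "0 \<le> a \<Longrightarrow> a \<le> b \<Longrightarrow> R a p \<le> R b p"
  using R_add[of a "b - a" p] by simp

lemma R_le_scale_1:
  assumes "h > 0" shows "R h p \<le> 2 * H\<^sup>2 * h * R 1 p"
proof (cases "h \<ge> 1")
  case True
  define m where "m = nat \<lceil>h\<rceil>"
  have m: "h \<le> real m" "real m \<le> 2 * h" using True unfolding m_def by linarith+
  have "R h p \<le> R (real m * 1) p" using assms m by (intro R_mono) auto
  also have "\<dots> \<le> real m * (H\<^sup>2 * R 1 p)" by (rule R_mult_le) simp
  also have "\<dots> \<le> (2 * h) * (H\<^sup>2 * R 1 p)" using m by (intro mult_right_mono) auto
  finally show ?thesis by (simp add: mult_ac)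
next
  case False
  define m where "m = nat \<lfloor>1 / h\<rfloor>"
  have "\<lfloor>1 / h\<rfloor> \<ge> 1" using False assms by (simp add: le_floor_iff)
  then have m: "real m \<le> 1 / h" "1 / h \<le> 2 * real m" unfolding m_def by linarith+
  have "1 / h * R h p \<le> 2 * real m * R h p" using m by (intro mult_right_mono) auto
  also have "\<dots> \<le> 2 * (H\<^sup>2 * R (real m * h) p)" using R_mult_le(2)[OF assms, of m p] by simp
  also have "R (real m * h) p \<le> R 1 p" using m assms by (intro R_mono) (auto simp: field_simps)
  finally have "1 / h * R h p \<le> 2 * (H\<^sup>2 * R 1 p)" using H_ge_1 by (simp add: mult_left_mono)
  then show ?thesis using assms by (simp add: field_simps)
qed

lemma scale_1_le_R:
  assumes "h > 0" shows "h * R 1 p \<le> 2 * H\<^sup>2 * R h p"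
proof (cases "h \<ge> 1")
  case True
  define m where "m = nat \<lfloor>h\<rfloor>"
  have "\<lfloor>h\<rfloor> \<ge> 1" using True by (simp add: le_floor_iff)
  then have m: "real m \<le> h" "h \<le> 2 * real m" unfolding m_def by linarith+
  have "h * R 1 p \<le> 2 * real m * R 1 p" using m by (intro mult_right_mono) auto
  also have "\<dots> \<le> 2 * (H\<^sup>2 * R (real m * 1) p)" using R_mult_le(2)[of 1 m p] by simp
  also have "\<dots> \<le> 2 * (H\<^sup>2 * R h p)" using m by (intro mult_left_mono R_mono) auto
  finally show ?thesis by (simp add: mult_ac)
next
  case False
  define m where "m = nat \<lceil>1 / h\<rceil>"
  have "1 / h \<ge> 1" using False assms by simp
  then have m: "1 / h \<le> real m" "real m \<le> 2 / h" unfolding m_def by linarith+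
  have "R 1 p \<le> R (real m * h) p" using m assms by (intro R_mono) (auto simp: field_simps)
  also have "\<dots> \<le> real m * (H\<^sup>2 * R h p)" by (rule R_mult_le) fact
  also have "\<dots> \<le> 2 / h * (H\<^sup>2 * R h p)" using m by (intro mult_right_mono) auto
  finally show ?thesis using assms by (simp add: field_simps)
qed

text \<open>At scale d = D q 0 the stretchings at q and at 0 are both comparable with the distance
  from F q to F 0. Linearity in the scale transfers this to scale 1, and d cancels.\<close>

lemma R_1_le: "R 1 q \<le> 4 * H ^ 6 * R 1 0"
proof (cases "q = 0")
  case False
  define d where "d = D q 0"
  have d: "d > 0" using False by (simp add: d_def D_pos)
  have H2: "H\<^sup>2 \<ge> 0" by simp
  have "d * R 1 q \<le> 2 * H\<^sup>2 * R d q" by (rule scale_1_le_R) fact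
  also have "\<dots> \<le> 2 * H\<^sup>2 * (H * D (F q) (F 0))"
    using d H_ge_1 by (intro mult_left_mono R_le) (auto simp: d_def)
  also have "\<dots> = 2 * H\<^sup>2 * H * D (F 0) (F q)" by (simp add: D_sym)
  also have "\<dots> \<le> 2 * H\<^sup>2 * H * (H * R d 0)"
    using d H_ge_1 by (intro mult_left_mono le_R) (auto simp: d_def D_sym)
  also have "\<dots> \<le> 2 * H\<^sup>2 * H * (H * (2 * H\<^sup>2 * d * R 1 0))"
    using d H_ge_1 by (intro mult_left_mono R_le_scale_1) auto
  also have "\<dots> = d * (4 * H ^ 6 * R 1 0)" by (simp add: eval_nat_numeral)
  finally show ?thesis using d by simp
next
  case True
  have "1 * R 1 0 \<le> (4 * H ^ 6) * R 1 0"
    using one_le_power[OF H_ge_1, of 6] by (intro mult_right_mono) (simp_all add: R_eq_abs_g)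
  then show ?thesis using True by simp
qed

lemma D_Lipschitz: "D (F x) (F y) \<le> 8 * H ^ 9 * R 1 0 * D x y"
proof (cases "x = y")
  case False
  define d where "d = D x y"
  have d: "d > 0" using False by (simp add: d_def D_pos)
  have "D (F x) (F y) \<le> H * R d x" using d by (intro le_R) (auto simp: d_def)
  also have "\<dots> \<le> H * (2 * H\<^sup>2 * d * R 1 x)"
    using d H_ge_1 by (intro mult_left_mono R_le_scale_1) auto
  also have "\<dots> \<le> H * (2 * H\<^sup>2 * d * (4 * H ^ 6 * R 1 0))"
    using d H_ge_1 by (intro mult_left_mono R_1_le) auto
  also have "\<dots> = 8 * H ^ 9 * R 1 0 * d" by (simp add: eval_nat_numeral)
  finally show ?thesis by (simp add: d_def)
qed simp

end

text \<open>A map that is Lipschitz for \<open>D\<close> is, at scales above \<open>exp (- \<tau>)\<close>, Lipschitz for each of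
  the norms \<open>\<lambda>x. norm (U \<tau> x)\<close>, with the same constant.\<close>

lemma D_Lipschitz_imp_U_Lipschitz:
  fixes F :: "real^'n::{finite,linorder} \<Rightarrow> (real,'n) vec"
  assumes L: "L > 0" and lip: "\<And>x y. D (F x) (F y) \<le> L * D x y"
  obtains C where "C > 0"
    "\<And>\<tau> p u. exp (- \<tau>) \<le> norm u \<Longrightarrow> norm (U \<tau> (F (p + U (- \<tau>) u) - F p)) \<le> C * norm u"
proof -
  define C where "C = L * Ubound TYPE('n) (ln L)"
  have C: "C > 0" using L Ubound_ge_1[of "ln L", where 'n='n] by (simp add: C_def)
  have step: "norm (U \<tau> (F (p + U (- \<tau>) u) - F p)) \<le> C * exp (- \<tau>)" if "norm u \<le> exp (- \<tau>)" for \<tau> p u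
  proof -
    define \<Delta> where "\<Delta> = F (p + U (- \<tau>) u) - F p"
    have "norm (E \<tau> (U (- \<tau>) u)) = exp \<tau> * norm u" by (simp add: E_eq_U)
    also have "\<dots> \<le> exp \<tau> * exp (- \<tau>)" using that by (intro mult_left_mono) auto
    finally have "norm (E (- (- \<tau>)) (p + U (- \<tau>) u - p)) \<le> 1" by (simp flip: exp_add)
    then have "D (p + U (- \<tau>) u) p \<le> exp (- \<tau>)" by (simp only: D_le_iff)
    then have "D (F (p + U (- \<tau>) u)) (F p) \<le> L * exp (- \<tau>)"
      using lip[of "p + U (- \<tau>) u" p] L by (meson mult_left_mono order_trans less_imp_le)
    also have "\<dots> = exp (ln L - \<tau>)" using L by (simp add: exp_diff exp_minus field_simps)
    finally have "norm (E (\<tau> - ln L) \<Delta>) \<le> 1" by (simp add: D_le_iff \<Delta>_def)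
    moreover have "E \<tau> \<Delta> = E (ln L) (E (\<tau> - ln L) \<Delta>)" by (simp flip: E_add)
    moreover have "norm (E (ln L) (E (\<tau> - ln L) \<Delta>)) \<le> C * norm (E (\<tau> - ln L) \<Delta>)"
      using norm_E_le[of "ln L" "E (\<tau> - ln L) \<Delta>"] L by (simp add: C_def)
    moreover have "C * norm (E (\<tau> - ln L) \<Delta>) \<le> C * 1"
      using calculation C by (intro mult_left_mono) auto
    ultimately have "norm (E \<tau> \<Delta>) \<le> C" by (metis mult_1_right order_trans)
    then have "exp \<tau> * norm (U \<tau> \<Delta>) \<le> C" by (simp add: E_eq_U)
    then show ?thesis by (simp add: \<Delta>_def exp_minus field_simps)
  qed
  have "norm (U \<tau> (F (p + U (- \<tau>) u) - F p)) \<le> 2 * C * norm u" if u: "exp (- \<tau>) \<le> norm u" for \<tau> p u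
  proof -
    \<comment> \<open>The vector u is cut into m pieces of norm at most exp (- \<tau>), the scale
      treated in \<open>step\<close>. The lower bound on norm u is what keeps the rounding within a
      factor 2.\<close>
    define m where "m = nat \<lceil>norm u * exp \<tau>\<rceil>"
    have "norm u * exp \<tau> \<ge> 1" using u by (simp add: exp_minus field_simps)
    then have m: "norm u * exp \<tau> \<le> real m" "real m \<le> 2 * (norm u * exp \<tau>)" "m > 0"
      unfolding m_def by linarith+
    define v where "v = (1 / real m) *\<^sub>R u"
    have v: "norm v \<le> exp (- \<tau>)" using m by (simp add: v_def exp_minus field_simps)
    have mv: "real m *\<^sub>R v = u" using m(3) by (simp add: v_def)
    define q where "q i = p + real i *\<^sub>R U (- \<tau>) v" for i
    have "q m = p + U (- \<tau>) u" by (simp add: q_def flip: mv U_simps)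
    then have "U \<tau> (F (p + U (- \<tau>) u) - F p) = U \<tau> (\<Sum>i<m. F (q (Suc i)) - F (q i))"
      by (simp add: sum_lessThan_telescope[of "\<lambda>i. F (q i)"]) (simp add: q_def)
    also have "\<dots> = (\<Sum>i<m. U \<tau> (F (q (Suc i)) - F (q i)))" by (rule linear_sum[OF linear_U])
    also have "norm \<dots> \<le> (\<Sum>i<m. norm (U \<tau> (F (q (Suc i)) - F (q i))))" by (rule norm_sum)
    also have "\<dots> \<le> (\<Sum>i<m. C * exp (- \<tau>))"
    proof (rule sum_mono)
      fix i
      have "q (Suc i) = q i + U (- \<tau>) v" by (simp add: q_def algebra_simps)
      then show "norm (U \<tau> (F (q (Suc i)) - F (q i))) \<le> C * exp (- \<tau>)" using step[OF v] by simp
    qed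
    also have "\<dots> = real m * (C * exp (- \<tau>))" by simp
    also have "\<dots> \<le> 2 * (norm u * exp \<tau>) * (C * exp (- \<tau>))" using m C by (intro mult_right_mono) auto
    also have "\<dots> = 2 * C * norm u" by (simp add: exp_minus field_simps)
    finally show ?thesis .
  qed
  then show ?thesis using that[of "2 * C"] C by simp
qed

section \<open>The structure of Lipschitz maps\<close>

lemma continuous_additive_imp_linear:
  fixes f :: "real \<Rightarrow> real"
  assumes cont: "continuous_on UNIV f" and add: "\<And>x y. f (x + y) = f x + f y"
  shows "f x = x * f 1"
proof -
  have f0: "f 0 = 0" using add[of 0 0] by simp
  have fneg: "f (- x) = - f x" for x using add[of x "-x"] f0 by simp
  have fnat: "f (real n * x) = real n * f x" for n x
    by (induction n) (simp_all add: f0 add algebra_simps)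
  have fint: "f (of_int k * x) = of_int k * f x" for k x
    by (cases k rule: int_cases2) (simp_all add: fnat fneg)
  have "closed {x. f x = x * f 1}"
    by (intro closed_Collect_eq cont continuous_intros)
  moreover have "\<rat> \<subseteq> {x. f x = x * f 1}"
  proof
    fix x :: real assume "x \<in> \<rat>"
    then obtain a b where ab: "b \<noteq> 0" "x = of_int a / of_nat b" by (metis Rats_cases' of_int_of_nat_eq of_nat_0_less_iff pos_int_cases less_irrefl)
    have "real b * f (1 / real b) = f 1" using fnat[of b "1 / real b"] ab by simp
    then have "f (1 / real b) = f 1 / real b" using ab by (simp add: field_simps)
    then show "x \<in> {x. f x = x * f 1}" using fint[of a "1 / real b"] ab by simp
  qed
  ultimately show ?thesis using closure_minimal[of "\<rat>"] Rats_closure_real by blast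
qed

definition U_Lipschitz :: "real \<Rightarrow> (real^'n::{finite,linorder} \<Rightarrow> (real,'n) vec) \<Rightarrow> bool" where
  "U_Lipschitz C F \<longleftrightarrow> C \<ge> 0 \<and>
     (\<forall>\<tau> p u. exp (- \<tau>) \<le> norm u \<longrightarrow> norm (U \<tau> (F (p + U (- \<tau>) u) - F p)) \<le> C * norm u)"

text \<open>\<open>toep a\<close> commutes with \<open>U \<tau>\<close>, so conjugation does not
  change it and its bound is uniform in \<tau>.\<close>

lemma U_Lipschitz_diff_toep:
  fixes F :: "real^'n::{finite,linorder} \<Rightarrow> (real,'n) vec"
  assumes "U_Lipschitz C F"
  shows "U_Lipschitz (C + (\<Sum>k<CARD('n). \<bar>fps_nth a k\<bar>)) (\<lambda>x. F x - toep a x)"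
  unfolding U_Lipschitz_def
proof (intro conjI allI impI)
  show "0 \<le> C + (\<Sum>k<CARD('n). \<bar>fps_nth a k\<bar>)"
    using assms by (auto simp: U_Lipschitz_def intro!: add_nonneg_nonneg sum_nonneg)
  fix \<tau> p and u :: "(real,'n) vec" assume u: "exp (- \<tau>) \<le> norm u"
  have "U \<tau> (toep a (U (- \<tau>) u)) = toep a u"
    by (simp add: U_def toep_commute[of _ a]) (simp flip: toep_mult fps_exp_add_mult)
  then have "U \<tau> (F (p + U (- \<tau>) u) - toep a (p + U (- \<tau>) u) - (F p - toep a p))
      = U \<tau> (F (p + U (- \<tau>) u) - F p) - toep a u"
    by (simp add: toep_add U_simps)
  moreover have "norm (U \<tau> (F (p + U (- \<tau>) u) - F p)) \<le> C * norm u"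
    using assms u by (simp add: U_Lipschitz_def)
  ultimately show "norm (U \<tau> (F (p + U (- \<tau>) u) - toep a (p + U (- \<tau>) u) - (F p - toep a p)))
      \<le> (C + (\<Sum>k<CARD('n). \<bar>fps_nth a k\<bar>)) * norm u"
    using norm_triangle_ineq4[of "U \<tau> (F (p + U (- \<tau>) u) - F p)" "toep a u"] norm_toep_le[of a u]
    by (simp add: distrib_right)
qed

text \<open>A small multiple of the last basis vector is stretched by \<^term>\<open>U (- \<tau>)\<close> to unit size in
  coordinate \<open>d\<close>, while the coordinates between \<open>d\<close> and the last one tend to 0. Those before \<open>d\<close>
  blow up, which is harmless if the function is already known not to depend on them.\<close>

lemma U_bounded_imp_depends_on_last:
  fixes \<phi> :: "real^'n::{finite,linorder} \<Rightarrow> real"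
  assumes cont: "continuous_on UNIV \<phi>"
    and bound: "\<And>\<tau> p u. exp (- \<tau>) \<le> norm u \<Longrightarrow> \<bar>\<phi> (p + U (- \<tau>) u) - \<phi> p\<bar> \<le> C * norm u"
    and eq: "p $ ix 0 = q $ ix 0"
  shows "\<phi> p = \<phi> q"
proof -
  \<comment> \<open>Induction on the number e of coordinates, counted from the first one, on which
    \<phi> is known not to depend.\<close>
  have claim: "\<forall>p q. (\<forall>i. rk i < CARD('n) - e \<longrightarrow> p $ i = q $ i) \<longrightarrow> \<phi> p = \<phi> q" if "e < CARD('n)" for e
    using that
  proof (induction e)
    case 0
    have "p = q" if "\<forall>i. rk i < CARD('n) - 0 \<longrightarrow> p $ i = q $ i" for p q :: "(real,'n) vec"
      using that by (simp add: vec_eq_iff rk_less)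
    then show ?case by blast
  next
    case (Suc e)
    define d where "d = CARD('n) - Suc e"
    have d: "d < CARD('n)" "CARD('n) - e = Suc d" using Suc.prems by (auto simp: d_def)
    have IH: "\<phi> p = \<phi> q" if "\<And>i. rk i \<le> d \<Longrightarrow> p $ i = q $ i" for p q
      using Suc that by (simp add: d(2) less_Suc_eq_le)
    have along: "\<phi> (p + axis (ix d) s) = \<phi> p" if "s \<noteq> 0" for p s
    proof -
      \<comment> \<open>Chosen so that coordinate d of \<open>U (- T) (u T)\<close> is exactly s: it
        is s divided by (- T) ^ d / fact d.\<close>
      define c where "c T = s * fact d * (-1) ^ d * (1 / real T) ^ d" for T
      define u where "u T = c T *\<^sub>R (last_axis :: (real,'n) vec)" for T
      \<comment> \<open>The coordinates that blow up are cut off, which \<phi> does not notice by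
        \<open>IH\<close>.\<close>
      define v where "v T = (\<chi> i. if rk i \<le> d then (U (- real T) (u T)) $ i else 0)" for T
      have dpos: "d > 0" using Suc.prems by (simp add: d_def)
      have "(\<lambda>T. c T) \<longlonglongrightarrow> s * fact d * (-1) ^ d * 0 ^ d"
        unfolding c_def by (intro tendsto_intros lim_const_over_n)
      moreover have "s * fact d * (-1) ^ d * 0 ^ d = 0" using dpos by simp
      ultimately have c: "c \<longlonglongrightarrow> 0" by simp
      have vl: "v \<longlonglongrightarrow> axis (ix d) s"
      proof (rule vec_tendstoI)
        fix i :: 'n
        show "(\<lambda>T. v T $ i) \<longlonglongrightarrow> axis (ix d) s $ i"
        proof (cases "rk i \<le> d")
          case True
          have L1: "(\<lambda>T. s * fact d * (-1) ^ d * (-1) ^ rk i / fact (rk i) * (1 / real T) ^ (d - rk i))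
             \<longlonglongrightarrow> s * fact d * (-1) ^ d * (-1) ^ rk i / fact (rk i) * 0 ^ (d - rk i)"
            by (intro tendsto_intros lim_const_over_n) simp
          have L3: "\<forall>\<^sub>F T in sequentially. s * fact d * (-1) ^ d * (-1) ^ rk i / fact (rk i) * (1 / real T) ^ (d - rk i) = v T $ i"
          proof (rule eventually_mono[OF eventually_gt_at_top[of 0]])
            fix T :: nat assume T: "T > 0"
            have "real T ^ d = real T ^ rk i * real T ^ (d - rk i)" using True by (simp flip: power_add)
            then have "(1 / real T) ^ d * real T ^ rk i = (1 / real T) ^ (d - rk i)"
              using T by (simp add: power_divide)
            moreover have "v T $ i = c T * ((-1) ^ rk i * real T ^ rk i / fact (rk i))"
              using True by (simp add: v_def u_def U_simps) (simp add: U_def toep_axis power_minus[of "real T"])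
            ultimately show "s * fact d * (-1) ^ d * (-1) ^ rk i / fact (rk i) * (1 / real T) ^ (d - rk i) = v T $ i"
              by (simp add: c_def)
          qed
          have L2: "s * fact d * (-1) ^ d * (-1) ^ rk i / fact (rk i) * 0 ^ (d - rk i) = axis (ix d) s $ i"
          proof (cases "rk i = d")
            case True
            then have "axis (ix d) s $ i = s" using d(1) by (auto simp: axis_def eq_ix_iff)
            moreover have "(-1 :: real) ^ d * (-1) ^ d = 1" by (simp flip: power_mult_distrib)
            ultimately show ?thesis by (simp add: True)
          next
            case False
            then have "i \<noteq> ix d" using d(1) by (auto simp: rk_ix)
            then show ?thesis using False \<open>rk i \<le> d\<close> by (simp add: axis_def)
          qed
          show ?thesis using Lim_transform_eventually[OF L1 L3] unfolding L2 .
        next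
          case False
          then have "i \<noteq> ix d" using d(1) by (auto simp: rk_ix)
          then show ?thesis using False by (simp add: v_def axis_def)
        qed
      qed
      have "(\<lambda>T. \<phi> (p + v T)) \<longlonglongrightarrow> \<phi> (p + axis (ix d) s)"
        by (rule continuous_on_tendsto_compose[OF cont]) (auto intro: tendsto_intros vl)
      moreover have "(\<lambda>T. \<phi> (p + v T)) \<longlonglongrightarrow> \<phi> p"
      proof -
        have "(\<lambda>T. real T ^ d / exp (real T)) \<longlonglongrightarrow> 0"
          by (rule filterlim_compose[OF tendsto_power_div_exp_0 filterlim_real_sequentially])
        then have "\<forall>\<^sub>F T in sequentially. real T ^ d / exp (real T) < \<bar>s\<bar>"
          using that by (intro order_tendstoD) auto
        then have "\<forall>\<^sub>F T in sequentially. norm (\<phi> (p + v T) - \<phi> p) \<le> C * \<bar>c T\<bar>"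
          using eventually_gt_at_top[of 0]
        proof eventually_elim
          case (elim T)
          \<comment> \<open>c T decays only like a power of T, so it stays above exp (- T) and
            \<open>bound\<close> applies.\<close>
          have "exp (- real T) \<le> \<bar>s\<bar> * (1 / real T) ^ d"
            using elim by (simp add: exp_minus power_divide field_simps)
          also have "\<dots> \<le> fact d * (\<bar>s\<bar> * (1 / real T) ^ d)"
            using mult_right_mono[of 1 "fact d" "\<bar>s\<bar> * (1 / real T) ^ d"] fact_ge_1[of d, where 'a=real] by simp
          also have "\<dots> = \<bar>c T\<bar>" by (simp add: c_def abs_mult power_abs)
          finally have "\<bar>\<phi> (p + U (- real T) (u T)) - \<phi> p\<bar> \<le> C * norm (u T)"
            by (intro bound) (simp add: u_def)
          moreover have "\<phi> (p + U (- real T) (u T)) = \<phi> (p + v T)"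
            by (rule IH) (simp add: v_def)
          ultimately show ?case by (simp add: u_def)
        qed
        moreover have "(\<lambda>T. C * \<bar>c T\<bar>) \<longlonglongrightarrow> 0"
          using tendsto_mult_right_zero[OF tendsto_rabs_zero[OF c]] by simp
        ultimately have "(\<lambda>T. \<phi> (p + v T) - \<phi> p) \<longlonglongrightarrow> 0" by (rule Lim_null_comparison)
        then show ?thesis by (rule LIM_zero_cancel)
      qed
      ultimately show ?thesis by (rule LIMSEQ_unique)
    qed
    have "\<phi> p = \<phi> q" if agree: "\<forall>i. rk i < d \<longrightarrow> p $ i = q $ i" for p q :: "(real,'n) vec"
    proof -
      define s where "s = q $ ix d - p $ ix d"
      have "\<phi> (p + axis (ix d) s) = \<phi> q"
      proof (rule IH)
        fix i :: 'n assume "rk i \<le> d"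
        then show "(p + axis (ix d) s) $ i = q $ i"
          using agree d(1) eq_ix_iff[OF d(1), of i] by (cases "rk i = d") (auto simp: axis_def s_def)
      qed
      moreover have "axis (ix d) 0 = (0 :: (real,'n) vec)" by (simp add: axis_eq_0_iff)
      ultimately show ?thesis using along[of s p] by (cases "s = 0") auto
    qed
    then show ?case by (simp add: d_def)
  qed
  have "CARD('n) - 1 < CARD('n)" "CARD('n) - (CARD('n) - 1) = 1" by (simp_all add: Suc_leI)
  moreover have "\<forall>i. rk i < 1 \<longrightarrow> p $ i = q $ i"
    using eq by (auto simp: eq_ix_iff) (metis ix_rk)
  ultimately show ?thesis using claim[of "CARD('n) - 1"] by metis
qed

text \<open>Compare the two orders in which a step at scale \<open>\<tau>\<^sub>1\<close> and a step at scale \<open>\<tau>\<^sub>2\<close> can be made,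
  and let \<open>\<tau>\<^sub>1\<close> tend to infinity.\<close>

lemma U_bounded_imp_affine:
  fixes \<psi> :: "real^'n::{finite,linorder} \<Rightarrow> real" and f :: "real \<Rightarrow> real"
  assumes cont: "continuous_on UNIV f"
    and bound: "\<And>\<tau> p u. exp (- \<tau>) \<le> norm u \<Longrightarrow>
       \<bar>\<psi> (p + U (- \<tau>) u) - \<psi> p + \<tau> * (f (p $ ix 0 + u $ ix 0) - f (p $ ix 0))\<bar> \<le> C * norm u"
  shows "f y = f 0 + (f 1 - f 0) * y"
proof -
  have nz: "f (y + s) - f y = f (y + s + s') - f (y + s')" if "s \<noteq> 0" "s' \<noteq> 0" for y s s'
  proof (rule ccontr)
    define A where "A = (f (y + s) - f y) - (f (y + s + s') - f (y + s'))"
    define B where "B = (f (y + s + s') - f (y + s)) - (f (y + s') - f y)"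
    assume "\<not> ?thesis"
    then have A: "A \<noteq> 0" by (simp add: A_def)
    \<comment> \<open>The smallest value that \<open>bound\<close> admits for a step of size |s'|;
      it stays fixed while \<tau>1 grows.\<close>
    define \<tau>2 where "\<tau>2 = - ln \<bar>s'\<bar>"
    have key: "\<bar>\<tau>1 * A + \<tau>2 * B\<bar> \<le> 2 * C * (\<bar>s\<bar> + \<bar>s'\<bar>)" if "exp (- \<tau>1) \<le> \<bar>s\<bar>" for \<tau>1
    proof -
      define p where "p = y *\<^sub>R (last_axis :: (real,'n) vec)"
      define a where "a = s *\<^sub>R (last_axis :: (real,'n) vec)"
      define b where "b = s' *\<^sub>R (last_axis :: (real,'n) vec)"
      have [simp]: "p $ ix 0 = y" "a $ ix 0 = s" "b $ ix 0 = s'" "norm a = \<bar>s\<bar>" "norm b = \<bar>s'\<bar>"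
        by (simp_all add: p_def a_def b_def)
      have [simp]: "U t x $ ix 0 = x $ ix 0" for t and x :: "(real,'n) vec"
        by (simp add: U_nth)
      have e: "exp (- \<tau>1) \<le> norm a" "exp (- \<tau>2) \<le> norm b" using that \<open>s' \<noteq> 0\<close> by (auto simp: \<tau>2_def)
      have 1: "\<bar>\<psi> (p + U (- \<tau>1) a) - \<psi> p + \<tau>1 * (f (y + s) - f y)\<bar> \<le> C * \<bar>s\<bar>"
        using bound[OF e(1), of p] by simp
      have 2: "\<bar>\<psi> (p + U (- \<tau>1) a + U (- \<tau>2) b) - \<psi> (p + U (- \<tau>1) a) + \<tau>2 * (f (y + s + s') - f (y + s))\<bar> \<le> C * \<bar>s'\<bar>"
        using bound[OF e(2), of "p + U (- \<tau>1) a"] by simp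
      have 3: "\<bar>\<psi> (p + U (- \<tau>2) b) - \<psi> p + \<tau>2 * (f (y + s') - f y)\<bar> \<le> C * \<bar>s'\<bar>"
        using bound[OF e(2), of p] by simp
      have 4: "\<bar>\<psi> (p + U (- \<tau>1) a + U (- \<tau>2) b) - \<psi> (p + U (- \<tau>2) b) + \<tau>1 * (f (y + s + s') - f (y + s'))\<bar> \<le> C * \<bar>s\<bar>"
        using bound[OF e(1), of "p + U (- \<tau>2) b"] by (simp add: algebra_simps)
      \<comment> \<open>Both orders of the steps end at the same point, so \<psi> cancels in this
        signed sum. What remains is \<tau>1 times a second difference A of f, plus a term
        independent of \<tau>1.\<close>
      have "\<tau>1 * A + \<tau>2 * B =
          (\<psi> (p + U (- \<tau>1) a) - \<psi> p + \<tau>1 * (f (y + s) - f y))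
        + (\<psi> (p + U (- \<tau>1) a + U (- \<tau>2) b) - \<psi> (p + U (- \<tau>1) a) + \<tau>2 * (f (y + s + s') - f (y + s)))
        - (\<psi> (p + U (- \<tau>2) b) - \<psi> p + \<tau>2 * (f (y + s') - f y))
        - (\<psi> (p + U (- \<tau>1) a + U (- \<tau>2) b) - \<psi> (p + U (- \<tau>2) b) + \<tau>1 * (f (y + s + s') - f (y + s')))"
        by (simp add: A_def B_def algebra_simps)
      also have "\<bar>\<dots>\<bar> \<le> C * \<bar>s\<bar> + C * \<bar>s'\<bar> + C * \<bar>s'\<bar> + C * \<bar>s\<bar>"
      proof -
        have "\<bar>a + b - c - d\<bar> \<le> \<bar>a\<bar> + \<bar>b\<bar> + \<bar>c\<bar> + \<bar>d\<bar>" for a b c d :: real by linarith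
        then show ?thesis by (rule order_trans) (intro add_mono 1 2 3 4)
      qed
      finally show ?thesis by (simp add: algebra_simps)
    qed
    define M where "M = 2 * C * (\<bar>s\<bar> + \<bar>s'\<bar>) + \<bar>\<tau>2 * B\<bar>"
    define \<tau>1 where "\<tau>1 = max (- ln \<bar>s\<bar>) ((\<bar>M\<bar> + 1) / \<bar>A\<bar>)"
    have "exp (- \<tau>1) \<le> exp (ln \<bar>s\<bar>)" unfolding exp_le_cancel_iff \<tau>1_def by linarith
    then have "\<bar>\<tau>1 * A + \<tau>2 * B\<bar> \<le> 2 * C * (\<bar>s\<bar> + \<bar>s'\<bar>)" using \<open>s \<noteq> 0\<close> by (intro key) simp
    then have "\<bar>\<tau>1 * A\<bar> \<le> M" unfolding M_def by linarith
    moreover have "(\<bar>M\<bar> + 1) / \<bar>A\<bar> * \<bar>A\<bar> \<le> \<tau>1 * \<bar>A\<bar>" by (intro mult_right_mono) (auto simp: \<tau>1_def)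
    then have "\<bar>M\<bar> + 1 \<le> \<bar>\<tau>1 * A\<bar>" using A by (simp add: abs_mult) (smt (verit) mult_right_mono abs_ge_self abs_ge_zero)
    ultimately show False by linarith
  qed
  have "f (s + s') - f 0 = (f s - f 0) + (f s' - f 0)" for s s'
    using nz[of s s' 0] by (cases "s = 0 \<or> s' = 0") (auto simp: algebra_simps)
  then have "(\<lambda>y. f y - f 0) y = y * (\<lambda>y. f y - f 0) 1"
    by (intro continuous_additive_imp_linear continuous_intros cont) auto
  then show ?thesis by (simp add: algebra_simps)
qed

text \<open>Induction on the rank m up to which F - p(N) has constant coordinates. The coordinate of
  rank m is then unchanged by \<open>U \<tau>\<close>, so it inherits the bound and depends on x_n
  alone. The coordinate of rank m + 1 acquires \<tau> times its increment, which makes it affine.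
  The induction ends at rank n - 1, where no next coordinate exists.\<close>

theorem U_Lipschitz_structure:
  fixes F :: "real^'n::{finite,linorder} \<Rightarrow> (real,'n) vec"
  assumes cont: "continuous_on UNIV F" and lip: "U_Lipschitz C F"
  obtains a C' h where "\<And>x. F x = F 0 + toep a x + h (x $ ix 0) *\<^sub>R first_axis"
    "\<And>y s. \<bar>h (y + s) - h y\<bar> \<le> C' * \<bar>s\<bar>"
proof -
  have leading: "\<bar>G (p + U (- \<tau>) u) $ i - G p $ i\<bar> \<le> C * norm u"
    if G: "U_Lipschitz C G" and const: "\<And>j p q. rk j < rk i \<Longrightarrow> G p $ j = G q $ j"
      and u: "exp (- \<tau>) \<le> norm u" for G :: "(real,'n) vec \<Rightarrow> (real,'n) vec" and C p u \<tau> i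
  proof -
    define \<Delta> where "\<Delta> = G (p + U (- \<tau>) u) - G p"
    have "\<Delta> $ ix (rk i - k) = 0" if "k \<noteq> 0" "k \<le> rk i" for k
    proof -
      have "rk (ix (rk i - k) :: 'n) < rk i" using that rk_less[of i] by (subst rk_ix) auto
      then show ?thesis using const by (simp add: \<Delta>_def)
    qed
    then have "U \<tau> \<Delta> $ i = (\<Sum>k\<le>rk i. if k = 0 then \<Delta> $ i else 0)"
      unfolding U_nth by (intro sum.cong) auto
    then have "\<Delta> $ i = U \<tau> \<Delta> $ i" by simp
    also have "\<bar>\<dots>\<bar> \<le> norm (U \<tau> \<Delta>)" by (rule component_le_norm_cart)
    also have "\<dots> \<le> C * norm u" using G u by (simp add: U_Lipschitz_def \<Delta>_def)
    finally show ?thesis by (simp add: \<Delta>_def)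
  qed
  have depends: "G p $ i = G q $ i"
    if G: "continuous_on UNIV G" "U_Lipschitz C G" and const: "\<And>j p q. rk j < rk i \<Longrightarrow> G p $ j = G q $ j"
      and pq: "p $ ix 0 = q $ ix 0" for G :: "(real,'n) vec \<Rightarrow> (real,'n) vec" and C p q i
    by (rule U_bounded_imp_depends_on_last[OF _ leading[OF G(2) const] pq]) (intro continuous_intros G)
  have "\<exists>a C'. U_Lipschitz C' (\<lambda>x. F x - toep a x) \<and>
      (\<forall>i p q. rk i < m \<longrightarrow> F p $ i - toep a p $ i = F q $ i - toep a q $ i)" if "m < CARD('n)" for m
    using that
  proof (induction m)
    case 0
    show ?case using U_Lipschitz_diff_toep[OF lip, of 0] by auto
  next
    case (Suc m)
    then obtain a C1 where a: "U_Lipschitz C1 (\<lambda>x. F x - toep a x)"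
      "\<And>i p q. rk i < m \<Longrightarrow> F p $ i - toep a p $ i = F q $ i - toep a q $ i"
      by auto
    define G where "G x = F x - toep a x" for x
    have G: "continuous_on UNIV G"
      unfolding G_def using linear_continuous_on[OF linear_toep[of a, unfolded linear_conv_bounded_linear]] cont
      by (intro continuous_intros) auto
    have GL: "U_Lipschitz C1 G" using a(1) by (simp add: G_def[abs_def])
    have Gc: "G p $ i = G q $ i" if "rk i < m" for i p q using a(2)[OF that] by (simp add: G_def)
    define i where "i = (ix m :: 'n)"
    define i' where "i' = (ix (Suc m) :: 'n)"
    have i: "rk i = m" "rk i' = Suc m" using Suc.prems by (auto simp: i_def i'_def rk_ix)
    define f where "f y = G (y *\<^sub>R last_axis) $ i" for y
    have Gf: "G p $ i = f (p $ ix 0)" for p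
      unfolding f_def by (rule depends[OF G GL]) (auto simp: i intro: Gc)
    have f_affine: "f y = f 0 + (f 1 - f 0) * y" for y
    proof (rule U_bounded_imp_affine[where \<psi> = "\<lambda>p. G p $ i'" and C = C1])
      show "continuous_on UNIV f" unfolding f_def
        by (intro continuous_intros continuous_on_compose2[OF G]) auto
      fix \<tau> p and u :: "(real,'n) vec" assume u: "exp (- \<tau>) \<le> norm u"
      define \<Delta> where "\<Delta> = G (p + U (- \<tau>) u) - G p"
      have "\<Delta> $ ix (Suc m - k) = 0" if "k \<noteq> 0" "k \<noteq> 1" "k \<le> Suc m" for k
      proof -
        have "rk (ix (Suc m - k) :: 'n) < m" using that Suc.prems by (subst rk_ix) auto
        then show ?thesis using Gc by (simp add: \<Delta>_def)
      qed
      then have "U \<tau> \<Delta> $ i' = (\<Sum>k\<le>Suc m. if k = 0 then \<Delta> $ i' else if k = 1 then \<tau> * \<Delta> $ i else 0)"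
        unfolding U_nth i by (intro sum.cong) (auto simp: i'_def i_def)
      also have "\<dots> = \<Delta> $ i' + \<tau> * \<Delta> $ i"
        by (subst sum.atMost_shift) simp
      finally have "\<Delta> $ i' + \<tau> * \<Delta> $ i = U \<tau> \<Delta> $ i'" by simp
      also have "\<bar>\<dots>\<bar> \<le> norm (U \<tau> \<Delta>)" by (rule component_le_norm_cart)
      also have "\<dots> \<le> C1 * norm u" using GL u by (simp add: U_Lipschitz_def \<Delta>_def)
      finally show "\<bar>G (p + U (- \<tau>) u) $ i' - G p $ i' + \<tau> * (f (p $ ix 0 + u $ ix 0) - f (p $ ix 0))\<bar> \<le> C1 * norm u"
        by (simp add: \<Delta>_def Gf U_nth)
    qed
    \<comment> \<open>The slope just found becomes the coefficient of X ^ m. Coordinates of smaller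
      rank are unaffected, and that of rank m becomes the constant f 0.\<close>
    define a' where "a' = a + fps_const (f 1 - f 0) * fps_X ^ m"
    have "toep a' x = toep a x + toep (fps_const (f 1 - f 0) * fps_X ^ m) x" for x :: "(real,'n) vec"
      by (simp add: a'_def toep_add_left)
    moreover have Xm: "toep (fps_const (f 1 - f 0) * fps_X ^ m) x $ j =
        (if rk j < m then 0 else (f 1 - f 0) * x $ ix (rk j - m))" for x :: "(real,'n) vec" and j
      by (auto simp: toep_const_mult toep_nth fps_X_power_nth if_distrib[of "\<lambda>u. u * _"] cong: if_cong)
    ultimately have "F p $ j - toep a' p $ j = F q $ j - toep a' q $ j" if "rk j < Suc m" for j p q
    proof (cases "rk j = m")
      case True
      then have "j = i" by (metis ix_rk i_def)
      have "G p $ j - (f 1 - f 0) * p $ ix 0 = f 0" for p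
        using f_affine[of "p $ ix 0"] by (simp add: \<open>j = i\<close> Gf)
      moreover have "toep a' p $ j = toep a p $ j + (f 1 - f 0) * p $ ix 0" for p
        using \<open>\<And>x. toep a' x = _\<close>[of p] Xm[of p j] True by simp
      ultimately have "F p $ j - toep a' p $ j = f 0" for p
        by (metis G_def vector_minus_component diff_diff_eq)
      then show ?thesis by simp
    next
      case False
      then have "rk j < m" using that by simp
      then show ?thesis using a(2)[of j p q] \<open>\<And>x. toep a' x = _\<close> Xm[of _ j] by simp
    qed
    then show ?case using U_Lipschitz_diff_toep[OF lip, of a'] by blast
  qed
  from this[of "CARD('n) - 1"] obtain a C1 where a: "U_Lipschitz C1 (\<lambda>x. F x - toep a x)"
      "\<And>i p q. rk i < CARD('n) - 1 \<Longrightarrow> F p $ i - toep a p $ i = F q $ i - toep a q $ i"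
    by auto
  define G where "G x = F x - toep a x" for x
  have G: "continuous_on UNIV G"
    unfolding G_def using linear_continuous_on[OF linear_toep[of a, unfolded linear_conv_bounded_linear]] cont
    by (intro continuous_intros) auto
  have GL: "U_Lipschitz C1 G" using a(1) by (simp add: G_def[abs_def])
  have Gc: "G p $ i = G q $ i" if "rk i < CARD('n) - 1" for i p q using a(2)[OF that] by (simp add: G_def)
  define i where "i = (ix (CARD('n) - Suc 0) :: 'n)"
  define h where "h y = G (y *\<^sub>R last_axis) $ i - G 0 $ i" for y
  have Gh: "G p $ i - G 0 $ i = h (p $ ix 0)" for p
  proof -
    have "G p $ i = G ((p $ ix 0) *\<^sub>R last_axis) $ i"
      by (rule depends[OF G GL]) (simp_all add: i_def Gc)
    then show ?thesis by (simp add: h_def)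
  qed
  have rep: "F x = F 0 + toep a x + h (x $ ix 0) *\<^sub>R first_axis" for x
  proof (rule vec_eq_iff[THEN iffD2], intro allI)
    fix j :: 'n
    have "G x $ j = G 0 $ j + (h (x $ ix 0) *\<^sub>R (first_axis :: (real,'n) vec)) $ j"
    proof (cases "j = i")
      case True
      then show ?thesis using Gh[of x] by (simp add: i_def axis_def)
    next
      case False
      then have "rk j \<noteq> CARD('n) - Suc 0" by (simp add: i_def eq_ix_iff)
      then have "rk j < CARD('n) - 1" using rk_less[of j] by simp
      then show ?thesis using False Gc[of j x 0] by (simp add: i_def axis_def)
    qed
    then show "F x $ j = (F 0 + toep a x + h (x $ ix 0) *\<^sub>R first_axis) $ j"
      by (simp add: G_def)
  qed
  have "\<bar>h (y + s) - h y\<bar> \<le> C1 * \<bar>s\<bar>" for y s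
  proof (cases "s = 0")
    case False
    define p where "p = y *\<^sub>R (last_axis :: (real,'n) vec)"
    define u where "u = s *\<^sub>R (last_axis :: (real,'n) vec)"
    have e: "exp (- (- ln \<bar>s\<bar>)) \<le> norm u" using False by (simp add: u_def)
    have "\<bar>G (p + U (- (- ln \<bar>s\<bar>)) u) $ i - G p $ i\<bar> \<le> C1 * norm u"
      by (rule leading[OF GL Gc e]) (simp add: i_def)
    moreover have "G (p + U (- (- ln \<bar>s\<bar>)) u) $ i - G p $ i = h (y + s) - h y"
      using Gh[of "p + U (- (- ln \<bar>s\<bar>)) u"] Gh[of p] by (simp add: p_def u_def U_nth)
    ultimately show ?thesis by (simp add: u_def)
  qed simp
  then show ?thesis using that rep by blast
qed

section \<open>Hausdorff null sets\<close>

lemma hausdorff_content_countable_null: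
  assumes "\<And>i :: nat. hausdorff_content \<rho> s \<delta> (A i) = 0"
  shows "hausdorff_content \<rho> s \<delta> (\<Union>i. A i) = 0"
proof -
  have "hausdorff_content \<rho> s \<delta> (\<Union>i. A i) \<le> ennreal e" if e: "e > 0" for e :: real
  proof -
    have "\<exists>U :: nat \<Rightarrow> 'a set. A i \<subseteq> (\<Union>j. U j) \<and> (\<forall>j. q_diameter \<rho> (U j) \<le> ennreal \<delta>) \<and>
        (\<Sum>j. hausdorff_gauge \<rho> s (U j)) < ennreal (e * (1/2) ^ Suc i)" for i
    proof -
      have "hausdorff_content \<rho> s \<delta> (A i) < ennreal (e * (1/2) ^ Suc i)" using assms e by simp
      then show ?thesis unfolding hausdorff_content_def by (auto simp: INF_less_iff)
    qed
    then obtain U :: "nat \<Rightarrow> nat \<Rightarrow> 'a set" where U: "\<And>i. A i \<subseteq> (\<Union>j. U i j)"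
        "\<And>i j. q_diameter \<rho> (U i j) \<le> ennreal \<delta>"
        "\<And>i. (\<Sum>j. hausdorff_gauge \<rho> s (U i j)) < ennreal (e * (1/2) ^ Suc i)"
      by metis
    define V where "V k = case_prod U (prod_decode k)" for k
    have "(\<Union>i. A i) \<subseteq> (\<Union>k. V k)"
    proof
      fix x assume "x \<in> (\<Union>i. A i)"
      then obtain i j where "x \<in> U i j" using U(1) by blast
      then have "x \<in> V (prod_encode (i, j))" by (simp add: V_def)
      then show "x \<in> (\<Union>k. V k)" by blast
    qed
    moreover have "q_diameter \<rho> (V k) \<le> ennreal \<delta>" for k
      by (simp add: V_def U(2) split: prod.split)
    ultimately have "hausdorff_content \<rho> s \<delta> (\<Union>i. A i) \<le> (\<Sum>k. hausdorff_gauge \<rho> s (V k))"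
      unfolding hausdorff_content_def by (intro INF_lower) auto
    also have "\<dots> = (\<Sum>i. \<Sum>j. hausdorff_gauge \<rho> s (U i j))"
    proof -
      have "(\<Sum>k. (\<lambda>z. hausdorff_gauge \<rho> s (case_prod U z)) (prod_decode k)) =
            (\<Sum>i. \<Sum>j. hausdorff_gauge \<rho> s (U i j))"
        using suminf_ennreal_2dimen[of "\<lambda>i. \<Sum>j. hausdorff_gauge \<rho> s (U i j)" "\<lambda>z. hausdorff_gauge \<rho> s (case_prod U z)"]
        by simp
      then show ?thesis by (simp add: V_def)
    qed
    also have "\<dots> \<le> (\<Sum>i. ennreal (e * (1/2) ^ Suc i))"
      by (intro suminf_le less_imp_le U(3)) auto
    also have "\<dots> = ennreal e"
    proof -
      have "(\<lambda>i. e * (1/2) ^ Suc i) sums (e * 1)" by (intro sums_mult power_half_series)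
      then show ?thesis using e by (simp add: suminf_ennreal2 sums_iff)
    qed
    finally show ?thesis .
  qed
  then have "hausdorff_content \<rho> s \<delta> (\<Union>i. A i) \<le> 0"
    by (metis add.left_neutral ennreal_le_epsilon)
  then show ?thesis by simp
qed

lemma hausdorff_content_le_finite_cover:
  assumes "finite \<C>" "A \<subseteq> \<Union>\<C>" "\<And>U. U \<in> \<C> \<Longrightarrow> q_diameter \<rho> U \<le> ennreal \<delta>"
  shows "hausdorff_content \<rho> s \<delta> A \<le> (\<Sum>U\<in>\<C>. hausdorff_gauge \<rho> s U)"
proof -
  obtain h where h: "bij_betw h {0..<card \<C>} \<C>" using ex_bij_betw_nat_finite[OF assms(1)] by blast
  define V where "V i = (if i < card \<C> then h i else {})" for i
  have hi: "h i \<in> \<C>" if "i < card \<C>" for i using h that by (auto simp: bij_betw_def)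
  have "A \<subseteq> (\<Union>i. V i)"
  proof
    fix x assume "x \<in> A"
    then obtain U where "U \<in> \<C>" "x \<in> U" using assms(2) by blast
    then have "U \<in> h ` {0..<card \<C>}" using h by (simp add: bij_betw_imp_surj_on)
    then obtain i where "i < card \<C>" "x \<in> h i" using \<open>x \<in> U\<close> by auto
    then show "x \<in> (\<Union>i. V i)" by (auto simp: V_def)
  qed
  moreover have "q_diameter \<rho> (V i) \<le> ennreal \<delta>" for i
    using assms(3)[OF hi] by (auto simp: V_def) (simp add: q_diameter_def bot_ennreal)
  ultimately have "hausdorff_content \<rho> s \<delta> A \<le> (\<Sum>i. hausdorff_gauge \<rho> s (V i))"
    unfolding hausdorff_content_def by (intro INF_lower) auto
  also have "\<dots> = (\<Sum>i\<in>{0..<card \<C>}. hausdorff_gauge \<rho> s (V i))"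
    by (rule suminf_finite) (auto simp: V_def hausdorff_gauge_def)
  also have "\<dots> = (\<Sum>i\<in>{0..<card \<C>}. hausdorff_gauge \<rho> s (h i))"
    by (auto simp: V_def)
  also have "\<dots> = (\<Sum>U\<in>\<C>. hausdorff_gauge \<rho> s U)"
    by (rule sum.reindex_bij_betw[OF h])
  finally show ?thesis .
qed

section \<open>Upper bound for the Hausdorff dimension\<close>

lemma exp_Ubound_tendsto_0_scaled:
  assumes "\<kappa> > 0"
  shows "(\<lambda>T. exp (- (\<kappa> * real T)) * Ubound TYPE('n::{finite,linorder}) (real T)) \<longlonglongrightarrow> 0"
proof -
  have lim: "filterlim (\<lambda>T. \<kappa> * real T) at_top sequentially"
    using assms by (intro filterlim_tendsto_pos_mult_at_top[OF tendsto_const] filterlim_real_sequentially)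
  have "(\<lambda>T. \<Sum>k<CARD('n). ((\<kappa> * real T) ^ k / exp (\<kappa> * real T)) / (\<kappa> ^ k * fact k)) \<longlonglongrightarrow> (\<Sum>k<CARD('n). 0 / (\<kappa> ^ k * fact k))"
    using assms by (intro tendsto_intros filterlim_compose[OF tendsto_power_div_exp_0 lim]) auto
  moreover have "(\<Sum>k<CARD('n). ((\<kappa> * real T) ^ k / exp (\<kappa> * real T)) / (\<kappa> ^ k * fact k)) = exp (- (\<kappa> * real T)) * Ubound TYPE('n) (real T)" for T
    using assms by (simp add: Ubound_def sum_distrib_left exp_minus field_simps)
  ultimately show ?thesis by simp
qed

lemma q_diameter_le:
  "(\<And>x y. x \<in> V \<Longrightarrow> y \<in> V \<Longrightarrow> \<rho> x y \<le> d) \<Longrightarrow> q_diameter \<rho> V \<le> ennreal d"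
  unfolding q_diameter_def by (intro SUP_least ennreal_leI)

text \<open>\<open>E T\<close> has norm at most B T, so cells with side of order 1 / B T have
  D-diameter at most exp (- T). The gauges of about B T ^ n such cells add up to order B T ^ n * exp
  (- s T), and the polynomial factor in B loses against exp ((n - s) T) because s exceeds n
  strictly.\<close>

lemma hausdorff_content_cube:
  fixes a :: real
  assumes s: "s > real CARD('n::{finite,linorder})" and "\<delta> > 0" "a > 0"
  shows "hausdorff_content D s \<delta> {x :: (real,'n) vec. \<forall>j. - a \<le> x $ j \<and> x $ j < a} = 0"
proof -
  let ?n = "CARD('n)" and ?E = "{x :: (real,'n) vec. \<forall>j. - a \<le> x $ j \<and> x $ j < a}"
  define \<kappa> where "\<kappa> = (s - real ?n) / real ?n"
  have \<kappa>: "\<kappa> > 0" using s by (simp add: \<kappa>_def)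
  define B where "B T = exp (real T) * Ubound TYPE('n) (real T)" for T
  \<comment> \<open>A cell of side 2 * a / K has norm-diameter at most n times its side, by the l1
    norm; the summand 1 keeps the number K of cells per axis positive.\<close>
  define c where "c = 2 * a * real ?n + 1"
  have c: "c > 1" using assms by (simp add: c_def)
  have bound: "hausdorff_content D s \<delta> ?E \<le> ennreal ((2 * c) ^ ?n * (exp (- (\<kappa> * real T)) * Ubound TYPE('n) (real T)) ^ ?n)"
    if T: "exp (- real T) \<le> \<delta>" for T
  proof -
    have B: "B T \<ge> 1"
      using mult_mono[of 1 "exp (real T)" 1 "Ubound TYPE('n) (real T)"] Ubound_ge_1[of "real T", where 'n='n] by (simp add: B_def)
    have cB: "c * B T \<ge> 1" using mult_mono[of 1 c 1 "B T"] B c by simp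
    define K where "K = nat \<lceil>c * B T\<rceil>"
    have K: "c * B T \<le> real K" "real K \<le> 2 * (c * B T)" "K > 0" using cB unfolding K_def by linarith+
    define cell where "cell f = {x \<in> ?E. \<forall>j. nat \<lfloor>(x $ j + a) * real K / (2 * a)\<rfloor> = f j}" for f :: "'n \<Rightarrow> nat"
    define \<C> where "\<C> = cell ` (UNIV \<rightarrow>\<^sub>E {..<K})"
    have fin: "finite \<C>" by (simp add: \<C>_def finite_PiE)
    have card: "card \<C> \<le> K ^ ?n"
      unfolding \<C>_def by (rule order_trans[OF card_image_le]) (simp_all add: finite_PiE card_PiE)
    have cover: "?E \<subseteq> \<Union>\<C>"
    proof
      fix x assume x: "x \<in> ?E"
      define f where "f j = nat \<lfloor>(x $ j + a) * real K / (2 * a)\<rfloor>" for j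
      have "f j < K" for j
      proof -
        have "0 \<le> x $ j + a" "x $ j + a < 2 * a" using x by (auto simp: algebra_simps) (smt (verit))+
        then have "(x $ j + a) * real K / (2 * a) < real K" using K(3) assms(3) by (simp add: divide_less_eq mult.commute)
        then show ?thesis unfolding f_def using K(3) by linarith
      qed
      then have "f \<in> UNIV \<rightarrow>\<^sub>E {..<K}" by auto
      moreover have "x \<in> cell f" using x by (simp add: cell_def f_def)
      ultimately show "x \<in> \<Union>\<C>" unfolding \<C>_def by blast
    qed
    have diam: "q_diameter D V \<le> ennreal (exp (- real T))" if "V \<in> \<C>" for V
    proof (rule q_diameter_le)
      fix x y assume "x \<in> V" "y \<in> V"
      then obtain f where f: "x \<in> cell f" "y \<in> cell f" using \<open>V \<in> \<C>\<close> by (auto simp: \<C>_def)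
      have "\<bar>x $ j - y $ j\<bar> \<le> 2 * a / real K" for j
      proof -
        have nn: "0 \<le> (x $ j + a) * real K / (2 * a)" "0 \<le> (y $ j + a) * real K / (2 * a)"
          using f assms(3) by (auto simp: cell_def intro!: divide_nonneg_pos mult_nonneg_nonneg) (smt (verit))+
        have "nat \<lfloor>(x $ j + a) * real K / (2 * a)\<rfloor> = nat \<lfloor>(y $ j + a) * real K / (2 * a)\<rfloor>"
          using f by (simp add: cell_def)
        then have "\<bar>(x $ j + a) * real K / (2 * a) - (y $ j + a) * real K / (2 * a)\<bar> \<le> 1"
          using nn by linarith
        moreover have "(x $ j + a) * real K / (2 * a) - (y $ j + a) * real K / (2 * a) = (x $ j - y $ j) * (real K / (2 * a))"
          by (simp only: diff_divide_distrib[symmetric] left_diff_distrib[symmetric]) simp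
        ultimately have "\<bar>x $ j - y $ j\<bar> * (real K / (2 * a)) \<le> 1" using assms(3) by (simp add: abs_mult)
        then show ?thesis using K(3) assms(3) by (simp add: field_simps)
      qed
      then have "norm (x - y) \<le> real ?n * (2 * a / real K)"
        using norm_le_l1_cart[of "x - y"] sum_mono[of UNIV "\<lambda>j. \<bar>x $ j - y $ j\<bar>" "\<lambda>_. 2 * a / real K"] by simp
      then have "norm (E (real T) (x - y)) \<le> B T * (real ?n * (2 * a / real K))"
        using B norm_E_le[of "real T" "x - y"] unfolding B_def[symmetric] by (meson mult_left_mono order_trans zero_le_one)
      also have "\<dots> = (c - 1) * B T / real K" by (simp add: c_def)
      also have "\<dots> \<le> 1" using K B by (simp add: left_diff_distrib)
      finally show "D x y \<le> exp (- real T)" by (simp add: D_le_iff)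
    qed
    have "hausdorff_content D s \<delta> ?E \<le> (\<Sum>V\<in>\<C>. hausdorff_gauge D s V)"
      using fin cover order_trans[OF diam ennreal_leI[OF T]] by (rule hausdorff_content_le_finite_cover)
    also have "\<dots> \<le> (\<Sum>V\<in>\<C>. ennreal (exp (- real T) powr s))"
    proof (rule sum_mono)
      fix V assume "V \<in> \<C>"
      then have "enn2real (q_diameter D V) \<le> exp (- real T)" using diam by (intro enn2real_leI) auto
      then have "enn2real (q_diameter D V) powr s \<le> exp (- real T) powr s"
        using s by (intro powr_mono2) auto
      then show "hausdorff_gauge D s V \<le> ennreal (exp (- real T) powr s)"
        using s by (auto simp: hausdorff_gauge_def intro: ennreal_leI)
    qed
    also have "\<dots> = ennreal (real (card \<C>) * exp (- real T) powr s)"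
      by (simp add: ennreal_mult' ennreal_of_nat_eq_real_of_nat)
    also have "\<dots> \<le> ennreal ((2 * (c * B T)) ^ ?n * exp (- real T) powr s)"
    proof (intro ennreal_leI mult_right_mono)
      have "real (card \<C>) \<le> real K ^ ?n" using card by (metis of_nat_le_iff of_nat_power)
      also have "\<dots> \<le> (2 * (c * B T)) ^ ?n" using K by (intro power_mono) auto
      finally show "real (card \<C>) \<le> (2 * (c * B T)) ^ ?n" .
    qed simp
    also have "(2 * (c * B T)) ^ ?n * exp (- real T) powr s =
        (2 * c) ^ ?n * (exp (- (\<kappa> * real T)) * Ubound TYPE('n) (real T)) ^ ?n"
    proof -
      have "exp (real T) ^ ?n * exp (- real T) powr s = exp (- (\<kappa> * real T)) ^ ?n"
        by (simp add: powr_def \<kappa>_def field_simps flip: exp_of_nat_mult exp_add)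
      then show ?thesis by (simp add: B_def power_mult_distrib mult_ac)
    qed
    finally show ?thesis .
  qed
  have "(\<lambda>T. (2 * c) ^ ?n * (exp (- (\<kappa> * real T)) * Ubound TYPE('n) (real T)) ^ ?n) \<longlonglongrightarrow> (2 * c) ^ ?n * 0 ^ ?n"
    by (intro tendsto_intros exp_Ubound_tendsto_0_scaled \<kappa>)
  moreover have "(2 * c) ^ ?n * 0 ^ ?n = 0" by (simp add: zero_power)
  ultimately have lim: "(\<lambda>T. ennreal ((2 * c) ^ ?n * (exp (- (\<kappa> * real T)) * Ubound TYPE('n) (real T)) ^ ?n)) \<longlonglongrightarrow> ennreal 0"
    by (intro tendsto_ennrealI) (simp only:)
  have "(\<lambda>T. exp (- real T)) \<longlonglongrightarrow> 0"
    using filterlim_compose[OF exp_at_bot filterlim_compose[OF filterlim_uminus_at_bot_at_top filterlim_real_sequentially]] .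
  then have "\<forall>\<^sub>F T in sequentially. exp (- real T) < \<delta>" by (rule order_tendstoD) fact
  then have "\<forall>\<^sub>F T in sequentially. hausdorff_content D s \<delta> ?E \<le> ennreal ((2 * c) ^ ?n * (exp (- (\<kappa> * real T)) * Ubound TYPE('n) (real T)) ^ ?n)"
    by eventually_elim (rule bound, simp)
  then have "hausdorff_content D s \<delta> ?E \<le> ennreal 0"
    by (intro tendsto_lowerbound[OF lim]) auto
  then show ?thesis by simp
qed

lemma hausdorff_outer_measure_UNIV_eq_0:
  assumes "s > real CARD('n::{finite,linorder})"
  shows "hausdorff_outer_measure (D :: (real,'n) vec \<Rightarrow> _) s UNIV = 0"
proof -
  have "hausdorff_content (D :: (real,'n) vec \<Rightarrow> _) s \<delta> UNIV = 0" if "\<delta> > 0" for \<delta>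
  proof -
    have "(\<Union>i::nat. {x :: (real,'n) vec. \<forall>j. - real (Suc i) \<le> x $ j \<and> x $ j < real (Suc i)}) = UNIV"
    proof -
      have "\<exists>i::nat. \<forall>j. - real (Suc i) \<le> x $ j \<and> x $ j < real (Suc i)" for x :: "(real,'n) vec"
      proof -
        obtain i :: nat where "norm x \<le> real i" using real_arch_simple by blast
        then have *: "\<bar>x $ j\<bar> \<le> real i" for j using component_le_norm_cart order_trans by blast
        have "- real (Suc i) \<le> x $ j \<and> x $ j < real (Suc i)" for j using *[of j] by (simp add: abs_le_iff)
        then show ?thesis by blast
      qed
      then show ?thesis by blast
    qed
    moreover have "hausdorff_content D s \<delta> {x :: (real,'n) vec. \<forall>j. - real (Suc i) \<le> x $ j \<and> x $ j < real (Suc i)} = 0" for i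
      by (rule hausdorff_content_cube[OF assms that]) simp
    then have "hausdorff_content D s \<delta> (\<Union>i::nat. {x :: (real,'n) vec. \<forall>j. - real (Suc i) \<le> x $ j \<and> x $ j < real (Suc i)}) = 0"
      by (rule hausdorff_content_countable_null)
    ultimately show ?thesis by (simp only:)
  qed
  then show ?thesis unfolding hausdorff_outer_measure_def by (simp add: SUP_constant)
qed

lemma hausdorff_dim_bounds:
  "0 \<le> real_of_ereal (hausdorff_dim (D :: real^'n::{finite,linorder} \<Rightarrow> _))"
  "real_of_ereal (hausdorff_dim (D :: (real,'n) vec \<Rightarrow> _)) \<le> real CARD('n)"
proof -
  have lo: "0 \<le> hausdorff_dim (D :: (real,'n) vec \<Rightarrow> _)"
    unfolding hausdorff_dim_def by (intro INF_greatest) auto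
  have le: "hausdorff_dim (D :: (real,'n) vec \<Rightarrow> _) \<le> ereal s" if "s > real CARD('n)" for s
    unfolding hausdorff_dim_def using that hausdorff_outer_measure_UNIV_eq_0[OF that]
    by (intro INF_lower) auto
  have "hausdorff_dim (D :: (real,'n) vec \<Rightarrow> _) \<le> ereal (real CARD('n))"
  proof (rule dense_ge)
    fix x assume "ereal (real CARD('n)) < x"
    then show "hausdorff_dim (D :: (real,'n) vec \<Rightarrow> _) \<le> x" using le by (cases x) auto
  qed
  then show "0 \<le> real_of_ereal (hausdorff_dim (D :: (real,'n) vec \<Rightarrow> _))"
    "real_of_ereal (hausdorff_dim (D :: (real,'n) vec \<Rightarrow> _)) \<le> real CARD('n)"
    using lo by (cases "hausdorff_dim (D :: (real,'n) vec \<Rightarrow> _)"; auto)+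
qed

text \<open>A set of D-diameter d lies in a D-ball of radius 2 * d, whose volume is W * d ^ n. For d
  at most 1 this is at most W times the gauge for each exponent s up to n, so covers with small
  total gauge have small volume.\<close>

lemma hausdorff_null_imp_negligible:
  fixes A :: "(real^'n::{finite,linorder}) set"
  assumes null: "hausdorff_outer_measure D s A = 0" and s: "0 \<le> s" "s \<le> real CARD('n)"
  shows "negligible A"
  unfolding negligible_outer
proof (intro allI impI)
  fix e :: real assume e: "e > 0"
  let ?n = "CARD('n)"
  define W where "W = unit_ball_vol (real ?n) * 2 ^ ?n"
  have W: "W > 0" by (simp add: W_def)
  have cover: "\<exists>B \<in> sets borel. V \<subseteq> B \<and> emeasure lborel B \<le> ennreal W * hausdorff_gauge D s V"
    if diam: "q_diameter D V \<le> ennreal 1" for V :: "(real,'n) vec set"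
  proof (cases "V = {}")
    case False
    then obtain x where x: "x \<in> V" by blast
    define d where "d = enn2real (q_diameter D V)"
    have fin: "q_diameter D V = ennreal d"
      using diam by (simp add: d_def ennreal_enn2real_if) (metis ennreal_1 ennreal_less_top not_le top.not_eq_extremum)
    have d: "0 \<le> d" "d \<le> 1" using diam by (auto simp: d_def intro: enn2real_leI)
    have le: "D x y \<le> d" if "y \<in> V" for y
    proof -
      have "ennreal (D x y) \<le> q_diameter D V"
        unfolding q_diameter_def using x that by (intro SUP_upper2[of x] SUP_upper) auto
      then show ?thesis using d by (simp add: fin)
    qed
    show ?thesis
    proof (cases "d = 0")
      case True
      then have "V \<subseteq> {x}" using le D_nonneg by (metis D_eq_0_iff order_antisym singletonI subsetI)
      then show ?thesis by (intro bexI[of _ "{x}"]) auto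
    next
      case False
      then have d0: "d > 0" using d by simp
      \<comment> \<open>Doubling the radius makes the inequality strict and accounts for the factor
        2 ^ n in W.\<close>
      have "V \<subseteq> {y. D x y < exp (ln (2 * d))}" using le d0 by fastforce
      moreover have "{y. D x y < exp (ln (2 * d))} \<in> sets borel"
        by (intro borel_open open_D_less continuous_intros)
      moreover have "emeasure lborel {y. D x y < exp (ln (2 * d))} \<le> ennreal W * hausdorff_gauge D s V"
      proof -
        have "emeasure lborel {y. D x y < exp (ln (2 * d))} = ennreal (W * d ^ ?n)"
          unfolding emeasure_D_ball using d0 by (simp add: W_def power_mult_distrib mult_ac)
        also have "\<dots> = ennreal W * ennreal (d ^ ?n)" using W by (simp add: ennreal_mult')
        also have "ennreal (d ^ ?n) \<le> hausdorff_gauge D s V"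
        proof (cases "s = 0")
          case True
          then show ?thesis using \<open>V \<noteq> {}\<close> d by (simp add: hausdorff_gauge_def power_le_one)
        next
          case False
          have "d ^ ?n = d powr real ?n" using d0 by (simp add: powr_realpow)
          also have "\<dots> \<le> d powr s" using d d0 s by (intro powr_mono') auto
          finally show ?thesis using False \<open>V \<noteq> {}\<close> by (simp add: hausdorff_gauge_def ennreal_leI flip: d_def)
        qed
        finally show ?thesis by (simp add: mult_left_mono)
      qed
      ultimately show ?thesis by blast
    qed
  qed (auto intro: bexI[of _ "{}"])
  have "hausdorff_content D s 1 A \<le> hausdorff_outer_measure D s A"
    unfolding hausdorff_outer_measure_def by (intro SUP_upper) auto
  then have "hausdorff_content D s 1 A < ennreal (e / (2 * W))" using null e W by simp
  then obtain V :: "nat \<Rightarrow> (real,'n) vec set" where V: "A \<subseteq> (\<Union>i. V i)" "\<And>i. q_diameter D (V i) \<le> ennreal 1"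
      "(\<Sum>i. hausdorff_gauge D s (V i)) < ennreal (e / (2 * W))"
    unfolding hausdorff_content_def by (auto simp: INF_less_iff)
  obtain B where B: "\<And>i. B i \<in> sets borel" "\<And>i. V i \<subseteq> B i" "\<And>i. emeasure lborel (B i) \<le> ennreal W * hausdorff_gauge D s (V i)"
    using cover[OF V(2)] by metis
  have "emeasure lborel (\<Union>i. B i) \<le> (\<Sum>i. emeasure lborel (B i))"
    using B(1) by (intro emeasure_subadditive_countably) auto
  also have "\<dots> \<le> (\<Sum>i. ennreal W * hausdorff_gauge D s (V i))" by (intro suminf_le B) auto
  also have "\<dots> = ennreal W * (\<Sum>i. hausdorff_gauge D s (V i))" by (rule ennreal_suminf_cmult)
  also have "\<dots> \<le> ennreal W * ennreal (e / (2 * W))" using V(3) by (intro mult_left_mono) auto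
  also have "\<dots> = ennreal (e / 2)" using W e by (simp flip: ennreal_mult')
  finally have le: "emeasure lborel (\<Union>i. B i) \<le> ennreal (e / 2)" .
  have meas: "(\<Union>i. B i) \<in> sets borel" using B(1) by auto
  have le': "emeasure lebesgue (\<Union>i. B i) \<le> ennreal (e / 2)" using le meas by simp
  then have "(\<Union>i. B i) \<in> lmeasurable"
    using meas by (intro fmeasurableI) (auto intro: le_less_trans)
  moreover have "measure lebesgue (\<Union>i. B i) \<le> e / 2"
    unfolding measure_def using le' e by (intro enn2real_leI) auto
  ultimately show "\<exists>T. A \<subseteq> T \<and> T \<in> lmeasurable \<and> measure lebesgue T < e"
    using V(1) B(2) e by (intro exI[of _ "\<Union>i. B i"]) fastforce
qed

lemma hausdorff_AE_imp_negligible: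
  "hausdorff_AE D P \<Longrightarrow> negligible {x :: real^'n::{finite,linorder}. \<not> P x}"
  unfolding hausdorff_AE_def using hausdorff_null_imp_negligible hausdorff_dim_bounds by blast

section \<open>Conformal maps\<close>

text \<open>The map \<open>\<Psi>\<close> that replaces coordinate \<open>i\<close> by its image under \<open>\<kappa>\<close> has negligible range, by Sard's
  lemma on the set where its derivative is singular and by the Lipschitz condition elsewhere.\<close>

lemma Lipschitz_ae_deriv_0_imp_const:
  fixes \<kappa> :: "real \<Rightarrow> real" and i :: "'m::{finite,wellorder}"
  assumes lip: "\<And>y s. \<bar>\<kappa> (y + s) - \<kappa> y\<bar> \<le> C * \<bar>s\<bar>"
    and null: "negligible {p :: (real,'m) vec. \<not> (\<kappa> has_real_derivative 0) (at (p $ i))}"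
  shows "\<kappa> y = \<kappa> y'"
proof -
  have False if lt: "\<kappa> y1 < \<kappa> y2" for y1 y2
  proof -
    have contk: "continuous_on A \<kappa>" for A
    proof (rule continuous_on_subset[of UNIV])
      have "C \<ge> 0" using lip[of 0 1] by simp
      then have "C-lipschitz_on UNIV \<kappa>"
      proof (rule lipschitz_onI[rotated])
        fix x y :: real
        show "dist (\<kappa> x) (\<kappa> y) \<le> C * dist x y" using lip[of y "x - y"] by (simp add: dist_real_def)
      qed
      then show "continuous_on UNIV \<kappa>" by (rule lipschitz_on_continuous_on)
    qed simp
    define \<Psi> where "\<Psi> p = p + (\<kappa> (p $ i) - p $ i) *\<^sub>R axis i 1" for p :: "(real,'m) vec"
    define S where "S = {p :: (real,'m) vec. (\<kappa> has_real_derivative 0) (at (p $ i))}"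
    have "negligible (\<Psi> ` S)"
    proof (rule baby_Sard)
      fix p assume p: "p \<in> S"
      have D1: "((\<lambda>p :: (real,'m) vec. p $ i) has_derivative (\<lambda>v. v $ i)) (at p)"
        by (rule bounded_linear_imp_has_derivative[OF bounded_linear_vec_nth])
      moreover have "(\<kappa> has_derivative (*) 0) (at (p $ i))"
        using p by (simp add: S_def has_field_derivative_def)
      ultimately have "((\<kappa> \<circ> (\<lambda>p. p $ i)) has_derivative ((*) 0 \<circ> (\<lambda>v. v $ i))) (at p)"
        by (rule diff_chain_at)
      then have "((\<lambda>p. \<kappa> (p $ i)) has_derivative (\<lambda>v. 0)) (at p)" by (simp add: o_def)
      then have "(\<Psi> has_derivative (\<lambda>v. v + (0 - v $ i) *\<^sub>R axis i 1)) (at p)"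
        unfolding \<Psi>_def by (intro derivative_intros D1)
      \<comment> \<open>At points of S the derivative is the projection that kills axis i, hence it
        is singular.\<close>
      then show "(\<Psi> has_derivative (\<lambda>v. v - v $ i *\<^sub>R axis i 1)) (at p within S)"
        by (simp add: has_derivative_at_withinI)
      have lin: "linear (\<lambda>v :: (real,'m) vec. v - v $ i *\<^sub>R axis i 1)"
        by (rule linearI) (simp_all add: algebra_simps)
      have e: "matrix (\<lambda>v :: (real,'m) vec. v - v $ i *\<^sub>R axis i 1) *v axis i 1 = matrix (\<lambda>v. v - v $ i *\<^sub>R axis i 1) *v 0"
        by (simp add: matrix_works lin)
      have "\<not> inj ((*v) (matrix (\<lambda>v :: (real,'m) vec. v - v $ i *\<^sub>R axis i 1)))"
      proof
        assume "inj ((*v) (matrix (\<lambda>v :: (real,'m) vec. v - v $ i *\<^sub>R axis i 1)))"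
        from injD[OF this e] show False by (simp add: axis_eq_0_iff)
      qed
      then show "rank (matrix (\<lambda>v :: (real,'m) vec. v - v $ i *\<^sub>R axis i 1)) < CARD('m)"
        by (simp add: less_rank_noninjective)
    qed simp
    moreover have "negligible (\<Psi> ` (- S))"
    proof (rule negligible_locally_Lipschitz_image)
      show "negligible (- S)" using null by (simp add: S_def Collect_neg_eq)
      fix x
      have "norm (\<Psi> y - \<Psi> x) \<le> (2 + C) * norm (y - x)" for y
      proof -
        have "\<Psi> y - \<Psi> x = (y - x) + (\<kappa> (y $ i) - \<kappa> (x $ i)) *\<^sub>R axis i 1 - (y $ i - x $ i) *\<^sub>R axis i 1"
          by (simp add: \<Psi>_def algebra_simps)
        also have "norm \<dots> \<le> norm (y - x) + \<bar>\<kappa> (y $ i) - \<kappa> (x $ i)\<bar> + \<bar>y $ i - x $ i\<bar>"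
          using norm_triangle_ineq4[of "(y - x) + (\<kappa> (y $ i) - \<kappa> (x $ i)) *\<^sub>R axis i 1" "(y $ i - x $ i) *\<^sub>R axis i 1"]
            norm_triangle_ineq[of "y - x" "(\<kappa> (y $ i) - \<kappa> (x $ i)) *\<^sub>R axis i 1"] by simp
        also have "\<bar>\<kappa> (y $ i) - \<kappa> (x $ i)\<bar> \<le> C * \<bar>y $ i - x $ i\<bar>" using lip[of "x $ i" "y $ i - x $ i"] by simp
        also have "norm (y - x) + C * \<bar>y $ i - x $ i\<bar> + \<bar>y $ i - x $ i\<bar> = norm (y - x) + (C + 1) * \<bar>(y - x) $ i\<bar>"
          by (simp add: algebra_simps)
        also have "\<dots> \<le> norm (y - x) + (C + 1) * norm (y - x)"
          using lip[of 0 1] component_le_norm_cart[of "y - x" i] by (intro add_left_mono mult_left_mono) auto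
        finally show ?thesis by (simp add: algebra_simps)
      qed
      then show "\<exists>T B. open T \<and> x \<in> T \<and> (\<forall>y\<in>- S \<inter> T. norm (\<Psi> y - \<Psi> x) \<le> B * norm (y - x))"
        by (intro exI[of _ UNIV] exI[of _ "2 + C"]) auto
    qed simp
    ultimately have "negligible (\<Psi> ` S \<union> \<Psi> ` (- S))" by (rule negligible_Un)
    then have "negligible (range \<Psi>)" by (simp flip: image_Un)
    \<comment> \<open>By the intermediate value theorem the range of \<Psi> contains this slab,
      which is open and nonempty.\<close>
    moreover have "{x. \<kappa> y1 < x $ i} \<inter> {x. x $ i < \<kappa> y2} \<subseteq> range \<Psi>"
    proof
      fix x :: "(real,'m) vec" assume "x \<in> {x. \<kappa> y1 < x $ i} \<inter> {x. x $ i < \<kappa> y2}"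
      then obtain y where y: "\<kappa> y = x $ i"
        using IVT'[of \<kappa> y1 "x $ i" y2] IVT2'[of \<kappa> y1 "x $ i" y2] contk
        by (cases "y1 \<le> y2") auto
      have "\<Psi> (x + (y - x $ i) *\<^sub>R axis i 1) = x" using y by (simp add: \<Psi>_def vec_eq_iff axis_def)
      then show "x \<in> range \<Psi>" by (metis rangeI)
    qed
    ultimately have "negligible ({x :: (real,'m) vec. \<kappa> y1 < x $ i} \<inter> {x. x $ i < \<kappa> y2})"
      by (rule negligible_subset)
    moreover have "open ({x :: (real,'m) vec. \<kappa> y1 < x $ i} \<inter> {x. x $ i < \<kappa> y2})"
      by (intro open_Int open_Collect_less continuous_intros)
    moreover have "axis i ((\<kappa> y1 + \<kappa> y2) / 2) \<in> {x :: (real,'m) vec. \<kappa> y1 < x $ i} \<inter> {x. x $ i < \<kappa> y2}"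
      using lt by (simp add: axis_def)
    ultimately show False using open_not_negligible by blast
  qed
  from this[of y y'] this[of y' y] show ?thesis by (meson linorder_neqE)
qed

section \<open>Estimates from upper and lower dilatations\<close>

lemma Limsup_L_upperD:
  assumes "L_upper \<rho>1 \<rho>2 f x < ereal b"
  obtains r0 where "r0 > 0" "\<And>y. 0 < \<rho>1 x y \<Longrightarrow> \<rho>1 x y < r0 \<Longrightarrow> \<rho>2 (f x) (f y) \<le> b * \<rho>1 x y"
proof -
  have "\<forall>\<^sub>F r in at_right 0. L_sup \<rho>1 \<rho>2 f x r / ereal r < ereal b"
    using assms unfolding L_upper_def by (rule Limsup_lessD)
  then obtain r0 where r0: "r0 > 0" "\<And>r. 0 < r \<Longrightarrow> r < r0 \<Longrightarrow> L_sup \<rho>1 \<rho>2 f x r / ereal r < ereal b"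
    unfolding eventually_at_right_field by blast
  have "\<rho>2 (f x) (f y) \<le> b * \<rho>1 x y" if y: "0 < \<rho>1 x y" "\<rho>1 x y < r0" for y
  proof -
    have "ereal (\<rho>2 (f x) (f y)) \<le> L_sup \<rho>1 \<rho>2 f x (\<rho>1 x y)"
      unfolding L_sup_def by (rule SUP_upper) simp
    then have "ereal (\<rho>2 (f x) (f y)) / ereal (\<rho>1 x y) \<le> L_sup \<rho>1 \<rho>2 f x (\<rho>1 x y) / ereal (\<rho>1 x y)"
      using y by (intro ereal_divide_right_mono) auto
    also have "\<dots> < ereal b" using y by (rule r0)
    finally have "\<rho>2 (f x) (f y) / \<rho>1 x y < b" using y by simp
    then show ?thesis using y by (simp add: field_simps)
  qed
  then show ?thesis using that r0 by blast
qed

lemma l_lower_le: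
  assumes "\<And>r. r > 0 \<Longrightarrow> \<exists>y. \<rho>1 x y \<ge> r \<and> \<rho>2 (f x) (f y) \<le> b * r"
  shows "l_lower \<rho>1 \<rho>2 f x \<le> ereal b"
proof -
  have "l_inf \<rho>1 \<rho>2 f x r / ereal r \<le> ereal b" if r: "r > 0" for r
  proof -
    obtain y where y: "\<rho>1 x y \<ge> r" "\<rho>2 (f x) (f y) \<le> b * r" using assms[OF r] by blast
    have "l_inf \<rho>1 \<rho>2 f x r \<le> ereal (\<rho>2 (f x) (f y))"
      unfolding l_inf_def using y by (intro INF_lower) simp
    also have "\<dots> \<le> ereal (b * r)" using y by simp
    finally have "l_inf \<rho>1 \<rho>2 f x r / ereal r \<le> ereal (b * r) / ereal r"
      using r by (intro ereal_divide_right_mono) auto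
    then show ?thesis using r by simp
  qed
  then have "l_lower \<rho>1 \<rho>2 f x \<le> Liminf (at_right 0) (\<lambda>r::real. ereal b)"
    unfolding l_lower_def by (intro Liminf_mono) (auto simp: eventually_at_right_field intro: exI[of _ 1])
  then show ?thesis by (simp add: Liminf_const)
qed

text \<open>Along the first axis F multiplies D by exactly |c|, with c the constant term of p. So
  \<open>l_lower\<close> is at most |c|, and at good points so is \<open>L_upper\<close>. The
  normalised map G is therefore infinitesimally non-expanding there, while its polynomial part has
  unit diagonal: a unit vector that keeps its component of size 1 has no room for a second
  one.\<close>

theorem conformal_structure:
  fixes F :: "real^'n::{finite,linorder} \<Rightarrow> (real,'n) vec"
  assumes n2: "CARD('n) \<ge> 2" and conf: "conformal D D F"
  obtains \<sigma> l where "\<bar>\<sigma>\<bar> = 1" "\<And>x. F x = F 0 + \<sigma> *\<^sub>R E l x"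
proof -
  obtain H where "weak_quasisymmetry F H"
    using conf quasisymmetric_imp_weak unfolding conformal_def by blast
  then interpret weak_quasisymmetry_ge2 F H
    using n2 by (simp add: weak_quasisymmetry_ge2_def weak_quasisymmetry_ge2_axioms_def)
  have "8 * H ^ 9 * R 1 0 > 0" using H_ge_1 R_pos[of 1 0] by simp
  from D_Lipschitz_imp_U_Lipschitz[OF this D_Lipschitz] obtain C0 where "U_Lipschitz C0 F"
    unfolding U_Lipschitz_def by (metis less_imp_le)
  then obtain a C h where F_eq: "\<And>x. F x = F 0 + toep a x + h (x $ ix 0) *\<^sub>R first_axis"
    and h: "\<And>y s. \<bar>h (y + s) - h y\<bar> \<le> C * \<bar>s\<bar>"
    using U_Lipschitz_structure[OF continuous_F] by metis
  have first_neq: "(ix 0 :: 'n) \<noteq> ix (CARD('n) - Suc 0)"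
    using n2 eq_ix_iff[of "CARD('n) - Suc 0" "ix 0 :: 'n"] by auto
  then have first0: "(first_axis :: (real,'n) vec) $ ix 0 = 0" by (simp add: axis_def)
  define c where "c = fps_nth a 0"
  define good where "good x \<longleftrightarrow> L_upper D D F x = l_lower D D F x \<and> 0 < L_upper D D F x \<and> L_upper D D F x < \<infinity>" for x
  have neg: "negligible {x. \<not> good x}"
    using conf hausdorff_AE_imp_negligible unfolding conformal_def good_def by blast
  then have "{x. \<not> good x} \<noteq> UNIV" by (auto dest: arg_cong[of _ _ negligible] simp: non_negligible_UNIV)
  then obtain x0 where x0: "good x0" by blast
  have "l_lower D D F x \<le> ereal \<bar>c\<bar>" for x
  proof (rule l_lower_le)
    fix r :: real assume r: "r > 0"
    have "F (x + r *\<^sub>R first_axis) = F x + (c * r) *\<^sub>R first_axis"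
      unfolding F_eq[of "x + _"] F_eq[of x] by (simp add: toep_add toep_scaleR toep_first_axis first0 c_def)
    then have "D x (x + r *\<^sub>R first_axis) = r \<and> D (F x) (F (x + r *\<^sub>R first_axis)) = \<bar>c\<bar> * r"
      using r by (simp add: D_first_axis abs_mult)
    then show "\<exists>y. r \<le> D x y \<and> D (F x) (F y) \<le> \<bar>c\<bar> * r" by (intro exI[of _ "x + r *\<^sub>R first_axis"]) simp
  qed
  then have L_le: "L_upper D D F x \<le> ereal \<bar>c\<bar>" if "good x" for x using that by (simp add: good_def)
  have "0 < ereal \<bar>c\<bar>" using L_le[OF x0] x0 unfolding good_def by (metis order.strict_trans2)
  then have c: "c \<noteq> 0" by simp
  define l where "l = ln \<bar>c\<bar>"
  define \<sigma> where "\<sigma> = sgn c"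
  have \<sigma>: "\<bar>\<sigma>\<bar> = 1" "\<sigma> * \<sigma> = 1" "\<sigma> * c = \<bar>c\<bar>" using c by (auto simp: \<sigma>_def sgn_if)
  \<comment> \<open>The polynomial part of G. Normalising by c gives it constant term 1.\<close>
  define b where "b = fps_const \<sigma> * (fps_const (exp (- l)) * fps_exp (- l)) * a"
  define G where "G x = \<sigma> *\<^sub>R E (- l) (F x - F 0)" for x
  define k where "k y = \<sigma> * exp (- l) * h y" for y
  have E_first: "E t first_axis = exp t *\<^sub>R (first_axis :: (real,'n) vec)" for t
    by (simp add: E_def toep_first_axis)
  have G_eq: "G x = toep b x + k (x $ ix 0) *\<^sub>R first_axis" for x
    unfolding G_def F_eq[of x]
    by (simp add: E_simps E_first k_def scaleR_add_right) (simp add: E_def b_def toep_const_mult mult.assoc flip: toep_mult)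
  have b0: "fps_nth b 0 = 1"
  proof -
    have "fps_nth b 0 = \<sigma> * c * inverse \<bar>c\<bar>" using c by (simp add: b_def l_def exp_minus mult_ac flip: c_def)
    then show ?thesis using \<sigma> c by simp
  qed
  \<comment> \<open>With t = ln r, E (- t) rescales the D-sphere of radius r to the Euclidean unit
    sphere, and the polynomial part commutes with this rescaling. The loss \<epsilon> comes from
    replacing |c| by the larger exp (l + d), which costs the norm of \<open>E d\<close>.\<close>
  have key: "\<exists>r0>0. \<forall>r. 0 < r \<and> r < r0 \<longrightarrow>
      norm (toep b w + ((k (p $ ix 0 + r * w $ ix 0) - k (p $ ix 0)) / r) *\<^sub>R first_axis) \<le> 1 + \<epsilon>"
    if p: "good p" and w: "norm w = 1" and \<epsilon>: "\<epsilon> > 0" for p \<epsilon> and w :: "(real,'n) vec"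
  proof -
    have "continuous (at (0::real)) (\<lambda>d. exp d * Ubound TYPE('n) d)"
      unfolding Ubound_def by (intro continuous_intros) auto
    then have "(\<lambda>d. exp d * Ubound TYPE('n) d) \<midarrow>0\<rightarrow> exp 0 * Ubound TYPE('n) 0" by (simp add: continuous_at)
    moreover have "Ubound TYPE('n) 0 = 1"
      unfolding Ubound_def by (subst sum.mono_neutral_right[of _ "{0}"]) auto
    ultimately have "\<forall>\<^sub>F d in at 0. exp d * Ubound TYPE('n) d < 1 + \<epsilon>"
      using \<epsilon> by (intro order_tendstoD) auto
    then obtain d0 where d0: "d0 > 0" "\<And>d. d \<noteq> 0 \<Longrightarrow> \<bar>d\<bar> < d0 \<Longrightarrow> exp d * Ubound TYPE('n) d < 1 + \<epsilon>"
      unfolding eventually_at by (auto simp: dist_real_def)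
    define d where "d = d0 / 2"
    have d: "d > 0" "exp d * Ubound TYPE('n) d < 1 + \<epsilon>" using d0 by (auto simp: d_def)
    have "\<bar>c\<bar> < exp (l + d)" using d c by (simp add: l_def exp_add)
    then have "L_upper D D F p < ereal (exp (l + d))" using L_le[OF p] by (simp add: order.strict_trans1)
    then obtain r0 where r0: "r0 > 0" "\<And>q. 0 < D p q \<Longrightarrow> D p q < r0 \<Longrightarrow> D (F p) (F q) \<le> exp (l + d) * D p q"
      by (rule Limsup_L_upperD) blast
    have "norm (toep b w + ((k (p $ ix 0 + r * w $ ix 0) - k (p $ ix 0)) / r) *\<^sub>R first_axis) \<le> 1 + \<epsilon>"
      if r: "0 < r" "r < r0" for r
    proof -
      define t where "t = ln r"
      have t: "exp t = r" using r by (simp add: t_def)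
      define q where "q = p + E t w"
      have Dpq: "D p q = r" unfolding q_def t[symmetric] by (rule D_E_unit) fact
      then have "D (F q) (F p) \<le> exp (l + d + t)" using r0(2)[of q] r by (subst D_sym) (simp add: exp_add t)
      then have le1: "norm (E (- (l + d + t)) (F q - F p)) \<le> 1" by (simp only: D_le_iff)
      have "E (- t) (G q - G p) = \<sigma> *\<^sub>R E (- t) (E (- l) (F q - F p))"
        by (simp add: G_def E_simps scaleR_diff_right)
      also have "E (- t) (E (- l) (F q - F p)) = E d (E (- (l + d + t)) (F q - F p))"
        unfolding E_add[symmetric] by (rule arg_cong[where f = "\<lambda>z. E z (F q - F p)"]) simp
      finally have "norm (E (- t) (G q - G p)) = norm (E d (E (- (l + d + t)) (F q - F p)))"
        using \<sigma> by simp
      also have "\<dots> \<le> exp d * Ubound TYPE('n) d * norm (E (- (l + d + t)) (F q - F p))" by (rule norm_E_le)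
      also have "\<dots> \<le> exp d * Ubound TYPE('n) d * 1"
        using le1 Ubound_ge_1[of d, where 'n='n] by (intro mult_left_mono) auto
      also have "\<dots> \<le> 1 + \<epsilon>" using d by simp
      finally have "norm (E (- t) (G q - G p)) \<le> 1 + \<epsilon>" .
      moreover have "E (- t) (G q - G p) = toep b w + ((k (p $ ix 0 + r * w $ ix 0) - k (p $ ix 0)) / r) *\<^sub>R first_axis"
      proof -
        have q0: "q $ ix 0 = p $ ix 0 + r * w $ ix 0" by (simp add: q_def E_eq_U U_nth t)
        have "G q - G p = toep b (E t w) + (k (q $ ix 0) - k (p $ ix 0)) *\<^sub>R first_axis"
          unfolding G_eq by (simp add: q_def toep_add algebra_simps)
        moreover have "E (- t) (toep b (E t w)) = toep b w"
          using toep_commute[of "fps_const (exp (- t)) * fps_exp (- t)" b "E t w"] by (simp flip: E_def)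
        ultimately show ?thesis
          by (simp add: E_simps E_first q0) (simp add: exp_minus t divide_inverse)
      qed
      ultimately show ?thesis by simp
    qed
    then show ?thesis using r0(1) by blast
  qed
  \<comment> \<open>Test vector of rank 1: its last coordinate is 0, so k does not enter, and its
    image has component 1 at rank 1 and \<open>fps_nth b j\<close> at rank j + 1, which is at most n
    - 1.\<close>
  have b_mid: "fps_nth b j = 0" if j: "1 \<le> j" "j \<le> CARD('n) - 2" for j
  proof -
    define w where "w = axis (ix 1 :: 'n) (1::real)"
    have r1: "rk (ix 1 :: 'n) = 1" "rk (ix (Suc j) :: 'n) = Suc j" using n2 j by (auto simp: rk_ix)
    then have ne: "(ix 0 :: 'n) \<noteq> ix 1" "(ix 1 :: 'n) \<noteq> ix (Suc j)" using j by (metis rk_ix_0 zero_neq_one, metis n_not_Suc_n not_one_le_zero One_nat_def Suc_inject)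
    have "norm (toep b w) \<le> 1 + \<epsilon>" if "\<epsilon> > 0" for \<epsilon>
    proof -
      have "norm w = 1" by (simp add: w_def)
      from key[OF x0 this that] obtain r0 where r0: "r0 > 0" "\<And>r. 0 < r \<Longrightarrow> r < r0 \<Longrightarrow>
        norm (toep b w + ((k (x0 $ ix 0 + r * w $ ix 0) - k (x0 $ ix 0)) / r) *\<^sub>R first_axis) \<le> 1 + \<epsilon>" by blast
      have "w $ ix 0 = 0" using ne by (simp add: w_def axis_def)
      then show ?thesis using r0(2)[of "r0 / 2"] r0(1) by simp
    qed
    then have "norm (toep b w) \<le> 1" by (rule field_le_epsilon)
    then have "(norm (toep b w))\<^sup>2 \<le> 1" by (simp add: power_le_one)
    then have "(\<Sum>i\<in>UNIV. (toep b w $ i)\<^sup>2) \<le> 1"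
      by (simp add: norm_vec_def L2_set_def sum_nonneg)
    moreover have "(\<Sum>i\<in>{ix 1, ix (Suc j)}. (toep b w $ i)\<^sup>2) \<le> (\<Sum>i\<in>UNIV. (toep b w $ i)\<^sup>2)"
      by (rule sum_mono2) auto
    moreover have "toep b w $ ix 1 = 1" "toep b w $ ix (Suc j) = fps_nth b j"
      unfolding w_def toep_axis r1 using b0 by auto
    then have "(\<Sum>i\<in>{ix 1, ix (Suc j)}. (toep b w $ i)\<^sup>2) = 1 + (fps_nth b j)\<^sup>2" using ne by simp
    ultimately have "1 + (fps_nth b j)\<^sup>2 \<le> 1" by linarith
    then show ?thesis by simp
  qed
  \<comment> \<open>The coefficient of X ^ (n - 1) contributes a multiple of x_n e_1 and is merged
    with k.\<close>
  define \<kappa> where "\<kappa> y = k y + fps_nth b (CARD('n) - 1) * y" for y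
  have toep_b: "toep b x = x + (fps_nth b (CARD('n) - 1) * x $ ix 0) *\<^sub>R first_axis" for x :: "(real,'n) vec"
  proof (rule vec_eq_iff[THEN iffD2], intro allI)
    fix i :: 'n
    have "toep b x $ i = (\<Sum>k\<in>insert 0 {1..rk i}. fps_nth b k * x $ ix (rk i - k))"
      unfolding toep_nth by (rule sum.cong) auto
    also have "\<dots> = x $ i + (\<Sum>k\<in>{1..rk i}. fps_nth b k * x $ ix (rk i - k))"
      by (subst sum.insert) (auto simp: b0)
    also have "(\<Sum>k\<in>{1..rk i}. fps_nth b k * x $ ix (rk i - k)) =
        (if i = ix (CARD('n) - Suc 0) then fps_nth b (CARD('n) - 1) * x $ ix 0 else 0)"
    proof (cases "i = ix (CARD('n) - Suc 0)")
      case True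
      then have rki: "rk i = CARD('n) - 1" by simp
      have "(\<Sum>k\<in>{1..rk i}. fps_nth b k * x $ ix (rk i - k)) = (\<Sum>k\<in>{rk i}. fps_nth b k * x $ ix (rk i - k))"
        using rki n2 by (intro sum.mono_neutral_right) (auto intro!: b_mid)
      then show ?thesis using True rki by simp
    next
      case False
      then have "rk i \<noteq> CARD('n) - Suc 0" by (simp add: eq_ix_iff)
      then have "rk i \<le> CARD('n) - 2" using rk_less[of i] by simp
      then show ?thesis using False by (auto intro!: sum.neutral b_mid)
    qed
    finally show "toep b x $ i = (x + (fps_nth b (CARD('n) - 1) * x $ ix 0) *\<^sub>R first_axis) $ i"
      by (simp add: axis_def)
  qed
  have G_eq': "G x = x + \<kappa> (x $ ix 0) *\<^sub>R first_axis" for x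
    unfolding G_eq toep_b by (simp add: \<kappa>_def algebra_simps)
  \<comment> \<open>For the test vectors \<open>last_axis\<close> and its negative the blow-up is w
    + z e_1 with squared norm 1 + z ^ 2, where z is up to sign the difference quotient of
    \<kappa>.\<close>
  have deriv: "(\<kappa> has_real_derivative 0) (at (p $ ix 0))" if p: "good p" for p
  proof -
    let ?y = "p $ ix 0"
    have ev: "\<exists>r0>0. \<forall>r. 0 < r \<and> r < r0 \<longrightarrow> \<bar>(\<kappa> (?y + s * r) - \<kappa> ?y) / (s * r)\<bar> \<le> \<epsilon>"
      if s: "s = 1 \<or> s = -1" and \<epsilon>: "\<epsilon> > 0" for s \<epsilon> :: real
    proof -
      \<comment> \<open>Chosen so that the bound 1 + \<epsilon>' on the norm becomes |z| <=
        \<epsilon>.\<close>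
      define \<epsilon>' where "\<epsilon>' = sqrt (1 + \<epsilon>\<^sup>2) - 1"
      have \<epsilon>': "\<epsilon>' > 0" "(1 + \<epsilon>')\<^sup>2 = 1 + \<epsilon>\<^sup>2" using \<epsilon> by (auto simp: \<epsilon>'_def)
      define w where "w = s *\<^sub>R (last_axis :: (real,'n) vec)"
      have "norm w = 1" using s by (auto simp: w_def)
      from key[OF p this \<epsilon>'(1)] obtain r0 where r0: "r0 > 0" "\<And>r. 0 < r \<Longrightarrow> r < r0 \<Longrightarrow>
        norm (toep b w + ((k (?y + r * w $ ix 0) - k ?y) / r) *\<^sub>R first_axis) \<le> 1 + \<epsilon>'" by blast
      have "\<bar>(\<kappa> (?y + s * r) - \<kappa> ?y) / (s * r)\<bar> \<le> \<epsilon>" if r: "0 < r" "r < r0" for r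
      proof -
        define z where "z = (\<kappa> (?y + s * r) - \<kappa> ?y) / r"
        have w0: "w $ ix 0 = s" by (simp add: w_def)
        have "toep b w + ((k (?y + r * w $ ix 0) - k ?y) / r) *\<^sub>R first_axis = w + z *\<^sub>R first_axis"
          unfolding toep_b w0 using r by (simp add: z_def \<kappa>_def algebra_simps diff_divide_distrib add_divide_distrib flip: scaleR_add_left)
        then have "norm (w + z *\<^sub>R first_axis) \<le> 1 + \<epsilon>'" using r0(2)[OF r] by simp
        then have "(norm (w + z *\<^sub>R first_axis))\<^sup>2 \<le> (1 + \<epsilon>')\<^sup>2" by (intro power_mono) auto
        then have le: "(\<Sum>i\<in>UNIV. ((w + z *\<^sub>R first_axis) $ i)\<^sup>2) \<le> 1 + \<epsilon>\<^sup>2"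
          unfolding \<epsilon>' by (simp add: norm_vec_def L2_set_def sum_nonneg)
        have "(\<Sum>i\<in>{ix 0, ix (CARD('n) - Suc 0)}. ((w + z *\<^sub>R first_axis) $ i)\<^sup>2) \<le> (\<Sum>i\<in>UNIV. ((w + z *\<^sub>R first_axis) $ i)\<^sup>2)"
          by (rule sum_mono2) auto
        moreover have "(w + z *\<^sub>R first_axis) $ ix 0 = s" "(w + z *\<^sub>R first_axis) $ ix (CARD('n) - Suc 0) = z"
          using first_neq by (auto simp: w_def axis_def)
        then have "(\<Sum>i\<in>{ix 0, ix (CARD('n) - Suc 0)}. ((w + z *\<^sub>R first_axis) $ i)\<^sup>2) = s\<^sup>2 + z\<^sup>2"
          using first_neq by (simp only: sum.insert[of "{ix (CARD('n) - Suc 0)}" "ix 0"] finite.intros sum.empty singleton_iff simp_thms) simp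
        ultimately have "s\<^sup>2 + z\<^sup>2 \<le> 1 + \<epsilon>\<^sup>2" using le by linarith
        then have "z\<^sup>2 \<le> \<epsilon>\<^sup>2" using s by auto
        then have "\<bar>z\<bar> \<le> \<epsilon>" using \<epsilon> by (simp add: abs_le_square_iff[symmetric])
        moreover have "\<bar>(\<kappa> (?y + s * r) - \<kappa> ?y) / (s * r)\<bar> = \<bar>z\<bar>" using s by (auto simp: z_def abs_divide)
        ultimately show ?thesis by simp
      qed
      then show ?thesis using r0(1) by blast
    qed
    show ?thesis
      unfolding DERIV_def LIM_def
    proof (intro allI impI)
      fix \<epsilon> :: real assume e: "0 < \<epsilon>"
      obtain r1 r2 where r: "r1 > 0" "\<And>r. 0 < r \<Longrightarrow> r < r1 \<Longrightarrow> \<bar>(\<kappa> (?y + 1 * r) - \<kappa> ?y) / (1 * r)\<bar> \<le> \<epsilon> / 2"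
        "r2 > 0" "\<And>r. 0 < r \<Longrightarrow> r < r2 \<Longrightarrow> \<bar>(\<kappa> (?y + -1 * r) - \<kappa> ?y) / (-1 * r)\<bar> \<le> \<epsilon> / 2"
        using ev[of 1 "\<epsilon> / 2"] ev[of "-1" "\<epsilon> / 2"] e by (metis half_gt_zero)
      have "\<bar>(\<kappa> (?y + x) - \<kappa> ?y) / x\<bar> < \<epsilon>" if "x \<noteq> 0" "\<bar>x\<bar> < min r1 r2" for x
      proof (cases "x > 0")
        case True
        then have "\<bar>(\<kappa> (?y + x) - \<kappa> ?y) / x\<bar> \<le> \<epsilon> / 2"
          using r(2)[of x, unfolded mult_1] that by simp
        then show ?thesis using e by linarith
      next
        case False
        then have "\<bar>(\<kappa> (?y + x) - \<kappa> ?y) / x\<bar> \<le> \<epsilon> / 2"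
          using r(4)[of "- x", unfolded minus_mult_minus mult_1] that by simp
        then show ?thesis using e by linarith
      qed
      then show "\<exists>s>0. \<forall>x. x \<noteq> 0 \<and> dist x 0 < s \<longrightarrow> dist ((\<kappa> (?y + x) - \<kappa> ?y) / x) 0 < \<epsilon>"
        using r by (intro exI[of _ "min r1 r2"]) (simp add: dist_real_def)
    qed
  qed
  have k_lip: "\<bar>\<kappa> (y + s) - \<kappa> y\<bar> \<le> (\<bar>\<sigma> * exp (- l)\<bar> * C + \<bar>fps_nth b (CARD('n) - 1)\<bar>) * \<bar>s\<bar>" for y s
  proof -
    have "\<kappa> (y + s) - \<kappa> y = \<sigma> * exp (- l) * (h (y + s) - h y) + fps_nth b (CARD('n) - 1) * s"
      by (simp add: \<kappa>_def k_def algebra_simps)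
    also have "\<bar>\<dots>\<bar> \<le> \<bar>\<sigma> * exp (- l)\<bar> * \<bar>h (y + s) - h y\<bar> + \<bar>fps_nth b (CARD('n) - 1)\<bar> * \<bar>s\<bar>"
      by (rule order_trans[OF abs_triangle_ineq]) (simp add: abs_mult)
    also have "\<dots> \<le> \<bar>\<sigma> * exp (- l)\<bar> * (C * \<bar>s\<bar>) + \<bar>fps_nth b (CARD('n) - 1)\<bar> * \<bar>s\<bar>"
      by (intro add_mono mult_left_mono h) auto
    finally show ?thesis by (simp add: algebra_simps)
  qed
  have "negligible {p :: (real,'n) vec. \<not> (\<kappa> has_real_derivative 0) (at (p $ ix 0))}"
    by (rule negligible_subset[OF neg]) (use deriv in auto)
  then have "negligible (of_wo -` {p :: (real,'n) vec. \<not> (\<kappa> has_real_derivative 0) (at (p $ ix 0))})"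
    by (rule negligible_of_wo_vimage)
  then have "negligible {p :: (real,'n wo) vec. \<not> (\<kappa> has_real_derivative 0) (at (p $ Abs_wo (ix 0)))}"
    by (simp add: of_wo_def vimage_def)
  then have const: "\<kappa> y = \<kappa> 0" for y
    using Lipschitz_ae_deriv_0_imp_const[OF k_lip] by blast
  have "G 0 = 0" by (simp add: G_def)
  then have "\<kappa> 0 *\<^sub>R (first_axis :: (real,'n) vec) = 0" unfolding G_eq'[of 0] by simp
  then have Gx: "G x = x" for x unfolding G_eq'[of x] const[of "x $ ix 0"] by simp
  have "F x = F 0 + \<sigma> *\<^sub>R E l x" for x
  proof -
    have "\<sigma> *\<^sub>R E l (G x) = (\<sigma> * \<sigma>) *\<^sub>R (F x - F 0)" unfolding G_def E_simps by simp
    then show ?thesis using Gx[of x] \<sigma> by simp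
  qed
  then show ?thesis using that \<sigma>(1) by blast
qed

section \<open>Isometries and boundary maps\<close>

abbreviation d_G :: "(real^'n::{finite,linorder}) \<times> real \<Rightarrow> ((real,'n) vec) \<times> real \<Rightarrow> real" where
  "d_G \<equiv> G_dist jordan_matrix"

section \<open>Lengths of paths and the triangle inequality\<close>

definition speed :: "(real^'n::{finite,linorder}) \<times> real \<Rightarrow> ((real,'n) vec) \<times> real \<Rightarrow> real" where
  "speed p u = sqrt ((norm (E (- snd p) (fst u)))\<^sup>2 + (snd u)\<^sup>2)"

text \<open>Left translation by the inverse of p is affine, with linear part E (- t) on the
  horizontal factor and the identity on the vertical one; this linear part is its derivative
  everywhere.\<close>

lemma sqrt_G_metric: "sqrt (G_metric jordan_matrix p u u) = speed p u"
  for p u :: "(real^'n::{finite,linorder}) \<times> real"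
proof -
  have 1: "matrix_exp (- (t *\<^sub>R jordan_matrix)) *v x = E (- t) x" for t and x :: "(real,'n) vec"
    using matrix_exp_jordan[of "-t" x] by simp
  have lin: "linear (\<lambda>q. (E (- snd p) (fst q), snd q))"
    by (rule linearI) (simp_all add: E_simps)
  have eq: "G_mult jordan_matrix (G_inverse jordan_matrix p) =
      (\<lambda>q. (- E (- snd p) (fst p), - snd p) + (E (- snd p) (fst q), snd q))"
    by (rule ext) (simp add: G_mult_def G_inverse_def 1)
  have "(G_mult jordan_matrix (G_inverse jordan_matrix p) has_derivative (\<lambda>q. 0 + (E (- snd p) (fst q), snd q))) (at p)"
    unfolding eq by (intro has_derivative_add has_derivative_const linear_imp_has_derivative lin)
  then have "(G_mult jordan_matrix (G_inverse jordan_matrix p) has_derivative (\<lambda>q. (E (- snd p) (fst q), snd q))) (at p)"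
    by simp
  then have "frechet_derivative (G_mult jordan_matrix (G_inverse jordan_matrix p)) (at p) = (\<lambda>q. (E (- snd p) (fst q), snd q))"
    by (rule frechet_derivative_at[symmetric])
  then show ?thesis by (simp add: G_metric_def Let_def speed_def dot_square_norm norm_Pair)
qed

lemma speed_scaleR: "speed p (k *\<^sub>R u) = \<bar>k\<bar> * speed p u"
proof -
  have "(norm (E (- snd p) (fst (k *\<^sub>R u))))\<^sup>2 + (snd (k *\<^sub>R u))\<^sup>2 = k\<^sup>2 * ((norm (E (- snd p) (fst u)))\<^sup>2 + (snd u)\<^sup>2)"
    by (simp add: E_simps power_mult_distrib algebra_simps)
  then show ?thesis by (simp add: speed_def real_sqrt_mult)
qed

lemma speed_nonneg [simp]: "0 \<le> speed p u"
  by (simp add: speed_def)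

definition has_length :: "(real \<Rightarrow> (real^'n::{finite,linorder}) \<times> real) \<Rightarrow> real \<Rightarrow> bool" where
  "has_length c l \<longleftrightarrow> ((\<lambda>t. speed (c t) (vector_derivative c (at t))) has_integral l) {0..1}"

definition lengths :: "(real^'n::{finite,linorder}) \<times> real \<Rightarrow> ((real,'n) vec) \<times> real \<Rightarrow> real set" where
  "lengths p q = {l. \<exists>c. valid_path c \<and> pathstart c = p \<and> pathfinish c = q \<and> has_length c l}"

lemma G_dist_eq: "d_G p q = Inf (lengths p q)"
  unfolding G_dist_def lengths_def has_length_def sqrt_G_metric ..

lemma lengths_nonneg: "l \<in> lengths p q \<Longrightarrow> 0 \<le> l"
  unfolding lengths_def has_length_def by (auto intro: has_integral_nonneg)

lemma bdd_below_lengths: "bdd_below (lengths p q)"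
  using lengths_nonneg by (meson bdd_belowI)

lemma G_dist_le: "l \<in> lengths p q \<Longrightarrow> d_G p q \<le> l"
  unfolding G_dist_eq by (rule cInf_lower[OF _ bdd_below_lengths])

lemma valid_path_differentiable:
  assumes "valid_path c"
  obtains S where "finite S" "\<And>t. t \<in> {0..1} - S \<Longrightarrow> c differentiable at t"
  using assms by (auto simp: valid_path_def piecewise_C1_differentiable_on_def C1_differentiable_on_eq)

text \<open>The segment stays at heights of absolute value at most M, and \<open>norm_E_mono\<close>
  bounds its horizontal speed there by the value at height - M.\<close>

lemma lengths_linepath:
  "\<exists>l \<in> lengths p q. l \<le> exp (\<bar>snd p\<bar> + \<bar>snd q\<bar>) * Ubound TYPE('n) (\<bar>snd p\<bar> + \<bar>snd q\<bar>) * norm (fst q - fst p) + \<bar>snd q - snd p\<bar>"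
  for p q :: "(real^'n::{finite,linorder}) \<times> real"
proof -
  let ?c = "linepath p q"
  define M where "M = \<bar>snd p\<bar> + \<bar>snd q\<bar>"
  define B where "B = exp M * Ubound TYPE('n) M * norm (fst q - fst p) + \<bar>snd q - snd p\<bar>"
  have vd: "vector_derivative ?c (at t) = q - p" for t by (rule vector_derivative_linepath_at)
  have "continuous_on {0..1} (\<lambda>t. speed (?c t) (q - p))"
    unfolding speed_def linepath_def by (intro continuous_intros)
  then have int: "(\<lambda>t. speed (?c t) (q - p)) integrable_on {0..1}" by (rule integrable_continuous_interval)
  then have "has_length ?c (integral {0..1} (\<lambda>t. speed (?c t) (q - p)))"
    unfolding has_length_def vd by (rule integrable_integral)
  then have mem: "integral {0..1} (\<lambda>t. speed (?c t) (q - p)) \<in> lengths p q"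
    unfolding lengths_def by (auto intro!: exI[of _ ?c] valid_path_linepath)
  have "speed (?c t) (q - p) \<le> B" if t: "t \<in> {0..1}" for t
  proof -
    have "\<bar>snd (?c t)\<bar> \<le> M"
    proof -
      have "\<bar>(1 - t) * snd p\<bar> \<le> \<bar>snd p\<bar>" "\<bar>t * snd q\<bar> \<le> \<bar>snd q\<bar>"
        using t by (auto simp: abs_mult intro: mult_left_le_one_le)
      then show ?thesis by (simp add: linepath_def M_def)
    qed
    then have "norm (E (- snd (?c t)) (fst (q - p))) \<le> norm (E M (fst (q - p)))" by (intro norm_E_mono) auto
    also have "\<dots> \<le> exp M * Ubound TYPE('n) M * norm (fst (q - p))" by (rule norm_E_le)
    finally have "speed (?c t) (q - p) \<le> sqrt ((exp M * Ubound TYPE('n) M * norm (fst (q - p)))\<^sup>2 + (snd (q - p))\<^sup>2)"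
      unfolding speed_def snd_diff by (intro real_sqrt_le_mono add_right_mono power_mono) auto
    also have "\<dots> \<le> \<bar>exp M * Ubound TYPE('n) M * norm (fst (q - p))\<bar> + \<bar>snd (q - p)\<bar>"
      by (rule sqrt_sum_squares_le_sum_abs)
    also have "\<dots> = B" using Ubound_ge_1[of M, where 'n='n] by (simp add: B_def abs_mult)
    finally show ?thesis .
  qed
  then have "integral {0..1} (\<lambda>t. speed (?c t) (q - p)) \<le> integral {0..1} (\<lambda>t::real. B)"
    by (intro integral_le int) auto
  then show ?thesis using mem by (auto simp: B_def M_def)
qed

lemma lengths_nonempty: "lengths p q \<noteq> {}"
  using lengths_linepath[of p q] by blast

text \<open>On each half the time is halved and the speed doubled, so lengths add. The junction and
  the points of non-differentiability form a finite set, which the integral ignores.\<close>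

lemma lengths_join:
  assumes "l1 \<in> lengths p q" "l2 \<in> lengths q r"
  shows "l1 + l2 \<in> lengths p r"
proof -
  obtain g1 g2 where g1: "valid_path g1" "pathstart g1 = p" "pathfinish g1 = q" "has_length g1 l1"
    and g2: "valid_path g2" "pathstart g2 = q" "pathfinish g2 = r" "has_length g2 l2"
    using assms by (auto simp: lengths_def)
  obtain S1 where S1: "finite S1" "\<And>t. t \<in> {0..1} - S1 \<Longrightarrow> g1 differentiable at t"
    using valid_path_differentiable[OF g1(1)] by metis
  obtain S2 where S2: "finite S2" "\<And>t. t \<in> {0..1} - S2 \<Longrightarrow> g2 differentiable at t"
    using valid_path_differentiable[OF g2(1)] by metis
  let ?g = "g1 +++ g2"
  have i1: "((\<lambda>x. 2 * speed (g1 (2*x)) (vector_derivative g1 (at (2*x)))) has_integral l1) {0..1/2}"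
   and i2: "((\<lambda>x. 2 * speed (g2 (2*x - 1)) (vector_derivative g2 (at (2*x - 1)))) has_integral l2) {1/2..1}"
    using has_integral_affinity01 [OF g1(4)[unfolded has_length_def], where m= 2 and c=0, THEN has_integral_cmul [where c=2]]
          has_integral_affinity01 [OF g2(4)[unfolded has_length_def], where m= 2 and c="-1", THEN has_integral_cmul [where c=2]]
    by (simp_all only: image_affinity_atLeastAtMost_div_diff, simp_all add: mult_ac)
  have d1: "vector_derivative ?g (at z) = 2 *\<^sub>R vector_derivative g1 (at (2*z))"
    if "0 \<le> z" "z < 1/2" "2*z \<notin> S1" for z
  proof (rule vector_derivative_at [OF has_vector_derivative_transform_within])
    show "0 < \<bar>z - 1/2\<bar>" using that by auto
    have "((*) 2 has_vector_derivative 2) (at z)"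
      by (simp add: has_vector_derivative_def has_derivative_def bounded_linear_mult_left)
    moreover have "(g1 has_vector_derivative vector_derivative g1 (at (2 * z))) (at (2 * z))"
      using S1(2)[of "2 * z"] that by (simp add: vector_derivative_works)
    ultimately show "((\<lambda>x. g1 (2 * x)) has_vector_derivative 2 *\<^sub>R vector_derivative g1 (at (2 * z))) (at z)"
      by (intro vector_diff_chain_at [simplified o_def])
  qed (use that in \<open>simp_all add: joinpaths_def dist_real_def abs_if split: if_split_asm\<close>)
  have d2: "vector_derivative ?g (at z) = 2 *\<^sub>R vector_derivative g2 (at (2*z - 1))"
    if "1/2 < z" "z \<le> 1" "2*z - 1 \<notin> S2" for z
  proof (rule vector_derivative_at [OF has_vector_derivative_transform_within])
    show "0 < \<bar>z - 1/2\<bar>" using that by auto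
    have "((\<lambda>x. 2 * x - 1) has_vector_derivative 2) (at z)"
      by (simp add: has_vector_derivative_def has_derivative_def bounded_linear_mult_left)
    moreover have "(g2 has_vector_derivative vector_derivative g2 (at (2 * z - 1))) (at (2 * z - 1))"
      using S2(2)[of "2 * z - 1"] that by (simp add: vector_derivative_works)
    ultimately show "((\<lambda>x. g2 (2 * x - 1)) has_vector_derivative 2 *\<^sub>R vector_derivative g2 (at (2 * z - 1))) (at z)"
      by (intro vector_diff_chain_at [simplified o_def])
  qed (use that in \<open>simp_all add: joinpaths_def dist_real_def abs_if split: if_split_asm\<close>)
  have "((\<lambda>x. speed (?g x) (vector_derivative ?g (at x))) has_integral l1) {0..1/2}"
  proof (rule has_integral_spike_finite[OF _ _ i1])
    show "finite (insert (1/2) ((\<lambda>x. x / 2) ` S1))" using S1(1) by simp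
    fix x assume x: "x \<in> {0..1/2} - insert (1/2) ((\<lambda>x. x / 2) ` S1)"
    have "x = (2 * x) / 2" by simp
    with x have "2 * x \<notin> S1" by (metis DiffD2 imageI insertI2)
    then have "vector_derivative ?g (at x) = 2 *\<^sub>R vector_derivative g1 (at (2*x))" using x by (intro d1) auto
    then show "speed (?g x) (vector_derivative ?g (at x)) = 2 * speed (g1 (2*x)) (vector_derivative g1 (at (2*x)))"
      using x by (simp add: speed_scaleR joinpaths_def)
  qed
  moreover have "((\<lambda>x. speed (?g x) (vector_derivative ?g (at x))) has_integral l2) {1/2..1}"
  proof (rule has_integral_spike_finite[OF _ _ i2])
    show "finite (insert (1/2) ((\<lambda>x. (x + 1) / 2) ` S2))" using S2(1) by simp
    fix x assume x: "x \<in> {1/2..1} - insert (1/2) ((\<lambda>x. (x + 1) / 2) ` S2)"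
    have "x = ((2 * x - 1) + 1) / 2" by simp
    with x have "2 * x - 1 \<notin> S2" by (metis DiffD2 imageI insertI2)
    then have "vector_derivative ?g (at x) = 2 *\<^sub>R vector_derivative g2 (at (2*x - 1))" using x by (intro d2) auto
    then show "speed (?g x) (vector_derivative ?g (at x)) = 2 * speed (g2 (2*x - 1)) (vector_derivative g2 (at (2*x - 1)))"
      using x by (simp add: speed_scaleR joinpaths_def)
  qed
  ultimately have "has_length ?g (l1 + l2)"
    unfolding has_length_def by (intro has_integral_combine[where c = "1/2"]) auto
  moreover have "valid_path ?g" using g1 g2 by (intro valid_path_join) auto
  ultimately show ?thesis unfolding lengths_def using g1 g2 by (auto intro!: exI[of _ ?g])
qed

lemma G_dist_triangle: "d_G p r \<le> d_G p q + d_G q r"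
proof (rule field_le_epsilon)
  fix e :: real assume e: "e > 0"
  obtain l1 where l1: "l1 \<in> lengths p q" "l1 < d_G p q + e / 2"
    using cInf_lessD[OF lengths_nonempty, of p q "d_G p q + e / 2"] e by (auto simp: G_dist_eq)
  obtain l2 where l2: "l2 \<in> lengths q r" "l2 < d_G q r + e / 2"
    using cInf_lessD[OF lengths_nonempty, of q r "d_G q r + e / 2"] e by (auto simp: G_dist_eq)
  show "d_G p r \<le> d_G p q + d_G q r + e"
    using G_dist_le[OF lengths_join[OF l1(1) l2(1)]] l1(2) l2(2) by simp
qed

text \<open>For \<sigma> = 1 this is left translation by (v, l); for \<sigma> = -1 it is that
  translation preceded by the automorphism that sends (x, t) to (- x, t).\<close>

definition affine_iso :: "real \<Rightarrow> real \<Rightarrow> real^'n::{finite,linorder} \<Rightarrow> ((real,'n) vec) \<times> real \<Rightarrow> ((real,'n) vec) \<times> real" where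
  "affine_iso \<sigma> l v p = (v + \<sigma> *\<^sub>R E l (fst p), snd p + l)"

text \<open>The change of height is compensated by E l, since E (- (t + l)) after E l is E (- t); so
  the map preserves the speed of a path at every differentiable time.\<close>

lemma lengths_affine_iso:
  fixes p q :: "(real^'n::{finite,linorder}) \<times> real"
  assumes "\<bar>\<sigma>\<bar> = 1" "l0 \<in> lengths p q"
  shows "l0 \<in> lengths (affine_iso \<sigma> l v p) (affine_iso \<sigma> l v q)"
proof -
  obtain c where c: "valid_path c" "pathstart c = p" "pathfinish c = q" "has_length c l0"
    using assms by (auto simp: lengths_def)
  define L where "L q = (\<sigma> *\<^sub>R E l (fst q), snd q)" for q :: "(real,'n) vec \<times> real"
  have L: "bounded_linear L"
    unfolding linear_conv_bounded_linear[symmetric] by (rule linearI) (simp_all add: L_def E_simps algebra_simps)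
  have T: "affine_iso \<sigma> l v q = L q + (v, l)" for q by (simp add: affine_iso_def L_def)
  obtain S where S: "finite S" "c C1_differentiable_on ({0..1} - S)" and cont: "continuous_on {0..1} c"
    using c(1) by (auto simp: valid_path_def piecewise_C1_differentiable_on_def)
  obtain c' where c': "\<And>t. t \<in> {0..1} - S \<Longrightarrow> (c has_vector_derivative c' t) (at t)" "continuous_on ({0..1} - S) c'"
    using S(2) unfolding C1_differentiable_on_def by blast
  have der: "((\<lambda>t. L (c t) + (v, l)) has_vector_derivative L (c' t)) (at t)" if "t \<in> {0..1} - S" for t
    using bounded_linear.has_vector_derivative[OF L c'(1)[OF that]] by (simp only: has_vector_derivative_add_const)
  have "(\<lambda>t. L (c t) + (v, l)) C1_differentiable_on ({0..1} - S)"
    unfolding C1_differentiable_on_def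
    by (intro exI[of _ "\<lambda>t. L (c' t)"] conjI ballI der bounded_linear.continuous_on[OF L c'(2)])
  moreover have "continuous_on {0..1} (\<lambda>t. L (c t) + (v, l))"
    by (intro continuous_intros bounded_linear.continuous_on[OF L cont])
  ultimately have "valid_path (\<lambda>t. L (c t) + (v, l))"
    using S(1) by (auto simp: valid_path_def piecewise_C1_differentiable_on_def)
  moreover have "has_length (\<lambda>t. L (c t) + (v, l)) l0"
    unfolding has_length_def
  proof (rule has_integral_spike_finite[OF S(1) _ c(4)[unfolded has_length_def]])
    fix t assume t: "t \<in> {0..1} - S"
    have v: "vector_derivative (\<lambda>t. L (c t) + (v, l)) (at t) = L (c' t)" "vector_derivative c (at t) = c' t"
      using der[OF t] c'(1)[OF t] by (simp_all add: vector_derivative_at)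
    have "E (- (snd (c t) + l)) (\<sigma> *\<^sub>R E l (fst (c' t))) = \<sigma> *\<^sub>R E (- snd (c t)) (fst (c' t))"
      by (simp add: E_simps) (simp flip: E_add)
    then show "speed (L (c t) + (v, l)) (vector_derivative (\<lambda>t. L (c t) + (v, l)) (at t)) = speed (c t) (vector_derivative c (at t))"
      unfolding v using assms(1) by (simp add: speed_def L_def)
  qed
  ultimately show ?thesis
    unfolding lengths_def T using c by (auto intro!: exI[of _ "\<lambda>t. L (c t) + (v, l)"] simp: pathstart_def pathfinish_def)
qed

lemma affine_iso_inverse:
  assumes "\<bar>\<sigma>\<bar> = 1"
  shows "affine_iso \<sigma> (- l) (- \<sigma> *\<^sub>R E (- l) v) (affine_iso \<sigma> l v p) = p"
    "affine_iso \<sigma> l v (affine_iso \<sigma> (- l) (- \<sigma> *\<^sub>R E (- l) v) p) = p"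
proof -
  have "\<sigma> * \<sigma> = 1" using assms by (metis abs_mult_self_eq mult_1)
  then show "affine_iso \<sigma> (- l) (- \<sigma> *\<^sub>R E (- l) v) (affine_iso \<sigma> l v p) = p"
    "affine_iso \<sigma> l v (affine_iso \<sigma> (- l) (- \<sigma> *\<^sub>R E (- l) v) p) = p"
    by (simp_all add: affine_iso_def E_simps scaleR_add_right scaleR_diff_right prod_eq_iff)
qed

text \<open>The inverse map has the same form, so even the sets of lengths coincide.\<close>

lemma G_dist_affine_iso:
  assumes "\<bar>\<sigma>\<bar> = 1"
  shows "d_G (affine_iso \<sigma> l v p) (affine_iso \<sigma> l v q) = d_G p q"
proof -
  have "lengths (affine_iso \<sigma> l v p) (affine_iso \<sigma> l v q) = lengths p q"
    using lengths_affine_iso[OF assms, of _ p q l v]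
      lengths_affine_iso[OF assms, of _ "affine_iso \<sigma> l v p" "affine_iso \<sigma> l v q" "- l" "- \<sigma> *\<^sub>R E (- l) v"]
    unfolding affine_iso_inverse[OF assms] by blast
  then show ?thesis by (simp add: G_dist_eq)
qed

lemma bij_affine_iso: "\<bar>\<sigma>\<bar> = 1 \<Longrightarrow> bij (affine_iso \<sigma> l v)"
  by (rule o_bij[of "affine_iso \<sigma> (- l) (- \<sigma> *\<^sub>R E (- l) v)"])
     (rule ext, simp only: o_apply id_apply affine_iso_inverse)+

text \<open>By \<open>same\<close>, b and b' are geodesic rays simultaneously; if neither is, both
  endpoints are empty and the equation still holds. The bounds in \<open>near\<close> are given in
  both orders because symmetry of d is not among the assumptions.\<close>

lemma boundary_extension_endpoint:
  assumes iso: "bij_isometry d f" and tri: "\<And>p q r. d p r \<le> d p q + d q r"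
    and near: "\<And>t. t \<ge> 0 \<Longrightarrow> d (f (b t)) (b' t) \<le> C" "\<And>t. t \<ge> 0 \<Longrightarrow> d (b' t) (f (b t)) \<le> C"
    and same: "\<And>s t. d (b' s) (b' t) = d (b s) (b t)"
  shows "boundary_extension d f (endpoint d b) = endpoint d b'"
proof -
  have fd: "d (f p) (f q) = d p q" for p q using iso by (simp add: bij_isometry_def)
  have geo: "geodesic_ray d (f \<circ> c) \<longleftrightarrow> geodesic_ray d c" for c by (simp add: geodesic_ray_def fd)
  have geob: "geodesic_ray d b' \<longleftrightarrow> geodesic_ray d b" by (simp add: geodesic_ray_def same)
  show ?thesis
  proof (intro set_eqI iffI)
    fix c assume "c \<in> boundary_extension d f (endpoint d b)"
    then obtain e C1 C2 where e: "geodesic_ray d b" "geodesic_ray d c"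
      "\<And>t. t \<ge> 0 \<Longrightarrow> d (b t) (e t) \<le> C1" "\<And>t. t \<ge> 0 \<Longrightarrow> d (f (e t)) (c t) \<le> C2"
      by (auto simp: boundary_extension_def endpoint_def asymptotic_rays_def)
    have "d (b' t) (c t) \<le> C + C1 + C2" if "t \<ge> 0" for t
      using tri[of "b' t" "c t" "f (b t)"] tri[of "f (b t)" "c t" "f (e t)"] near(2)[OF that] e(3,4)[OF that] fd[of "b t" "e t"] by linarith
    then show "c \<in> endpoint d b'" using e geob by (auto simp: endpoint_def asymptotic_rays_def)
  next
    fix c assume "c \<in> endpoint d b'"
    then obtain C1 where c: "geodesic_ray d b'" "geodesic_ray d c" "\<And>t. t \<ge> 0 \<Longrightarrow> d (b' t) (c t) \<le> C1"
      by (auto simp: endpoint_def asymptotic_rays_def)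
    define e where "e = inv f \<circ> c"
    have fe: "f \<circ> e = c" using iso by (auto simp: e_def bij_isometry_def bij_is_surj surj_f_inv_f)
    then have "geodesic_ray d e" using geo c by metis
    moreover have "d (b t) (e t) \<le> C + C1" if "t \<ge> 0" for t
      using tri[of "f (b t)" "c t" "b' t"] near(1)[OF that] c(3)[OF that] fd[of "b t" "e t"] fe by (auto simp: fun_eq_iff)
    ultimately have "e \<in> endpoint d b" using c geob by (auto simp: endpoint_def asymptotic_rays_def)
    moreover have "d (c t) (c t) \<le> 0" if "t \<ge> 0" for t using c(2) that by (simp add: geodesic_ray_def)
    then have "(f \<circ> e, c) \<in> asymptotic_rays d" unfolding fe using c by (auto simp: asymptotic_rays_def)
    ultimately show "c \<in> boundary_extension d f (endpoint d b)"
      unfolding boundary_extension_def by blast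
  qed
qed

text \<open>The isometry that lowers heights by a is applied before joining by a segment. With a
  near s and t the exponential factor stays bounded however high or low the two points lie.\<close>

lemma G_dist_height_le:
  fixes x y :: "real^'n::{finite,linorder}"
  shows "d_G (x, s) (y, t) \<le> exp (\<bar>s - a\<bar> + \<bar>t - a\<bar>) * Ubound TYPE('n) (\<bar>s - a\<bar> + \<bar>t - a\<bar>) * norm (E (- a) (y - x)) + \<bar>t - s\<bar>"
proof -
  have "d_G (x, s) (y, t) = d_G (affine_iso 1 (- a) 0 (x, s)) (affine_iso 1 (- a) 0 (y, t))"
    by (rule G_dist_affine_iso[symmetric]) simp
  also have "\<dots> = d_G (E (- a) x, s - a) (E (- a) y, t - a)" by (simp add: affine_iso_def)
  finally have eq: "d_G (x, s) (y, t) = d_G (E (- a) x, s - a) (E (- a) y, t - a)" .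
  obtain l where "l \<in> lengths (E (- a) x, s - a) (E (- a) y, t - a)"
     "l \<le> exp (\<bar>s - a\<bar> + \<bar>t - a\<bar>) * Ubound TYPE('n) (\<bar>s - a\<bar> + \<bar>t - a\<bar>) * norm (E (- a) (y - x)) + \<bar>t - s\<bar>"
    using lengths_linepath[of "(E (- a) x, s - a)" "(E (- a) y, t - a)"] by (auto simp: E_simps)
  then show ?thesis unfolding eq using G_dist_le order_trans by blast
qed

lemma is_boundary_map_affine_iso:
  fixes F :: "real^'n::{finite,linorder} \<Rightarrow> (real,'n) vec"
  assumes \<sigma>: "\<bar>\<sigma>\<bar> = 1" and F: "\<And>x. F x = v + \<sigma> *\<^sub>R E l x"
  shows "is_boundary_map jordan_matrix (affine_iso \<sigma> l v) F"
proof -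
  let ?f = "affine_iso \<sigma> l v"
  have iso: "bij_isometry d_G ?f"
    using bij_affine_iso[OF \<sigma>] G_dist_affine_iso[OF \<sigma>] unfolding bij_isometry_def by blast
  have "boundary_extension d_G ?f (endpoint d_G (vertical_line 0)) = endpoint d_G (vertical_line 0)"
  proof (rule boundary_extension_endpoint[OF iso G_dist_triangle])
    let ?C = "exp \<bar>l\<bar> * Ubound TYPE('n) \<bar>l\<bar> * norm v + \<bar>l\<bar>"
    fix t :: real assume t: "t \<ge> 0"
    \<comment> \<open>Upwards, the horizontal displacement v is contracted, so the image ray stays
      at bounded distance.\<close>
    have "norm (E (- t) v) \<le> norm v" using norm_E_mono[of "- t" 0 v] t by simp
    then have *: "exp \<bar>l\<bar> * Ubound TYPE('n) \<bar>l\<bar> * norm (E (- t) v) \<le> exp \<bar>l\<bar> * Ubound TYPE('n) \<bar>l\<bar> * norm v"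
      using Ubound_ge_1[of "\<bar>l\<bar>", where 'n='n] by (intro mult_left_mono) auto
    have "d_G (?f (vertical_line 0 t)) (vertical_line 0 t) \<le> exp \<bar>l\<bar> * Ubound TYPE('n) \<bar>l\<bar> * norm (E (- t) v) + \<bar>l\<bar>"
      using G_dist_height_le[of v "t + l" 0 t t] by (simp add: affine_iso_def vertical_line_def E_simps)
    then show "d_G (?f (vertical_line 0 t)) (vertical_line 0 t) \<le> ?C"
      using * by linarith
    have "d_G (vertical_line 0 t) (?f (vertical_line 0 t)) \<le> exp \<bar>l\<bar> * Ubound TYPE('n) \<bar>l\<bar> * norm (E (- t) v) + \<bar>l\<bar>"
      using G_dist_height_le[of 0 t v "t + l" t] by (simp add: affine_iso_def vertical_line_def E_simps)
    then show "d_G (vertical_line 0 t) (?f (vertical_line 0 t)) \<le> ?C"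
      using * by linarith
  qed simp
  moreover have "boundary_extension d_G ?f (endpoint d_G (\<lambda>t. vertical_line x (- t))) = endpoint d_G (\<lambda>t. vertical_line (F x) (- t))" for x
  proof (rule boundary_extension_endpoint[OF iso G_dist_triangle])
    fix t :: real
    \<comment> \<open>The line over x is carried onto the line over F x, shifted by l in height, so
      the horizontal term vanishes.\<close>
    show "d_G (?f (vertical_line x (- t))) (vertical_line (F x) (- t)) \<le> \<bar>l\<bar>"
      using G_dist_height_le[of "F x" "- t + l" "F x" "- t" "- t"] by (simp add: affine_iso_def vertical_line_def F)
    show "d_G (vertical_line (F x) (- t)) (?f (vertical_line x (- t))) \<le> \<bar>l\<bar>"
      using G_dist_height_le[of "F x" "- t" "F x" "- t + l" "- t"] by (simp add: affine_iso_def vertical_line_def F)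
  next
    fix s t
    show "d_G (vertical_line (F x) (- s)) (vertical_line (F x) (- t)) = d_G (vertical_line x (- s)) (vertical_line x (- t))"
      using G_dist_affine_iso[of 1 0 "F x - x" "(x, - s)" "(x, - t)"] by (simp add: affine_iso_def vertical_line_def)
  qed
  ultimately show ?thesis
    by (simp add: is_boundary_map_def top_endpoint_def lower_endpoint_def)
qed

theorem theorem8p1:
  fixes F :: "real^('n::{finite,linorder}) \<Rightarrow> real^('n::{finite,linorder})"
  assumes "CARD('n) \<ge> 2"
    and "conformal (parabolic_quasimetric jordan_matrix) (parabolic_quasimetric jordan_matrix) F"
  shows "\<exists>f. bij_isometry (G_dist jordan_matrix) f \<and> is_boundary_map jordan_matrix f F"
proof -
  obtain \<sigma> l where \<sigma>: "\<bar>\<sigma>\<bar> = 1" and F: "\<And>x. F x = F 0 + \<sigma> *\<^sub>R E l x"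
    using conformal_structure[OF assms] by blast
  have "bij_isometry d_G (affine_iso \<sigma> l (F 0))"
    using bij_affine_iso[OF \<sigma>] G_dist_affine_iso[OF \<sigma>] unfolding bij_isometry_def by blast
  moreover have "is_boundary_map jordan_matrix (affine_iso \<sigma> l (F 0)) F"
    by (rule is_boundary_map_affine_iso[OF \<sigma> F])
  ultimately show ?thesis by blast
qed

end
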